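(* Let $n\ge1$ be an integer and let $m$ be the odd part of $n$. If $n\equiv0\pmod4$, then $$r_7(1,2^5,4;n^2)=r_7(1^2,2^3,4^2;n^2)=r_7(1^3,2,4^3;n^2),\qquad r_7(1^3,2^3,4;n^2)=r_7(1^4,2,4^2;n^2).$$ If $n\equiv2\pmod4$, then \begin{align*} 4C_3(m)&=r_7(1,2^5,4;n^2)-2\,r_7(1,2^3,4^3;n^2)=r_7(1^2,2^3,4^2;n^2)-2\,r_7(1,2^3,4^3;n^2)\\ &=r_7(1,2^5,4;n^2)-2\,r_7(1^2,2,4^4;n^2)=r_7(1^2,2^3,4^2;n^2)-2\,r_7(1^2,2,4^4;n^2),\\ 8C_3(m)&=r_7(1,2^5,4;n^2)-r_7(1^3,2,4^3;n^2)=r_7(1^2,2^3,4^2;n^2)-r_7(1^3,2,4^3;n^2),\\ r_7(1,2^5,4;n^2)&=4\,r_7(1^2,2,4^4;n^2)-r_7(1^3,2,4^3;n^2). \end{align*}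
   Context: For ${\bf a}=(a_1,\ldots,a_7)$ of positive integers, $r_7({\bf a};N)=\#\{x\in\mathbb{Z}^7:\sum a_ix_i^2=N\}$; exponents denote multiplicities, e.g. $(1,2^5,4)=(1,2,2,2,2,2,4)$. With $\eta(z)=q^{1/24}\prod_{n\ge1}(1-q^n)$, $q=e^{2\pi iz}$, let $\Delta_{6,4}(z)=\eta^{12}(2z)=\sum_{n\ge1}\tau_{6,4}(n)q^n$. For odd $m\ge1$, with $\left(\frac{-2}{p}\right)$ the Legendre symbol and the product over odd primes, $$C_3(m)=\tau_{6,4}(m)\prod_{p\ge3}\left(1-p^2\left(\frac{-2}{p}\right)\frac{\tau_{6,4}(m/p)}{\tau_{6,4}(m)}\right),$$ with $\tau_{6,4}(m/p)=0$ if $p\nmid m$; this is understood (also when $\tau_{6,4}(m)=0$) as $\prod_{p^{\lambda_p}\|m}\left(\tau_{6,4}(p^{\lambda_p})-p^2\left(\frac{-2}{p}\right)\tau_{6,4}(p^{\lambda_p-1})\right)$, the product over primes $p\mid m$. *)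

theory Defs
  imports "HOL-Analysis.Analysis" "HOL-Number_Theory.Number_Theory"
begin

text \<open>The coefficient vector is a list of length 7; the solution vectors in \<open>\<int>\<^sup>7\<close> are the
  integer lists of length 7.\<close>

definition r7 :: "nat list \<Rightarrow> nat \<Rightarrow> nat" where
  "r7 a N = card {x :: int list. length x = 7 \<and> (\<Sum>i<7. int (a ! i) * (x ! i)\<^sup>2) = int N}"

definition q_exp :: "complex \<Rightarrow> complex" where
  "q_exp z = exp (2 * of_real pi * \<i> * z)"

text \<open>The fractional power \<open>q\<^bsup>1/24\<^esup>\<close> means \<open>exp (2\<pi>\<i>z/24)\<close>. The index of the product is
  shifted so that it starts at \<open>n = 0\<close>.\<close>

definition dedekind_eta :: "complex \<Rightarrow> complex" where
  "dedekind_eta z = q_exp (z / 24) * (\<Prod>n. 1 - q_exp z ^ Suc n)"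

definition Delta_6_4 :: "complex \<Rightarrow> complex" where
  "Delta_6_4 z = dedekind_eta (2 * z) ^ 12"

text \<open>The coefficients of the expansion of \<^const>\<open>Delta_6_4\<close> in powers of \<open>q\<close> on the upper
  half-plane. They are unique by the identity theorem for power series, and integers because
  \<open>\<eta>(2z)\<^sup>1\<^sup>2 = q \<Prod> (1 - q\<^sup>2\<^sup>n)\<^sup>1\<^sup>2\<close>. The expansion starts at \<open>n = 1\<close>, so the value at \<open>0\<close> is \<open>0\<close>.\<close>

definition tau_6_4 :: "nat \<Rightarrow> int" where
  "tau_6_4 = (THE t. t 0 = 0 \<and>
     (\<forall>z. Im z > 0 \<longrightarrow> (\<lambda>n. of_int (t n) * q_exp z ^ n) sums Delta_6_4 z))"

text \<open>For odd \<open>m\<close>, the division-free form of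
  \<open>\<tau>(m) \<Prod>\<^sub>p (1 - p\<^sup>2 (-2/p) \<tau>(m/p) / \<tau>(m))\<close>, meaningful also if \<open>\<tau>(m) = 0\<close>.\<close>

definition C3 :: "nat \<Rightarrow> int" where
  "C3 m = (\<Prod>p\<in>prime_factors m.
     tau_6_4 (p ^ multiplicity p m)
       - (int p)\<^sup>2 * Legendre (-2) (int p) * tau_6_4 (p ^ (multiplicity p m - 1)))"

end

theory Submission
  imports Defs "HOL-Computational_Algebra.Formal_Laurent_Series"
    "HOL-Complex_Analysis.Cauchy_Integral_Formula"
begin

text \<open>Write \<open>\<theta>(q) = \<Sum> q\<^bsup>x\<^sup>2\<^esup>\<close>, so that the numbers \<open>r\<^sub>7\<close> are coefficients of products of \<open>\<theta>(q)\<close>, \<open>\<theta>(q\<^sup>2)\<close>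
and \<open>\<theta>(q\<^sup>4)\<close>. Let \<open>z\<close> and \<open>w\<close> be the parts of \<open>\<theta>(q)\<close> coming from even and from odd \<open>x\<close>, and let
\<open>P\<close>, \<open>S\<close> be \<open>z\<close>, \<open>w\<close> with \<open>q\<^sup>2\<close> for \<open>q\<close>. Then \<open>\<theta>(q) = z + w\<close>, \<open>\<theta>(q\<^sup>2) = P + S\<close>, \<open>\<theta>(q\<^sup>4) = z\<close>,
and the substitution \<open>(x, y) = (a + b, a - b)\<close> gives \<open>z\<^sup>2 = P\<^sup>2 + S\<^sup>2\<close>, \<open>w\<^sup>2 = 2PS\<close>. Coefficients at even
exponents therefore only see a polynomial in \<open>P\<close> and \<open>S\<close>, and the residue of the exponent modulo 8
only sees the degree in \<open>S\<close> modulo 4. This settles all relations that do not mention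
\<open>C\<^sub>3\<close>, and leaves the differences equal to multiples of the coefficient at \<open>4m\<^sup>2\<close> of the cusp form
\<open>f = P S\<^sup>2 (P\<^sup>4 - S\<^sup>4)\<close> of weight \<open>7/2\<close> (\<open>r7_relations\<close>). What remains is
\<open>f[4m\<^sup>2] = 4 C\<^sub>3(m)\<close> for odd \<open>m\<close> (\<open>cusp_series_C3\<close>), an explicit Shimura correspondence.

With \<open>D = q d/dq\<close> let \<open>K = P\<cdot>DS - S\<cdot>DP\<close>. Two classical identities are needed:
\<open>K = 2PS(P\<^sup>4 - S\<^sup>4)\<close> and \<open>K = 4J\<^sup>2\<close> with \<open>J = \<Sum> s q\<^bsup>s\<^sup>2\<^esup>\<close> over \<open>s \<equiv> 1 (mod 4)\<close>. The second is
again the substitution \<open>(a + b, a - b)\<close>. For the first, the error \<open>e(q)\<close> of the identity for \<open>z, w\<close>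
satisfies \<open>z w e(q) = 2(P\<^sup>2 - S\<^sup>2) e(q\<^sup>2)\<close>, so a nonzero \<open>e\<close> would vanish to order exactly 1 at
\<open>q = 0\<close>, which the first coefficients exclude. Jacobi's identity \<open>\<Prod>(1 - q\<^sup>n)\<^sup>3 = \<Sum> (-1)\<^sup>j (2j+1) q\<^bsup>j(j+1)/2\<^esup>\<close>,
obtained here as a limit of a finite product formula, says that \<open>J\<close> is \<open>\<eta>(8z)\<^sup>3\<close>;
hence \<open>\<tau>\<^sub>6\<^sub>,\<^sub>4(m)\<close> is the coefficient of \<open>J\<^sup>4\<close> at \<open>4m\<close> (\<open>tau_6_4_eq\<close>).

Let \<open>B(n) = \<Sum> (x\<^sup>2 - 2y\<^sup>2)\<close> over \<open>x\<^sup>2 + 2y\<^sup>2 = n\<close>, a theta series of weight 3 attached to \<open>\<int>[\<surd>-2]\<close>.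
For odd \<open>n\<close> it is the coefficient of \<open>(P\<cdot>Dw - w\<cdot>DP) + (S\<cdot>Dw - w\<cdot>DS)\<close>, and the two
identities yield, for odd \<open>m\<close> and with \<open>u\<close> running over odd numbers,
\<open>2 f[4m\<^sup>2] = - \<Sum> B(u(4m - u))\<close> and \<open>\<Sum> B(u) B(4m - u) = -16 \<tau>\<^sub>6\<^sub>,\<^sub>4(m)\<close>.
Arithmetic of \<open>\<int>[\<surd>-2]\<close> shows that \<open>B/2\<close> satisfies the Hecke relations
\<open>b(p) b(n) = b(pn) + p\<^sup>2 (-2/p) b(n/p)\<close> (\<open>hecke_theta_prime_mult\<close>), which express \<open>b(uv)\<close> through the
products \<open>b(u/d) b(v/d)\<close> for square-free \<open>d\<close>. Substituting this in the first sum and using the second turns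
\<open>f[4m\<^sup>2]\<close> into \<open>4 \<Sum> \<mu>(d) d\<^sup>2 (-2/d) \<tau>\<^sub>6\<^sub>,\<^sub>4(m/d)\<close> over \<open>d\<close> dividing \<open>m\<close>.

This is \<open>4 C\<^sub>3(m)\<close> once \<open>\<tau>\<^sub>6\<^sub>,\<^sub>4\<close> is multiplicative on odd numbers. For that, \<open>8 \<tau>\<^sub>6\<^sub>,\<^sub>4(m)\<close> is
written as a sum of a harmonic quartic over the integral quaternions of norm \<open>m\<close>
(\<open>jacobi_series_fourth_power\<close>). A quaternion of norm \<open>mn\<close> with coprime odd \<open>m\<close>, \<open>n\<close> is a product of
quaternions of norms \<open>m\<close> and \<open>n\<close> in exactly eight ways, and the quartic is multiplicative on average
(\<open>sum_harmonic4_coprime\<close>).\<close>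

unbundle no vec_syntax
unbundle fps_syntax

section \<open>Generating functions of weighted lattice sums\<close>

text \<open>The condition under which \<open>\<Sum>\<^bsub>x \<in> X\<^esub> c(x) q\<^bsup>Q(x)\<^esup>\<close> makes sense as a formal power series. The exponent
is an integer, so that changes of variables remain polynomial identities over \<open>\<int>\<close>.\<close>

definition finite_fibres :: "'a set \<Rightarrow> ('a \<Rightarrow> int) \<Rightarrow> bool" where
  "finite_fibres X Q \<longleftrightarrow> (\<forall>x\<in>X. Q x \<ge> 0) \<and> (\<forall>n. finite {x\<in>X. Q x = n})"

definition genfun :: "'a set \<Rightarrow> ('a \<Rightarrow> int) \<Rightarrow> ('a \<Rightarrow> int) \<Rightarrow> int fps" where
  "genfun X Q c = Abs_fps (\<lambda>n. \<Sum>x\<in>{x\<in>X. Q x = int n}. c x)"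

lemma genfun_nth: "genfun X Q c $ n = (\<Sum>x\<in>{x\<in>X. Q x = int n}. c x)"
  by (simp add: genfun_def)

lemma finite_fibresD: "finite_fibres X Q \<Longrightarrow> finite {x\<in>X. Q x = n}"
  by (simp add: finite_fibres_def)

lemma finite_fibres_Times:
  assumes "finite_fibres X Q" "finite_fibres Y R"
  shows "finite_fibres (X \<times> Y) (\<lambda>(x, y). Q x + R y)"
proof -
  have "finite {p \<in> X \<times> Y. (case p of (x, y) \<Rightarrow> Q x + R y) = n}" for n
  proof (rule finite_subset)
    show "{p \<in> X \<times> Y. (case p of (x, y) \<Rightarrow> Q x + R y) = n}
      \<subseteq> (\<Union>i\<in>{0..n}. {x\<in>X. Q x = i} \<times> {y\<in>Y. R y = n - i})"
      using assms unfolding finite_fibres_def by fastforce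
    show "finite (\<Union>i\<in>{0..n}. {x\<in>X. Q x = i} \<times> {y\<in>Y. R y = n - i})"
      using assms unfolding finite_fibres_def by auto
  qed
  then show ?thesis
    using assms unfolding finite_fibres_def by auto
qed

lemma genfun_mult:
  assumes "finite_fibres X Q" "finite_fibres Y R"
  shows "genfun X Q c * genfun Y R d
    = genfun (X \<times> Y) (\<lambda>(x, y). Q x + R y) (\<lambda>(x, y). c x * d y)"
proof (rule fps_ext)
  fix n
  let ?A = "\<lambda>i. {x\<in>X. Q x = int i}" and ?B = "\<lambda>j. {y\<in>Y. R y = int j}"
  have eq: "{p \<in> X \<times> Y. (case p of (x, y) \<Rightarrow> Q x + R y) = int n}
      = (\<Union>i\<in>{0..n}. ?A i \<times> ?B (n - i))" (is "?L = ?R")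
  proof
    show "?L \<subseteq> ?R"
    proof
      fix p assume "p \<in> ?L"
      then obtain x y where p: "p = (x, y)" "x \<in> X" "y \<in> Y" "Q x + R y = int n" by auto
      then have "Q x \<ge> 0" "R y \<ge> 0" using assms by (auto simp: finite_fibres_def)
      then have "p \<in> ?A (nat (Q x)) \<times> ?B (n - nat (Q x))" "nat (Q x) \<in> {0..n}"
        using p by auto
      then show "p \<in> ?R" by blast
    qed
  qed (use assms in auto)
  have "(genfun X Q c * genfun Y R d) $ n
      = (\<Sum>i=0..n. \<Sum>p\<in>?A i \<times> ?B (n - i). case p of (x, y) \<Rightarrow> c x * d y)"
    by (simp add: fps_mult_nth genfun_nth sum_product sum.cartesian_product)
  also have "\<dots> = (\<Sum>p\<in>(\<Union>i\<in>{0..n}. ?A i \<times> ?B (n - i)). case p of (x, y) \<Rightarrow> c x * d y)"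
    by (rule sum.UNION_disjoint [symmetric])
      (use assms in \<open>auto simp: finite_fibres_def\<close>)
  also have "\<dots> = genfun (X \<times> Y) (\<lambda>(x, y). Q x + R y) (\<lambda>(x, y). c x * d y) $ n"
    by (simp only: genfun_nth eq)
  finally show "(genfun X Q c * genfun Y R d) $ n
    = genfun (X \<times> Y) (\<lambda>(x, y). Q x + R y) (\<lambda>(x, y). c x * d y) $ n" .
qed

lemma bij_betw_subset_fibre:
  assumes "bij_betw h X Y" "\<And>x. x \<in> X \<Longrightarrow> R (h x) = Q x"
  shows "bij_betw h {x\<in>X. Q x = n} {y\<in>Y. R y = n}"
proof (rule bij_betw_subset [OF assms(1)])
  show "h ` {x\<in>X. Q x = n} = {y\<in>Y. R y = n}"
    using assms(2) bij_betw_imp_surj_on [OF assms(1)] by auto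
qed auto

text \<open>All identities between theta functions below are changes of variables in this sense.\<close>

lemma genfun_reindex:
  assumes "bij_betw h X Y" "\<And>x. x \<in> X \<Longrightarrow> R (h x) = Q x" "\<And>x. x \<in> X \<Longrightarrow> d (h x) = c x"
  shows "genfun X Q c = genfun Y R d"
proof (rule fps_ext)
  fix n
  have "bij_betw h {x\<in>X. Q x = int n} {y\<in>Y. R y = int n}"
    using assms(1,2) by (rule bij_betw_subset_fibre)
  then show "genfun X Q c $ n = genfun Y R d $ n"
    unfolding genfun_nth
    by (subst sum.reindex_bij_betw [symmetric], assumption) (rule sum.cong, auto simp: assms(3))
qed

lemma genfun_diff: "genfun X Q (\<lambda>x. c x - d x) = genfun X Q c - genfun X Q d"
  by (rule fps_ext) (simp add: genfun_nth sum_subtractf)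

lemma genfun_cmult: "genfun X Q (\<lambda>x. k * c x) = fps_const k * genfun X Q c"
  by (rule fps_ext) (simp add: genfun_nth sum_distrib_left)

lemma genfun_union:
  assumes "finite_fibres X Q" "finite_fibres Y Q" "X \<inter> Y = {}"
  shows "genfun (X \<union> Y) Q c = genfun X Q c + genfun Y Q c"
proof (rule fps_ext)
  fix n
  have "{x \<in> X \<union> Y. Q x = int n} = {x\<in>X. Q x = int n} \<union> {x\<in>Y. Q x = int n}" by auto
  then show "genfun (X \<union> Y) Q c $ n = (genfun X Q c + genfun Y Q c) $ n"
    using assms by (simp add: genfun_nth finite_fibres_def) (subst sum.union_disjoint, auto)
qed

lemma genfun_cong:
  assumes "X = Y" "\<And>x. x \<in> Y \<Longrightarrow> Q x = R x" "\<And>x. x \<in> Y \<Longrightarrow> c x = d x"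
  shows "genfun X Q c = genfun Y R d"
  by (rule genfun_reindex [where h = id]) (use assms in auto)

lemma genfun_dilate:
  assumes "k > 0"
  shows "genfun X Q c oo fps_X ^ k = genfun X (\<lambda>x. int k * Q x) c"
proof (rule fps_ext)
  fix n
  show "(genfun X Q c oo fps_X ^ k) $ n = genfun X (\<lambda>x. int k * Q x) c $ n"
  proof (cases "k dvd n")
    case True
    then obtain j where "n = k * j" by auto
    then show ?thesis using assms by (simp add: fps_nth_compose_X_power genfun_nth)
  next
    case False
    then have "{x\<in>X. int k * Q x = int n} = {}"
      by (auto) (metis dvd_triv_left int_dvd_int_iff)
    with False show ?thesis by (simp only: fps_nth_compose_X_power genfun_nth) simp
  qed
qed

text \<open>The derivation \<open>q d/dq\<close>.\<close>

definition euler :: "'a::comm_ring_1 fps \<Rightarrow> 'a fps" where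
  "euler f = fps_X * fps_deriv f"

lemma euler_nth: "euler f $ n = of_nat n * f $ n"
  by (cases n) (simp_all add: euler_def)

lemma euler_mult: "euler (f * g) = euler f * g + f * euler g"
  by (simp add: euler_def algebra_simps)

lemma euler_add: "euler (f + g) = euler f + euler g"
  by (simp add: euler_def algebra_simps)

lemma euler_dilate:
  assumes "k > 0"
  shows "euler (f oo fps_X ^ k) = fps_const (of_nat k) * (euler f oo fps_X ^ k)"
proof (rule fps_ext)
  fix n
  show "euler (f oo fps_X ^ k) $ n = (fps_const (of_nat k) * (euler f oo fps_X ^ k)) $ n"
  proof (cases "k dvd n")
    case True
    then obtain j where "n = k * j" by (elim dvdE)
    then show ?thesis using assms
      by (simp add: euler_nth fps_nth_compose_X_power mult.assoc del: fps_const_mult_left)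
  next
    case False
    then show ?thesis
      by (simp add: euler_nth fps_nth_compose_X_power)
  qed
qed

lemma euler_genfun: "euler (genfun X Q c) = genfun X Q (\<lambda>x. Q x * c x)"
  by (rule fps_ext) (auto simp: euler_nth genfun_nth sum_distrib_left intro!: sum.cong)

definition supported_mod :: "nat \<Rightarrow> nat \<Rightarrow> 'a::zero fps \<Rightarrow> bool" where
  "supported_mod M r f \<longleftrightarrow> (\<forall>n. f $ n \<noteq> 0 \<longrightarrow> [n = r] (mod M))"

text \<open>Gradings modulo \<open>M\<close> are what allows coefficients to be read off termwise from a polynomial in
theta functions.\<close>

lemma supported_mod_mult:
  fixes f g :: "int fps"
  assumes "supported_mod M r f" "supported_mod M s g"
  shows "supported_mod M (r + s) (f * g)"
  unfolding supported_mod_def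
proof (intro allI impI)
  fix n assume "(f * g) $ n \<noteq> 0"
  then obtain i where i: "i \<le> n" "f $ i * g $ (n - i) \<noteq> 0"
    unfolding fps_mult_nth by (rule sum.not_neutral_contains_not_neutral) simp
  have "f $ i \<noteq> 0" "g $ (n - i) \<noteq> 0" using i by auto
  then have "[i = r] (mod M)" "[n - i = s] (mod M)"
    using assms unfolding supported_mod_def by blast+
  then have "[i + (n - i) = r + s] (mod M)" by (rule cong_add)
  with i show "[n = r + s] (mod M)" by simp
qed

lemma supported_mod_nth:
  assumes "supported_mod M r f" "\<not> [n = r] (mod M)"
  shows "f $ n = 0"
  using assms by (auto simp: supported_mod_def)

lemma supported_mod_add:
  fixes f g :: "int fps"
  assumes "supported_mod M r f" "supported_mod M r g"
  shows "supported_mod M r (f + g)"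
  unfolding supported_mod_def
proof (intro allI impI)
  fix n assume "(f + g) $ n \<noteq> 0"
  then have "f $ n \<noteq> 0 \<or> g $ n \<noteq> 0" by auto
  then show "[n = r] (mod M)" using assms by (auto simp: supported_mod_def)
qed

lemma supported_mod_cong:
  "supported_mod M r f \<Longrightarrow> [r = s] (mod M) \<Longrightarrow> supported_mod M s f"
  unfolding supported_mod_def by (blast intro: cong_trans)

lemma supported_mod_power:
  fixes f :: "int fps"
  assumes "supported_mod M r f"
  shows "supported_mod M (k * r) (f ^ k)"
proof (induction k)
  case 0
  show ?case by (auto simp: supported_mod_def fps_one_nth)
next
  case (Suc k)
  then show ?case using supported_mod_mult [OF assms Suc] by simp
qed

lemma supported_mod_genfun:
  assumes "\<And>x. x \<in> X \<Longrightarrow> [Q x = int r] (mod int M)"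
  shows "supported_mod M r (genfun X Q c)"
  unfolding supported_mod_def
proof (intro allI impI)
  fix n assume "genfun X Q c $ n \<noteq> 0"
  then obtain x where "x \<in> X" "Q x = int n"
    unfolding genfun_nth by (rule sum.not_neutral_contains_not_neutral) auto
  then show "[n = r] (mod M)" using assms [of x] by (simp add: cong_int_iff)
qed

lemma supported_mod_coarsen:
  assumes "supported_mod M r f" "N dvd M"
  shows "supported_mod N r f"
  using assms unfolding supported_mod_def by (meson cong_dvd_modulus_nat)

section \<open>Theta functions of even and of odd integers\<close>

text \<open>This and the next function are the classical theta constants \<open>\<theta>\<^sub>3\<close> and \<open>\<theta>\<^sub>2\<close> with nome \<open>q\<^bsup>4k\<^esup>\<close>.\<close>

definition theta_even :: "int \<Rightarrow> int fps" where
  "theta_even k = genfun {x::int. even x} (\<lambda>x. k * x\<^sup>2) (\<lambda>_. 1)"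

definition theta_odd :: "int \<Rightarrow> int fps" where
  "theta_odd k = genfun {x::int. odd x} (\<lambda>x. k * x\<^sup>2) (\<lambda>_. 1)"

lemma abs_le_of_square_eq:
  fixes x k n :: int
  assumes "k > 0" "k * x\<^sup>2 = n"
  shows "\<bar>x\<bar> \<le> n"
proof -
  have "\<bar>x\<bar> \<le> \<bar>x\<bar> * \<bar>x\<bar>"
  proof (cases "x = 0")
    case False
    then have "1 * \<bar>x\<bar> \<le> \<bar>x\<bar> * \<bar>x\<bar>" by (intro mult_right_mono) auto
    then show ?thesis by simp
  qed simp
  also have "\<dots> = x\<^sup>2" by (simp add: power2_eq_square)
  also have "\<dots> \<le> k * x\<^sup>2" using assms(1) by (simp add: mult_le_cancel_right1)
  finally show ?thesis using assms(2) by simp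
qed

lemma finite_fibres_square:
  assumes "k > 0"
  shows "finite_fibres X (\<lambda>x::int. k * x\<^sup>2)"
  unfolding finite_fibres_def
proof (intro conjI ballI allI)
  show "finite {x \<in> X. k * x\<^sup>2 = n}" for n
  proof (rule finite_subset)
    show "{x \<in> X. k * x\<^sup>2 = n} \<subseteq> {- n..n}"
    proof
      fix x assume "x \<in> {x \<in> X. k * x\<^sup>2 = n}"
      then have "\<bar>x\<bar> \<le> n" by (intro abs_le_of_square_eq [OF assms]) simp
      then show "x \<in> {- n..n}" by auto
    qed
  qed simp
qed (use assms in simp)

lemmas finite_fibres_square1 = finite_fibres_square [where k = 1, simplified]

lemma theta_even_dilate: "theta_even 1 oo fps_X ^ 2 = theta_even 2"
  unfolding theta_even_def by (subst genfun_dilate) simp_all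

lemma theta_odd_dilate: "theta_odd 1 oo fps_X ^ 2 = theta_odd 2"
  unfolding theta_odd_def by (subst genfun_dilate) simp_all

text \<open>The isometry up to the factor 2 between pairs \<open>(a, b)\<close> and pairs \<open>(s, t)\<close> of equal parity.\<close>

lemma half_sum_diff_bij:
  assumes "\<And>a b. (a, b) \<in> X \<longleftrightarrow> (a + b, a - b) \<in> Y"
    and "\<And>s t. (s, t) \<in> Y \<Longrightarrow> even (s + t)"
  shows "bij_betw (\<lambda>(a, b). (a + b, a - b :: int)) X Y"
proof (rule bij_betwI)
  show "(\<lambda>(a, b). (a + b, a - b)) \<in> X \<rightarrow> Y"
    using assms(1) by auto
  show "(\<lambda>(s, t). ((s + t) div 2, (s - t) div 2)) \<in> Y \<rightarrow> X"
  proof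
    fix p assume "p \<in> Y"
    obtain s t where p: "p = (s, t)" by (cases p)
    with \<open>p \<in> Y\<close> have "(s, t) \<in> Y" "even (s + t)" using assms(2) by auto
    then have "((s + t) div 2 + (s - t) div 2, (s + t) div 2 - (s - t) div 2) = (s, t)"
      by (auto elim!: evenE) presburger+
    with \<open>(s, t) \<in> Y\<close> show "(\<lambda>(s, t). ((s + t) div 2, (s - t) div 2)) p \<in> X"
      unfolding p by (simp add: assms(1))
  qed
  show "(\<lambda>(s, t). ((s + t) div 2, (s - t) div 2)) ((\<lambda>(a, b). (a + b, a - b)) x) = x" for x :: "int \<times> int"
    by (cases x) simp
  show "(\<lambda>(a, b). (a + b, a - b)) ((\<lambda>(s, t). ((s + t) div 2, (s - t) div 2)) y) = y" if "y \<in> Y" for y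
  proof -
    obtain s t where y: "y = (s, t)" by (cases y)
    with that have "even (s + t)" using assms(2) by auto
    then show ?thesis unfolding y by auto presburger+
  qed
qed

text \<open>Two even numbers \<open>a + b\<close> and \<open>a - b\<close>: here \<open>a\<close> and \<open>b\<close> are both even or both odd.\<close>

lemma theta_even_square: "(theta_even 1)\<^sup>2 = (theta_even 2)\<^sup>2 + (theta_odd 2)\<^sup>2"
proof -
  let ?E = "{x::int. even x}" and ?O = "{x::int. odd x}"
  let ?Q = "\<lambda>(x, y). x\<^sup>2 + y\<^sup>2 :: int" and ?Q2 = "\<lambda>(x, y). 2 * x\<^sup>2 + 2 * y\<^sup>2 :: int"
  have "(theta_even 1)\<^sup>2 = genfun (?E \<times> ?E) ?Q (\<lambda>_. 1)"
    unfolding theta_even_def power2_eq_square [where a = "genfun _ _ _"]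
    by (subst genfun_mult) (auto simp: finite_fibres_square1 intro!: genfun_cong)
  also have "\<dots> = genfun (?E \<times> ?E \<union> ?O \<times> ?O) ?Q2 (\<lambda>_. 1)"
    by (rule genfun_reindex [symmetric, OF half_sum_diff_bij])
      (auto simp: power2_eq_square algebra_simps)
  also have "\<dots> = genfun (?E \<times> ?E) ?Q2 (\<lambda>_. 1) + genfun (?O \<times> ?O) ?Q2 (\<lambda>_. 1)"
    by (intro genfun_union finite_fibres_Times finite_fibres_square) auto
  also have "genfun (?E \<times> ?E) ?Q2 (\<lambda>_. 1) = (theta_even 2)\<^sup>2"
    unfolding theta_even_def power2_eq_square [where a = "genfun _ _ _"]
    by (subst genfun_mult) (auto simp: finite_fibres_square intro!: genfun_cong)
  also have "genfun (?O \<times> ?O) ?Q2 (\<lambda>_. 1) = (theta_odd 2)\<^sup>2"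
    unfolding theta_odd_def power2_eq_square [where a = "genfun _ _ _"]
    by (subst genfun_mult) (auto simp: finite_fibres_square intro!: genfun_cong)
  finally show ?thesis .
qed

text \<open>Two odd numbers \<open>a + b\<close> and \<open>a - b\<close>: here \<open>a\<close> and \<open>b\<close> have opposite parity.\<close>

lemma theta_odd_square: "(theta_odd 1)\<^sup>2 = 2 * (theta_even 2 * theta_odd 2)"
proof -
  let ?E = "{x::int. even x}" and ?O = "{x::int. odd x}"
  let ?Q = "\<lambda>(x, y). x\<^sup>2 + y\<^sup>2 :: int" and ?Q2 = "\<lambda>(x, y). 2 * x\<^sup>2 + 2 * y\<^sup>2 :: int"
  have "(theta_odd 1)\<^sup>2 = genfun (?O \<times> ?O) ?Q (\<lambda>_. 1)"
    unfolding theta_odd_def power2_eq_square [where a = "genfun _ _ _"]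
    by (subst genfun_mult) (auto simp: finite_fibres_square1 intro!: genfun_cong)
  also have "\<dots> = genfun (?E \<times> ?O \<union> ?O \<times> ?E) ?Q2 (\<lambda>_. 1)"
    by (rule genfun_reindex [symmetric, OF half_sum_diff_bij])
      (auto simp: power2_eq_square algebra_simps)
  also have "\<dots> = genfun (?E \<times> ?O) ?Q2 (\<lambda>_. 1) + genfun (?O \<times> ?E) ?Q2 (\<lambda>_. 1)"
    by (intro genfun_union finite_fibres_Times finite_fibres_square) auto
  also have "genfun (?E \<times> ?O) ?Q2 (\<lambda>_. 1) = theta_even 2 * theta_odd 2"
    unfolding theta_even_def theta_odd_def
    by (subst genfun_mult) (auto simp: finite_fibres_square intro!: genfun_cong)
  also have "genfun (?O \<times> ?E) ?Q2 (\<lambda>_. 1) = theta_odd 2 * theta_even 2"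
    unfolding theta_even_def theta_odd_def
    by (subst genfun_mult) (auto simp: finite_fibres_square intro!: genfun_cong)
  finally show ?thesis by (simp add: mult.commute)
qed

text \<open>Up to a constant the first Rankin--Cohen bracket of the two theta functions, a cusp form of weight 3.\<close>

definition theta_wronskian :: "int \<Rightarrow> int fps" where
  "theta_wronskian k = theta_even k * euler (theta_odd k) - theta_odd k * euler (theta_even k)"

text \<open>The series for \<open>\<eta>(8z)\<^sup>3\<close>. The sign \<open>(-1)\<^sup>j\<close> of Jacobi's formula is absorbed by letting \<open>s\<close> run over
\<open>1, -3, 5, -7, \<dots>\<close>.\<close>

definition jacobi_series :: "int fps" where
  "jacobi_series = genfun {s::int. s mod 4 = 1} (\<lambda>s. s\<^sup>2) (\<lambda>s. s)"

lemma theta_wronskian_genfun: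
  assumes "k > 0"
  shows "theta_wronskian k = genfun ({a. odd a} \<times> {b. even b})
    (\<lambda>(a, b). k * a\<^sup>2 + k * b\<^sup>2) (\<lambda>(a, b). k * a\<^sup>2 - k * b\<^sup>2)"
proof -
  have "theta_wronskian k = genfun {a. odd a} (\<lambda>a. k * a\<^sup>2) (\<lambda>a. k * a\<^sup>2 * 1) * genfun {b. even b} (\<lambda>b. k * b\<^sup>2) (\<lambda>_. 1)
    - genfun {a. odd a} (\<lambda>a. k * a\<^sup>2) (\<lambda>_. 1) * genfun {b. even b} (\<lambda>b. k * b\<^sup>2) (\<lambda>b. k * b\<^sup>2 * 1)"
    unfolding theta_wronskian_def theta_even_def theta_odd_def euler_genfun
    by (simp only: mult.commute)
  also have "\<dots> = genfun ({a. odd a} \<times> {b. even b})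
    (\<lambda>(a, b). k * a\<^sup>2 + k * b\<^sup>2) (\<lambda>(a, b). k * a\<^sup>2 - k * b\<^sup>2)"
    by (simp only: genfun_mult [OF finite_fibres_square [OF assms] finite_fibres_square [OF assms]]
          genfun_diff [symmetric])
      (auto intro!: genfun_cong)
  finally show ?thesis .
qed

text \<open>The summand \<open>2a\<^sup>2 - 2b\<^sup>2\<close> is \<open>2 s t\<close> for \<open>s = a + b\<close>, \<open>t = a - b\<close>. If \<open>a\<close> is odd and \<open>b\<close> even then \<open>s\<close>
and \<open>t\<close> are odd and congruent modulo 4, and the sum factorizes.\<close>

lemma theta_wronskian_2: "theta_wronskian 2 = 4 * jacobi_series\<^sup>2"
proof -
  let ?C1 = "{s::int. s mod 4 = 1}" and ?C3 = "{s::int. s mod 4 = 3}"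
  let ?Q = "\<lambda>(s, t). s\<^sup>2 + t\<^sup>2 :: int" and ?c = "\<lambda>(s, t). s * t :: int"
  have "theta_wronskian 2 = genfun ({a. odd a} \<times> {b. even b})
     (\<lambda>(a, b). 2 * a\<^sup>2 + 2 * b\<^sup>2) (\<lambda>(a, b). 2 * a\<^sup>2 - 2 * b\<^sup>2)"
    by (simp add: theta_wronskian_genfun)
  also have "\<dots> = genfun (?C1 \<times> ?C1 \<union> ?C3 \<times> ?C3) ?Q (\<lambda>p. 2 * ?c p)"
  proof (rule genfun_reindex [OF half_sum_diff_bij])
    show "(a, b) \<in> {a. odd a} \<times> {b. even b} \<longleftrightarrow> (a + b, a - b) \<in> ?C1 \<times> ?C1 \<union> ?C3 \<times> ?C3" for a b :: int
      by simp presburger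
    show "even (s + t)" if "(s, t) \<in> ?C1 \<times> ?C1 \<union> ?C3 \<times> ?C3" for s t :: int
      using that by simp presburger
  qed (auto simp: power2_eq_square algebra_simps)
  also have "\<dots> = fps_const 2 * genfun (?C1 \<times> ?C1 \<union> ?C3 \<times> ?C3) ?Q ?c"
    by (rule genfun_cmult)
  also have "genfun (?C1 \<times> ?C1 \<union> ?C3 \<times> ?C3) ?Q ?c = genfun (?C1 \<times> ?C1) ?Q ?c + genfun (?C3 \<times> ?C3) ?Q ?c"
    by (intro genfun_union finite_fibres_Times finite_fibres_square1) auto
  also have "genfun (?C1 \<times> ?C1) ?Q ?c = jacobi_series\<^sup>2"
    unfolding jacobi_series_def power2_eq_square [where a = "genfun _ _ _"]
    by (subst genfun_mult) (auto simp: finite_fibres_square1 intro!: genfun_cong)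
  also have "genfun (?C3 \<times> ?C3) ?Q ?c = genfun (?C1 \<times> ?C1) ?Q ?c"
  proof (rule genfun_reindex)
    show "bij_betw (\<lambda>(s, t). (- s, - t)) (?C3 \<times> ?C3) (?C1 \<times> ?C1)"
      by (rule bij_betwI [where g = "\<lambda>(s, t). (- s, - t)"]) (auto, presburger+)
  qed auto
  also have "genfun (?C1 \<times> ?C1) ?Q ?c = jacobi_series\<^sup>2"
    unfolding jacobi_series_def power2_eq_square [where a = "genfun _ _ _"]
    by (subst genfun_mult) (auto simp: finite_fibres_square1 intro!: genfun_cong)
  finally show ?thesis by (simp add: numeral_fps_const)
qed

lemma theta_odd_1_nth_1: "theta_odd 1 $ 1 = 2"
proof -
  have "{x::int. odd x \<and> x\<^sup>2 = 1} = {1, -1}" by (auto simp: power2_eq_1_iff)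
  then show ?thesis by (simp add: theta_odd_def genfun_nth)
qed

lemma theta_odd_nth_0: "k \<noteq> 0 \<Longrightarrow> theta_odd k $ 0 = 0"
  by (auto simp: theta_odd_def genfun_nth)

lemma theta_even_nth_0: "k \<noteq> 0 \<Longrightarrow> theta_even k $ 0 = 1"
proof -
  assume "k \<noteq> 0"
  then have "{x::int. even x \<and> (k = 0 \<or> x = 0)} = {0}" by auto
  then show ?thesis by (simp add: theta_even_def genfun_nth)
qed

lemma theta_even_1_nth_1: "theta_even 1 $ 1 = 0"
proof -
  have "{x \<in> {x::int. even x}. 1 * x\<^sup>2 = int 1} = {}" by (auto simp: power2_eq_1_iff)
  then show ?thesis unfolding theta_even_def genfun_nth by (simp only: sum.empty)
qed

lemma theta_odd_nonzero: "theta_odd 1 \<noteq> 0"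
  using theta_odd_1_nth_1 by force

lemma theta_even_nonzero: "theta_even 1 \<noteq> 0"
  using theta_even_nth_0 [of 1] by force

lemma subdegree_dilate:
  fixes f :: "int fps"
  assumes "k > 0" "f \<noteq> 0"
  shows "subdegree (f oo fps_X ^ k) = k * subdegree f"
proof (rule subdegreeI)
  show "(f oo fps_X ^ k) $ (k * subdegree f) \<noteq> 0"
    using assms by (simp add: fps_nth_compose_X_power)
  show "(f oo fps_X ^ k) $ i = 0" if "i < k * subdegree f" for i
    using that assms by (auto simp: fps_nth_compose_X_power intro!: nth_less_subdegree_zero elim!: dvdE)
qed

lemma theta_wronskian_dilate: "theta_wronskian 2 = 2 * (theta_wronskian 1 oo fps_X ^ 2)"
proof -
  have "euler (theta_odd 2) = 2 * (euler (theta_odd 1) oo fps_X ^ 2)"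
    "euler (theta_even 2) = 2 * (euler (theta_even 1) oo fps_X ^ 2)"
    by (simp_all add: theta_odd_dilate [symmetric] theta_even_dilate [symmetric] euler_dilate numeral_fps_const)
  then show ?thesis
    by (simp add: theta_wronskian_def theta_odd_dilate [symmetric] theta_even_dilate [symmetric]
       fps_compose_sub_distrib fps_compose_mult_distrib algebra_simps)
qed

text \<open>A form of Jacobi's derivative formula. The doubling relations \<open>z\<^sup>2 = P\<^sup>2 + S\<^sup>2\<close>, \<open>w\<^sup>2 = 2PS\<close> transform both
sides in the same way, which makes the error \<open>e\<close> proportional to \<open>e(q\<^sup>2)\<close>.\<close>

lemma theta_wronskian_1:
  "theta_wronskian 1 = theta_even 1 * theta_odd 1 * (theta_even 1 ^ 4 - theta_odd 1 ^ 4)"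
proof -
  define z w P S where "z = theta_even 1" and "w = theta_odd 1"
    and "P = theta_even 2" and "S = theta_odd 2"
  define e where "e = theta_wronskian 1 - z * w * (z ^ 4 - w ^ 4)"
  have zz: "z\<^sup>2 = P\<^sup>2 + S\<^sup>2" and ww: "w\<^sup>2 = 2 * (P * S)"
    using theta_even_square theta_odd_square by (simp_all add: z_def w_def P_def S_def)
  have "euler (z * z) = euler (P * P + S * S)" "euler (w * w) = euler (2 * (P * S))"
    using zz ww by (simp_all add: power2_eq_square)
  moreover have "euler 2 = (0 :: int fps)" by (simp add: euler_def)
  ultimately have Dz: "2 * z * euler z = 2 * P * euler P + 2 * S * euler S"
    and Dw: "2 * w * euler w = 2 * (euler P * S + P * euler S)"
    by (simp_all add: euler_mult euler_add algebra_simps)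
  have W2: "theta_wronskian 2 = P * euler S - S * euler P"
    by (simp add: theta_wronskian_def P_def S_def)
  have "2 * (z * w * theta_wronskian 1) = z\<^sup>2 * (2 * w * euler w) - w\<^sup>2 * (2 * z * euler z)"
    by (simp add: theta_wronskian_def z_def w_def power2_eq_square algebra_simps)
  also have "\<dots> = 2 * ((P\<^sup>2 - S\<^sup>2) * (P * euler S - S * euler P))"
    unfolding Dz Dw zz ww by (simp add: power2_eq_square algebra_simps)
  finally have 1: "z * w * theta_wronskian 1 = (P\<^sup>2 - S\<^sup>2) * theta_wronskian 2"
    unfolding W2 by simp
  have "z ^ 4 - w ^ 4 = (z\<^sup>2)\<^sup>2 - (w\<^sup>2)\<^sup>2" by simp
  also have "\<dots> = (P\<^sup>2 - S\<^sup>2)\<^sup>2"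
    unfolding zz ww by (simp add: power2_eq_square algebra_simps)
  finally have zw4: "z ^ 4 - w ^ 4 = (P\<^sup>2 - S\<^sup>2)\<^sup>2" .
  have "z * w * (z * w * (z ^ 4 - w ^ 4)) = z\<^sup>2 * w\<^sup>2 * (P\<^sup>2 - S\<^sup>2)\<^sup>2"
    unfolding zw4 by (simp add: power2_eq_square ac_simps)
  also have "\<dots> = (P\<^sup>2 - S\<^sup>2) * (2 * (P * S * (P ^ 4 - S ^ 4)))"
    unfolding zz ww by (simp add: power2_eq_square power4_eq_xxxx algebra_simps)
  also have "P * S * (P ^ 4 - S ^ 4) = (z * w * (z ^ 4 - w ^ 4)) oo fps_X ^ 2"
    by (simp add: z_def w_def P_def S_def theta_odd_dilate [symmetric] theta_even_dilate [symmetric]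
       fps_compose_sub_distrib fps_compose_mult_distrib fps_compose_power)
  finally have "z * w * e = (P\<^sup>2 - S\<^sup>2) * (2 * (e oo fps_X ^ 2))"
    unfolding e_def right_diff_distrib 1 theta_wronskian_dilate fps_compose_sub_distrib by simp
  \<comment> \<open>Comparing orders of vanishing: \<open>1 + ord e = 2 ord e\<close>, so \<open>e\<close> would have order exactly 1.\<close>
  have "e = 0"
  proof (rule ccontr)
    assume "e \<noteq> 0"
    have PS0: "(P\<^sup>2 - S\<^sup>2) $ 0 = 1"
      by (simp add: P_def S_def theta_even_nth_0 theta_odd_nth_0 fps_mult_nth power2_eq_square)
    have sz: "subdegree z = 0" by (rule subdegreeI) (simp_all add: z_def theta_even_nth_0)
    have sw: "subdegree w = 1"
      by (rule subdegreeI) (simp_all add: w_def theta_odd_nth_0 theta_odd_1_nth_1 [simplified])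
    have sPS: "subdegree (P\<^sup>2 - S\<^sup>2) = 0" by (rule subdegreeI) (use PS0 in auto)
    have nz: "P\<^sup>2 - S\<^sup>2 \<noteq> 0" using PS0 by force
    have e2: "e oo fps_X ^ 2 \<noteq> 0"
      using \<open>e \<noteq> 0\<close> \<open>z * w * e = _\<close> theta_odd_nonzero theta_even_nonzero by (auto simp: z_def w_def)
    have "subdegree (z * w * e) = 1 + subdegree e"
      using \<open>e \<noteq> 0\<close> theta_odd_nonzero theta_even_nonzero sz sw by (simp add: z_def w_def)
    moreover have "subdegree ((P\<^sup>2 - S\<^sup>2) * (2 * (e oo fps_X ^ 2))) = 2 * subdegree e"
    proof -
      have "subdegree (2 :: int fps) = 0" by (rule subdegreeI) (simp_all add: numeral_fps_const)
      then show ?thesis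
        using nz e2 sPS \<open>e \<noteq> 0\<close> by (simp add: subdegree_dilate)
    qed
    ultimately have "subdegree e = 1" using \<open>z * w * e = _\<close> by simp
    then have "e $ 1 \<noteq> 0" using \<open>e \<noteq> 0\<close> by (metis nth_subdegree_nonzero)
    moreover have "e $ 1 = 0"
      by (simp add: e_def theta_wronskian_def z_def w_def euler_nth fps_mult_nth power2_eq_square power4_eq_xxxx
        theta_even_nth_0 theta_odd_nth_0 theta_odd_1_nth_1 [simplified] theta_even_1_nth_1 [simplified])
    ultimately show False by simp
  qed
  then show ?thesis by (simp add: e_def z_def w_def)
qed

lemma theta_wronskian_2_product:
  "theta_wronskian 2 = 2 * (theta_even 2 * theta_odd 2 * (theta_even 2 ^ 4 - theta_odd 2 ^ 4))"
  unfolding theta_wronskian_dilate theta_wronskian_1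
  by (simp add: theta_odd_dilate [symmetric] theta_even_dilate [symmetric]
       fps_compose_sub_distrib fps_compose_mult_distrib fps_compose_power)

section \<open>Representation numbers of diagonal forms\<close>

definition theta :: "nat \<Rightarrow> int fps" where
  "theta k = genfun (UNIV :: int set) (\<lambda>x. int k * x\<^sup>2) (\<lambda>_. 1)"

lemma finite_fibres_reindex:
  assumes "bij_betw h X Y" "\<And>x. x \<in> X \<Longrightarrow> R (h x) = Q x" "finite_fibres X Q"
  shows "finite_fibres Y R"
  unfolding finite_fibres_def
proof (intro conjI ballI allI)
  fix y assume "y \<in> Y"
  then obtain x where "x \<in> X" "y = h x" using assms(1) by (auto simp: bij_betw_def)
  then show "0 \<le> R y" using assms(2,3) by (auto simp: finite_fibres_def)
next
  fix n
  have "bij_betw h {x \<in> X. Q x = n} {y \<in> Y. R y = n}"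
    using assms(1,2) by (rule bij_betw_subset_fibre)
  then show "finite {y \<in> Y. R y = n}"
    using finite_fibresD [OF assms(3)] bij_betw_finite by blast
qed

text \<open>Finiteness and the product formula are proved by one induction, since multiplying generating functions
requires finite fibres.\<close>

lemma prod_list_theta:
  assumes "\<forall>k\<in>set a. k > 0"
  shows "finite_fibres {x :: int list. length x = length a} (\<lambda>x. \<Sum>i<length a. int (a ! i) * (x ! i)\<^sup>2)
    \<and> prod_list (map theta a)
      = genfun {x :: int list. length x = length a} (\<lambda>x. \<Sum>i<length a. int (a ! i) * (x ! i)\<^sup>2) (\<lambda>_. 1)"
  using assms
proof (induction a)
  case Nil
  have "{x :: int list. x = [] \<and> n = 0} = (if n = 0 then {[]} else {})" for n :: nat by auto
  then show ?case
    by (auto simp: finite_fibres_def fps_eq_iff genfun_nth fps_one_nth)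
next
  case (Cons k a)
  let ?X = "\<lambda>a. {x :: int list. length x = length a}"
    and ?Q = "\<lambda>(a :: nat list) x :: int list. \<Sum>i<length a. int (a ! i) * (x ! i)\<^sup>2"
  let ?R = "\<lambda>(x, y). int k * x\<^sup>2 + ?Q a y"
  have IH: "finite_fibres (?X a) (?Q a)" "prod_list (map theta a) = genfun (?X a) (?Q a) (\<lambda>_. 1)"
    using Cons by auto
  have k: "finite_fibres (UNIV :: int set) (\<lambda>x. int k * x\<^sup>2)"
    using Cons.prems by (intro finite_fibres_square) auto
  have bij: "bij_betw (\<lambda>(x, y). x # y) (UNIV \<times> ?X a) (?X (k # a))"
    by (rule bij_betwI [where g = "\<lambda>x. (hd x, tl x)"]) (auto simp: length_Suc_conv)
  have Q: "?Q (k # a) ((\<lambda>(x, y). x # y) p) = ?R p" for p :: "int \<times> int list"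
    by (cases p) (simp only: length_Cons sum.lessThan_Suc_shift prod.case, simp)
  have "finite_fibres (UNIV \<times> ?X a) ?R"
    by (rule finite_fibres_Times [OF k IH(1)])
  with bij Q have "finite_fibres (?X (k # a)) (?Q (k # a))"
    by (rule finite_fibres_reindex)
  moreover have "prod_list (map theta (k # a)) = genfun (UNIV \<times> ?X a) ?R (\<lambda>_. 1)"
    by (simp only: list.map prod_list.Cons IH(2) theta_def genfun_mult [OF k IH(1)])
      (auto intro!: genfun_cong)
  moreover have "\<dots> = genfun (?X (k # a)) (?Q (k # a)) (\<lambda>_. 1)"
    using bij Q by (rule genfun_reindex) simp
  ultimately show ?case by simp
qed

lemma r7_eq_coeff:
  assumes "length a = 7" "\<forall>k\<in>set a. k > 0"
  shows "int (r7 a N) = prod_list (map theta a) $ N"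
  using prod_list_theta [OF assms(2)] assms(1)
  by (simp add: r7_def genfun_nth)

lemma theta_1: "theta 1 = theta_even 1 + theta_odd 1"
proof -
  have "genfun ({x::int. even x} \<union> {x. odd x}) (\<lambda>x. int 1 * x\<^sup>2) (\<lambda>_. 1)
      = genfun {x. even x} (\<lambda>x. int 1 * x\<^sup>2) (\<lambda>_. 1) + genfun {x. odd x} (\<lambda>x. int 1 * x\<^sup>2) (\<lambda>_. 1)"
    by (intro genfun_union finite_fibres_square) auto
  moreover have "{x::int. even x} \<union> {x. odd x} = UNIV" by auto
  ultimately show ?thesis by (simp add: theta_def theta_even_def theta_odd_def)
qed

lemma theta_2: "theta 2 = theta_even 2 + theta_odd 2"
proof -
  have "genfun ({x::int. even x} \<union> {x. odd x}) (\<lambda>x. int 2 * x\<^sup>2) (\<lambda>_. 1)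
      = genfun {x. even x} (\<lambda>x. int 2 * x\<^sup>2) (\<lambda>_. 1) + genfun {x. odd x} (\<lambda>x. int 2 * x\<^sup>2) (\<lambda>_. 1)"
    by (intro genfun_union finite_fibres_square) auto
  moreover have "{x::int. even x} \<union> {x. odd x} = UNIV" by auto
  ultimately show ?thesis by (simp add: theta_def theta_even_def theta_odd_def)
qed

lemma theta_4: "theta 4 = theta_even 1"
  unfolding theta_def theta_even_def
proof (rule genfun_reindex)
  show "bij_betw (\<lambda>x. 2 * x) (UNIV :: int set) {x. even x}"
    by (rule bij_betwI [where g = "\<lambda>x. x div 2"]) auto
qed (auto simp: power2_eq_square)

lemma supported_theta_even_2: "supported_mod 8 0 (theta_even 2)"
  unfolding theta_even_def
  by (rule supported_mod_genfun) (auto simp: cong_def power2_eq_square elim!: evenE)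

lemma supported_theta_odd_2: "supported_mod 8 2 (theta_odd 2)"
  unfolding theta_odd_def
proof (rule supported_mod_genfun)
  fix x :: int assume "x \<in> {x. odd x}"
  then obtain y where x: "x = 2 * y + 1" by (auto elim: oddE)
  have "2 * x\<^sup>2 - 2 = 8 * (y\<^sup>2 + y)" unfolding x by (simp add: power2_eq_square algebra_simps)
  then show "[2 * x\<^sup>2 = int 2] (mod int 8)" by (simp add: cong_iff_dvd_diff)
qed

lemma supported_theta_even_1: "supported_mod 4 0 (theta_even 1)"
  unfolding theta_even_def
  by (rule supported_mod_genfun) (auto simp: cong_def power2_eq_square elim!: evenE)

lemma supported_theta_odd_1: "supported_mod 8 1 (theta_odd 1)"
  unfolding theta_odd_def
proof (rule supported_mod_genfun)
  fix x :: int assume "x \<in> {x. odd x}"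
  then have "odd x" by simp
  then obtain y where x: "x = 2 * y + 1" by (auto elim: oddE)
  obtain k where k: "y\<^sup>2 + y = 2 * k" by (metis dvd_def even_add even_power zero_less_numeral)
  have "x\<^sup>2 - 1 = 4 * (y\<^sup>2 + y)" unfolding x by (simp add: power2_eq_square algebra_simps)
  then show "[1 * x\<^sup>2 = int 1] (mod int 8)" unfolding k by (simp add: cong_iff_dvd_diff)
qed

lemma supported_mod_0_mult:
  fixes f g :: "int fps"
  shows "supported_mod M 0 f \<Longrightarrow> supported_mod M 0 g \<Longrightarrow> supported_mod M 0 (f * g)"
  using supported_mod_mult [of M 0 f 0 g] by simp

lemma supported_mod_0_power:
  fixes f :: "int fps"
  shows "supported_mod M 0 f \<Longrightarrow> supported_mod M 0 (f ^ k)"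
  using supported_mod_power [of M 0 f k] by simp

lemma supported_mod_0_numeral: "supported_mod M 0 (numeral k :: int fps)"
  by (auto simp: supported_mod_def numeral_fps_const)

lemma supported_mod_diff:
  fixes f g :: "int fps"
  assumes "supported_mod M r f" "supported_mod M r g"
  shows "supported_mod M r (f - g)"
  unfolding supported_mod_def
proof (intro allI impI)
  fix n assume "(f - g) $ n \<noteq> 0"
  then have "f $ n \<noteq> 0 \<or> g $ n \<noteq> 0" by auto
  then show "[n = r] (mod M)" using assms by (auto simp: supported_mod_def)
qed

lemmas supported_mod_0_intros = supported_mod_0_mult supported_mod_0_power
  supported_mod_0_numeral supported_mod_add supported_mod_diff

text \<open>The terms with an odd power of \<open>w\<close> contain the factor \<open>z w\<close>, whose exponents are odd.\<close>

lemma coeff_even_part: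
  fixes f :: "int fps"
  assumes "even N" "supported_mod 2 0 f" "g = h + theta_even 1 * theta_odd 1 * f"
  shows "g $ N = h $ N"
proof -
  have "supported_mod 2 (0 + 1 + 0) (theta_even 1 * theta_odd 1 * f)"
    by (intro supported_mod_mult assms(2) supported_mod_coarsen [OF supported_theta_even_1]
       supported_mod_coarsen [OF supported_theta_odd_1]) auto
  then have "(theta_even 1 * theta_odd 1 * f) $ N = 0"
    by (rule supported_mod_nth) (use assms(1) in \<open>auto simp: cong_def even_iff_mod_2_eq_zero\<close>)
  then show ?thesis using assms(3) by simp
qed

text \<open>Each product is expanded in \<open>z\<close> and \<open>w\<close>; the part that is odd in \<open>w\<close> is dropped, and the even part is
rewritten with \<open>z\<^sup>2 = P\<^sup>2 + S\<^sup>2\<close> and \<open>w\<^sup>2 = 2PS\<close>. In particular the forms \<open>(1,2\<^sup>5,4)\<close> and \<open>(1\<^sup>2,2\<^sup>3,4\<^sup>2)\<close> agree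
at all even numbers, and so do \<open>(1,2\<^sup>3,4\<^sup>3)\<close> and \<open>(1\<^sup>2,2,4\<^sup>4)\<close>.\<close>

lemma r7_even:
  fixes N :: nat
  defines "P \<equiv> theta_even 2" and "S \<equiv> theta_odd 2"
  assumes N: "even N"
  shows "int (r7 [1,2,2,2,2,2,4] N) = ((P\<^sup>2 + S\<^sup>2) * (P + S) ^ 5) $ N"
    and "int (r7 [1,1,2,2,2,4,4] N) = ((P\<^sup>2 + S\<^sup>2) * (P + S) ^ 5) $ N"
    and "int (r7 [1,1,1,2,4,4,4] N) = ((P\<^sup>2 + S\<^sup>2)\<^sup>2 * (P\<^sup>2 + S\<^sup>2 + 6 * (P * S)) * (P + S)) $ N"
    and "int (r7 [1,1,1,2,2,2,4] N) = ((P\<^sup>2 + S\<^sup>2) * (P\<^sup>2 + S\<^sup>2 + 6 * (P * S)) * (P + S) ^ 3) $ N"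
    and "int (r7 [1,1,1,1,2,4,4] N)
      = ((P\<^sup>2 + S\<^sup>2) * ((P\<^sup>2 + S\<^sup>2)\<^sup>2 + 12 * (P\<^sup>2 + S\<^sup>2) * (P * S) + 4 * (P * S)\<^sup>2) * (P + S)) $ N"
    and "int (r7 [1,2,2,2,4,4,4] N) = ((P\<^sup>2 + S\<^sup>2)\<^sup>2 * (P + S) ^ 3) $ N"
    and "int (r7 [1,1,2,4,4,4,4] N) = ((P\<^sup>2 + S\<^sup>2)\<^sup>2 * (P + S) ^ 3) $ N"
proof -
  define z w where "z = theta_even 1" and "w = theta_odd 1"
  have zz: "z * z = P\<^sup>2 + S\<^sup>2" and ww: "w * w = 2 * (P * S)"
    using theta_even_square theta_odd_square
    by (simp_all add: z_def w_def P_def S_def power2_eq_square)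
  have P: "supported_mod 2 0 P" and S: "supported_mod 2 0 S"
    using supported_mod_coarsen [OF supported_theta_even_2, of 2]
      supported_mod_cong [OF supported_mod_coarsen [OF supported_theta_odd_2, of 2], of 0]
    by (simp_all add: P_def S_def cong_def)
  note eq = theta_1 [unfolded One_nat_def] theta_2 theta_4 z_def [symmetric] w_def [symmetric] P_def [symmetric] S_def [symmetric]
  note fin = coeff_even_part [OF N _, folded z_def w_def]
  have PS: "(P + S) * (P + S) = z * z + w * w" unfolding zz ww by (simp add: power2_eq_square algebra_simps)
  show "int (r7 [1,2,2,2,2,2,4] N) = ((P\<^sup>2 + S\<^sup>2) * (P + S) ^ 5) $ N"
    by (simp add: r7_eq_coeff eq zz [symmetric],
      rule fin [where f = "(P + S) ^ 5"])
      (intro supported_mod_0_intros P S, simp add: numeral_eq_Suc algebra_simps)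
  show "int (r7 [1,1,2,2,2,4,4] N) = ((P\<^sup>2 + S\<^sup>2) * (P + S) ^ 5) $ N"
  proof (simp add: r7_eq_coeff eq, rule fin [where f = "2 * (P\<^sup>2 + S\<^sup>2) * (P + S) ^ 3"])
    have "(P\<^sup>2 + S\<^sup>2) * (P + S) ^ 5 = (z * z) * ((P + S) * (P + S)) * (P + S) ^ 3"
      unfolding zz by (simp add: numeral_eq_Suc algebra_simps)
    then show "(z + w) * ((z + w) * ((P + S) * ((P + S) * ((P + S) * (z * z)))))
      = (P\<^sup>2 + S\<^sup>2) * (P + S) ^ 5 + z * w * (2 * (P\<^sup>2 + S\<^sup>2) * (P + S) ^ 3)"
      unfolding PS zz [symmetric] by (simp add: numeral_eq_Suc algebra_simps)
  qed (intro supported_mod_0_intros P S)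
  show "int (r7 [1,1,1,2,4,4,4] N) = ((P\<^sup>2 + S\<^sup>2)\<^sup>2 * (P\<^sup>2 + S\<^sup>2 + 6 * (P * S)) * (P + S)) $ N"
  proof (simp add: r7_eq_coeff eq, rule fin [where f = "(3 * (P\<^sup>2 + S\<^sup>2)\<^sup>2 + (P\<^sup>2 + S\<^sup>2) * (2 * (P * S))) * (P + S)"])
    have "6 * (P * S) = 3 * (w * w)" unfolding ww by simp
    then show "(z + w) * ((z + w) * ((z + w) * ((P + S) * (z * (z * z)))))
      = (P\<^sup>2 + S\<^sup>2)\<^sup>2 * (P\<^sup>2 + S\<^sup>2 + 6 * (P * S)) * (P + S)
        + z * w * ((3 * (P\<^sup>2 + S\<^sup>2)\<^sup>2 + (P\<^sup>2 + S\<^sup>2) * (2 * (P * S))) * (P + S))"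
      unfolding zz [symmetric] ww [symmetric] by (simp add: numeral_eq_Suc algebra_simps)
  qed (intro supported_mod_0_intros P S)
  show "int (r7 [1,1,1,2,2,2,4] N) = ((P\<^sup>2 + S\<^sup>2) * (P\<^sup>2 + S\<^sup>2 + 6 * (P * S)) * (P + S) ^ 3) $ N"
  proof (simp add: r7_eq_coeff eq, rule fin [where f = "(3 * (P\<^sup>2 + S\<^sup>2) + 2 * (P * S)) * (P + S) ^ 3"])
    have "6 * (P * S) = 3 * (w * w)" unfolding ww by simp
    then show "(z + w) * ((z + w) * ((z + w) * ((P + S) * ((P + S) * ((P + S) * z)))))
      = (P\<^sup>2 + S\<^sup>2) * (P\<^sup>2 + S\<^sup>2 + 6 * (P * S)) * (P + S) ^ 3
        + z * w * ((3 * (P\<^sup>2 + S\<^sup>2) + 2 * (P * S)) * (P + S) ^ 3)"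
      unfolding zz [symmetric] ww [symmetric] by (simp add: numeral_eq_Suc algebra_simps)
  qed (intro supported_mod_0_intros P S)
  show "int (r7 [1,1,1,1,2,4,4] N)
      = ((P\<^sup>2 + S\<^sup>2) * ((P\<^sup>2 + S\<^sup>2)\<^sup>2 + 12 * (P\<^sup>2 + S\<^sup>2) * (P * S) + 4 * (P * S)\<^sup>2) * (P + S)) $ N"
  proof -
    have "int (r7 [1,1,1,1,2,4,4] N) = ((z + w) * ((z + w) * ((z + w) * ((z + w) * ((P + S) * (z * z)))))) $ N"
      by (simp add: r7_eq_coeff eq)
    also have "\<dots> = ((P\<^sup>2 + S\<^sup>2) * ((P\<^sup>2 + S\<^sup>2)\<^sup>2 + 12 * (P\<^sup>2 + S\<^sup>2) * (P * S) + 4 * (P * S)\<^sup>2) * (P + S)) $ N"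
    proof (rule fin [where f = "(4 * (P\<^sup>2 + S\<^sup>2)\<^sup>2 + 4 * (P\<^sup>2 + S\<^sup>2) * (2 * (P * S))) * (P + S)"])
    have c12: "12 * (P\<^sup>2 + S\<^sup>2) * (P * S) = 6 * (P\<^sup>2 + S\<^sup>2) * (w * w)"
      and c4: "4 * (P * S)\<^sup>2 = (w * w) * (w * w)"
      unfolding ww by (simp_all add: power2_eq_square)
    show "(z + w) * ((z + w) * ((z + w) * ((z + w) * ((P + S) * (z * z)))))
      = (P\<^sup>2 + S\<^sup>2) * ((P\<^sup>2 + S\<^sup>2)\<^sup>2 + 12 * (P\<^sup>2 + S\<^sup>2) * (P * S) + 4 * (P * S)\<^sup>2) * (P + S)
        + z * w * ((4 * (P\<^sup>2 + S\<^sup>2)\<^sup>2 + 4 * (P\<^sup>2 + S\<^sup>2) * (2 * (P * S))) * (P + S))"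
      unfolding c12 c4 unfolding ww [symmetric] zz [symmetric] by (simp add: numeral_eq_Suc algebra_simps)
    qed (intro supported_mod_0_intros P S)
    finally show ?thesis .
  qed
  show "int (r7 [1,2,2,2,4,4,4] N) = ((P\<^sup>2 + S\<^sup>2)\<^sup>2 * (P + S) ^ 3) $ N"
  proof (simp add: r7_eq_coeff eq, rule fin [where f = "(P\<^sup>2 + S\<^sup>2) * (P + S) ^ 3"])
    show "(z + w) * ((P + S) * ((P + S) * ((P + S) * (z * (z * z)))))
      = (P\<^sup>2 + S\<^sup>2)\<^sup>2 * (P + S) ^ 3 + z * w * ((P\<^sup>2 + S\<^sup>2) * (P + S) ^ 3)"
      unfolding zz [symmetric] by (simp add: numeral_eq_Suc algebra_simps)
  qed (intro supported_mod_0_intros P S)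
  show "int (r7 [1,1,2,4,4,4,4] N) = ((P\<^sup>2 + S\<^sup>2)\<^sup>2 * (P + S) ^ 3) $ N"
  proof (simp add: r7_eq_coeff eq, rule fin [where f = "2 * (P\<^sup>2 + S\<^sup>2)\<^sup>2 * (P + S)"])
    have "(P + S) ^ 3 = ((P + S) * (P + S)) * (P + S)" by (simp add: numeral_eq_Suc algebra_simps)
    then show "(z + w) * ((z + w) * ((P + S) * (z * (z * (z * z)))))
      = (P\<^sup>2 + S\<^sup>2)\<^sup>2 * (P + S) ^ 3 + z * w * (2 * (P\<^sup>2 + S\<^sup>2)\<^sup>2 * (P + S))"
      unfolding PS zz [symmetric] by (simp add: numeral_eq_Suc algebra_simps)
  qed (intro supported_mod_0_intros P S)
qed

text \<open>The cusp form of weight \<open>7/2\<close> whose coefficients at squares are governed by \<open>\<eta>(2z)\<^sup>1\<^sup>2\<close>.\<close>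

definition cusp_series :: "int fps" where
  "cusp_series = theta_even 2 * (theta_odd 2)\<^sup>2 * (theta_even 2 ^ 4 - theta_odd 2 ^ 4)"

text \<open>All differences are multiples of \<open>P\<^sup>4 - S\<^sup>4\<close>, which lives in exponents divisible by 8, by monomials
\<open>P\<^sup>i S\<^sup>j\<close> with \<open>i + j = 3\<close>, which live in exponents congruent to \<open>2j\<close> modulo 8. At a multiple of 4 only
\<open>j = 2\<close> (exponents 4 modulo 8) and \<open>j = 0\<close> (exponents 0 modulo 8) can contribute.\<close>

lemma r7_relations:
  fixes N :: nat
  assumes N: "4 dvd N"
  shows "int (r7 [1,2,2,2,2,2,4] N) = int (r7 [1,1,2,2,2,4,4] N)"
    and "int (r7 [1,2,2,2,4,4,4] N) = int (r7 [1,1,2,4,4,4,4] N)"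
    and "int (r7 [1,2,2,2,2,2,4] N) - int (r7 [1,1,1,2,4,4,4] N) = 2 * cusp_series $ N"
    and "int (r7 [1,1,1,2,2,2,4] N) - int (r7 [1,1,1,1,2,4,4] N) = 4 * cusp_series $ N"
    and "\<not> 8 dvd N \<Longrightarrow> int (r7 [1,2,2,2,2,2,4] N) - 2 * int (r7 [1,2,2,2,4,4,4] N) = cusp_series $ N"
    and "8 dvd N \<Longrightarrow> cusp_series $ N = 0"
proof -
  define P S where "P = theta_even 2" and "S = theta_odd 2"
  have "even N" using N by (auto elim!: dvdE)
  note r = r7_even [OF this, folded P_def S_def]
  have P: "supported_mod 8 0 P" and S: "supported_mod 8 2 S"
    using supported_theta_even_2 supported_theta_odd_2 by (simp_all add: P_def S_def)
  have S4: "supported_mod 8 0 (S ^ 4)"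
    by (rule supported_mod_cong [OF supported_mod_power [OF S]]) (simp add: cong_def)
  have PS: "supported_mod 8 0 (P ^ 4 - S ^ 4)"
    by (rule supported_mod_diff [OF supported_mod_0_power [OF P] S4])
  have T: "supported_mod 8 (0 + 2 * 2 + 0) (P * S\<^sup>2 * (P ^ 4 - S ^ 4))"
    by (intro supported_mod_mult supported_mod_power P S PS)
  have 1: "(P\<^sup>2 * S * (P ^ 4 - S ^ 4)) $ N = 0"
  proof (rule supported_mod_nth)
    show "supported_mod 8 (2 * 0 + 2 + 0) (P\<^sup>2 * S * (P ^ 4 - S ^ 4))"
      by (intro supported_mod_mult supported_mod_power P S PS)
    show "\<not> [N = 2 * 0 + 2 + 0] (mod 8)" using N by (simp add: cong_def) presburger
  qed
  have 2: "(S ^ 3 * (P ^ 4 - S ^ 4)) $ N = 0"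
  proof (rule supported_mod_nth)
    show "supported_mod 8 (3 * 2 + 0) (S ^ 3 * (P ^ 4 - S ^ 4))"
      by (intro supported_mod_mult supported_mod_power P S PS)
    show "\<not> [N = 3 * 2 + 0] (mod 8)" using N by (simp add: cong_def) presburger
  qed
  have c: "cusp_series = P * S\<^sup>2 * (P ^ 4 - S ^ 4)"
    by (simp add: cusp_series_def P_def S_def)
  show "int (r7 [1,2,2,2,2,2,4] N) = int (r7 [1,1,2,2,2,4,4] N)"
    "int (r7 [1,2,2,2,4,4,4] N) = int (r7 [1,1,2,4,4,4,4] N)"
    using r by simp_all
  have "(P\<^sup>2 + S\<^sup>2) * (P + S) ^ 5 - (P\<^sup>2 + S\<^sup>2)\<^sup>2 * (P\<^sup>2 + S\<^sup>2 + 6 * (P * S)) * (P + S)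
    = fps_const 2 * (P * S\<^sup>2 * (P ^ 4 - S ^ 4)) - fps_const 2 * (P\<^sup>2 * S * (P ^ 4 - S ^ 4))"
    unfolding numeral_fps_const [symmetric] by (simp add: numeral_eq_Suc algebra_simps)
  from arg_cong [OF this, of "\<lambda>f. f $ N"]
  show "int (r7 [1,2,2,2,2,2,4] N) - int (r7 [1,1,1,2,4,4,4] N) = 2 * cusp_series $ N"
    unfolding r c by (simp add: 1 del: fps_const_mult_left)
  have "(P\<^sup>2 + S\<^sup>2) * (P\<^sup>2 + S\<^sup>2 + 6 * (P * S)) * (P + S) ^ 3
    - (P\<^sup>2 + S\<^sup>2) * ((P\<^sup>2 + S\<^sup>2)\<^sup>2 + 12 * (P\<^sup>2 + S\<^sup>2) * (P * S) + 4 * (P * S)\<^sup>2) * (P + S)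
    = fps_const 4 * (P * S\<^sup>2 * (P ^ 4 - S ^ 4)) - fps_const 4 * (P\<^sup>2 * S * (P ^ 4 - S ^ 4))"
    unfolding numeral_fps_const [symmetric] by (simp add: numeral_eq_Suc algebra_simps)
  from arg_cong [OF this, of "\<lambda>f. f $ N"]
  show "int (r7 [1,1,1,2,2,2,4] N) - int (r7 [1,1,1,1,2,4,4] N) = 4 * cusp_series $ N"
    unfolding r c by (simp add: 1 del: fps_const_mult_left)
  show "int (r7 [1,2,2,2,2,2,4] N) - 2 * int (r7 [1,2,2,2,4,4,4] N) = cusp_series $ N" if N8: "\<not> 8 dvd N"
  proof -
    have 3: "(P ^ 3 * (P ^ 4 - S ^ 4)) $ N = 0"
    proof (rule supported_mod_nth)
      show "supported_mod 8 (3 * 0 + 0) (P ^ 3 * (P ^ 4 - S ^ 4))"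
        by (intro supported_mod_mult supported_mod_power P S PS)
      show "\<not> [N = 3 * 0 + 0] (mod 8)" using N8 by (simp add: cong_def dvd_eq_mod_eq_0)
    qed
    have "(P\<^sup>2 + S\<^sup>2) * (P + S) ^ 5 - fps_const 2 * ((P\<^sup>2 + S\<^sup>2)\<^sup>2 * (P + S) ^ 3)
      = P * S\<^sup>2 * (P ^ 4 - S ^ 4) + S ^ 3 * (P ^ 4 - S ^ 4)
        - P ^ 3 * (P ^ 4 - S ^ 4) - P\<^sup>2 * S * (P ^ 4 - S ^ 4)"
      unfolding numeral_fps_const [symmetric] by (simp add: numeral_eq_Suc algebra_simps)
    from arg_cong [OF this, of "\<lambda>f. f $ N"]
    show ?thesis
      unfolding r c by (simp add: 1 2 3 del: fps_const_mult_left)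
  qed
  show "cusp_series $ N = 0" if "8 dvd N"
    unfolding c by (rule supported_mod_nth [OF T]) (use that in \<open>auto simp: cong_def elim!: dvdE\<close>)
qed

section \<open>Jacobi's series for the cube of the Euler product\<close>

definition euler_prod :: "complex \<Rightarrow> nat \<Rightarrow> complex" where
  "euler_prod q n = (\<Prod>k<n. 1 - q ^ Suc k)"

lemma euler_prod_0 [simp]: "euler_prod q 0 = 1"
  and euler_prod_Suc: "euler_prod q (Suc n) = euler_prod q n * (1 - q ^ Suc n)"
  by (simp_all add: euler_prod_def)

text \<open>The coefficients of \<open>\<Prod>\<^bsub>k<n\<^esub> (y - q\<^sup>k)\<close>, that is, signed Gaussian binomial coefficients times powers of \<open>q\<close>.\<close>

fun qcoeff :: "complex \<Rightarrow> nat \<Rightarrow> nat \<Rightarrow> complex" where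
  "qcoeff q 0 0 = 1"
| "qcoeff q 0 (Suc k) = 0"
| "qcoeff q (Suc n) 0 = qcoeff q n 0"
| "qcoeff q (Suc n) (Suc k) = qcoeff q n (Suc k) - q ^ n * qcoeff q n k"

lemma qcoeff_eq_0: "n < k \<Longrightarrow> qcoeff q n k = 0"
  by (induction q n k rule: qcoeff.induct) auto

lemma qcoeff_0 [simp]: "qcoeff q n 0 = 1"
  by (induction n) auto

lemma prod_minus_powers: "(\<Prod>k<n. y - q ^ k) = (\<Sum>k\<le>n. qcoeff q n k * y ^ (n - k))"
proof (induction n)
  case (Suc n)
  have "(\<Prod>k<Suc n. y - q ^ k) = (\<Sum>k\<le>n. qcoeff q n k * y ^ (n - k)) * y
      - q ^ n * (\<Sum>k\<le>n. qcoeff q n k * y ^ (n - k))"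
    using Suc by (simp add: algebra_simps)
  also have "(\<Sum>k\<le>n. qcoeff q n k * y ^ (n - k)) * y = (\<Sum>k\<le>n. qcoeff q n k * y ^ (Suc n - k))"
    unfolding sum_distrib_right by (rule sum.cong) (auto simp: Suc_diff_le)
  also have "\<dots> = (\<Sum>k\<le>Suc n. qcoeff q n k * y ^ (Suc n - k))"
    by (simp add: qcoeff_eq_0)
  also have "\<dots> = y ^ Suc n + (\<Sum>k\<le>n. qcoeff q n (Suc k) * y ^ (n - k))"
    by (subst sum.atMost_Suc_shift) simp
  also have "\<dots> - q ^ n * (\<Sum>k\<le>n. qcoeff q n k * y ^ (n - k))
      = (\<Sum>k\<le>Suc n. qcoeff q (Suc n) k * y ^ (Suc n - k))"
    by (subst sum.atMost_Suc_shift) (simp add: sum_distrib_left sum_subtractf algebra_simps)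
  finally show ?case .
qed simp

lemma Suc_choose_two: "Suc n choose 2 = (n choose 2) + n"
  by (simp add: numeral_2_eq_2)

text \<open>Together with \<open>prod_minus_powers\<close> this is the \<open>q\<close>-binomial theorem, in a form that also holds when a factor
\<open>1 - q\<^sup>i\<close> vanishes.\<close>

lemma qcoeff_closed_form:
  "k \<le> n \<Longrightarrow> qcoeff q n k * (euler_prod q k * euler_prod q (n - k))
    = (- 1) ^ k * q ^ (k choose 2) * euler_prod q n"
proof (induction n arbitrary: k)
  case (Suc n)
  show ?case
  proof (cases k)
    case k: (Suc l)
    let ?E = "euler_prod q"
    have l: "l \<le> n" using Suc.prems k by simp
    note IHl = Suc.IH [OF l]
    have q1: "q ^ (Suc l choose 2) = q ^ (l choose 2) * q ^ l" by (simp add: Suc_choose_two power_add)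
    have 1: "qcoeff q n (Suc l) * (?E (Suc l) * ?E (n - l))
      = (- 1) ^ Suc l * q ^ (Suc l choose 2) * ?E n * (1 - q ^ (n - l))"
    proof (cases "l = n")
      case True
      then show ?thesis by (simp add: qcoeff_eq_0)
    next
      case False
      with l have sl: "Suc l \<le> n" and nl: "n - l = Suc (n - Suc l)" by auto
      have E: "?E (n - l) = ?E (n - Suc l) * (1 - q ^ (n - l))"
        by (metis euler_prod_Suc nl)
      have "qcoeff q n (Suc l) * (?E (Suc l) * ?E (n - l))
        = qcoeff q n (Suc l) * (?E (Suc l) * ?E (n - Suc l)) * (1 - q ^ (n - l))"
        unfolding E by (simp only: mult.assoc)
      then show ?thesis unfolding Suc.IH [OF sl] .
    qed
    have 2: "q ^ n * qcoeff q n l * (?E (Suc l) * ?E (n - l))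
      = (- 1) ^ l * q ^ (l choose 2) * ?E n * (1 - q ^ Suc l) * q ^ n"
    proof -
      have "q ^ n * qcoeff q n l * (?E (Suc l) * ?E (n - l))
        = (qcoeff q n l * (?E l * ?E (n - l))) * (1 - q ^ Suc l) * q ^ n"
        unfolding euler_prod_Suc by (simp only: mult_ac)
      then show ?thesis unfolding IHl .
    qed
    have 3: "q ^ l * q ^ (n - l) = q ^ n" using l by (simp add: power_add [symmetric])
    have "qcoeff q (Suc n) k * (?E k * ?E (Suc n - k))
      = qcoeff q n (Suc l) * (?E (Suc l) * ?E (n - l)) - q ^ n * qcoeff q n l * (?E (Suc l) * ?E (n - l))"
      by (simp add: k left_diff_distrib)
    also have "\<dots> = (- 1) ^ Suc l * q ^ (l choose 2) * ?E n * (q ^ l * (1 - q ^ (n - l)) + (1 - q ^ Suc l) * q ^ n)"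
      unfolding 1 2 q1 by (simp add: algebra_simps)
    also have "q ^ l * (1 - q ^ (n - l)) + (1 - q ^ Suc l) * q ^ n = q ^ l * (1 - q ^ Suc n)"
      using 3 by (simp add: algebra_simps)
    finally show ?thesis unfolding k q1 euler_prod_Suc by (simp add: algebra_simps)
  qed (simp add: binomial_eq_0)
qed (simp add: binomial_eq_0)

lemma two_choose_two: "2 * int (n choose 2) = int n * (int n - 1)"
  by (induction n) (auto simp: Suc_choose_two algebra_simps binomial_eq_0)

lemma sum_atMost_odd_pairs:
  fixes N :: nat
  shows "(\<Sum>k\<le>2 * N + 1. f k) = (\<Sum>j\<le>N. f (N - j) + f (N + 1 + j) :: 'a::comm_monoid_add)"
proof -
  have "{..2 * N + 1} = (\<lambda>j. N - j) ` {..N} \<union> (\<lambda>j. N + 1 + j) ` {..N}" (is "_ = ?A \<union> ?B")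
  proof (intro equalityI subsetI)
    fix k assume k: "k \<in> {..2 * N + 1}"
    show "k \<in> ?A \<union> ?B"
    proof (cases "k \<le> N")
      case True
      then have "k = N - (N - k)" "N - k \<in> {..N}" by auto
      then show ?thesis by blast
    next
      case False
      then have "k = N + 1 + (k - N - 1)" "k - N - 1 \<in> {..N}" using k by auto
      then show ?thesis by blast
    qed
  qed auto
  then have "(\<Sum>k\<le>2 * N + 1. f k) = sum f ?A + sum f ?B"
    by (simp only:) (rule sum.union_disjoint, auto)
  also have "sum f ?A = (\<Sum>j\<le>N. f (N - j))"
    by (subst sum.reindex) (auto simp: inj_on_def)
  also have "sum f ?B = (\<Sum>j\<le>N. f (N + 1 + j))"
    by (subst sum.reindex) (auto simp: inj_on_def)
  finally show ?thesis by (simp add: sum.distrib)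
qed

text \<open>Both sides are \<open>q\<^sup>N\<close> times the derivative of \<open>\<Prod>\<^bsub>k\<le>2N\<^esub> (y - q\<^sup>k)\<close> at its root \<open>q\<^sup>N\<close>. This replaces the limit
\<open>z \<longlongrightarrow> 1\<close> in the usual deduction of Jacobi's formula from the triple product identity.\<close>

lemma derivative_at_simple_root:
  "(\<Sum>k\<le>2 * N + 1. of_nat (2 * N + 1 - k) * qcoeff q (2 * N + 1) k * (q ^ N) ^ (2 * N + 1 - k))
    = (- 1) ^ N * q ^ ((N choose 2) + N * N + N) * euler_prod q N ^ 2"
proof -
  let ?n = "2 * N + 1"
  \<comment> \<open>\<open>R\<close> is the product with the factor vanishing at \<open>q ^ N\<close> removed.\<close>
  define R where "R = (\<Prod>k\<in>{..<?n} - {N}. [:- (q ^ k), 1:])"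
  define p where "p = (\<Sum>k\<le>?n. Polynomial.monom (qcoeff q ?n k) (?n - k))"
  have "poly p y = poly ([:- (q ^ N), 1:] * R) y" for y
  proof -
    have "poly p y = (\<Prod>k<?n. y - q ^ k)"
      by (simp add: p_def poly_sum poly_monom prod_minus_powers)
    also have "\<dots> = (y - q ^ N) * (\<Prod>k\<in>{..<?n} - {N}. y - q ^ k)"
      by (rule prod.remove) auto
    finally show ?thesis by (simp add: R_def poly_prod algebra_simps)
  qed
  then have p: "p = [:- (q ^ N), 1:] * R" by (simp add: poly_eq_poly_eq_iff [symmetric] fun_eq_iff)
  have "poly (pderiv p) (q ^ N) * q ^ N = poly R (q ^ N) * q ^ N"
    unfolding p pderiv_mult by (simp add: pderiv_pCons del: mult_pCons_left)
  moreover have "poly (pderiv p) (q ^ N) * q ^ N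
    = (\<Sum>k\<le>?n. of_nat (?n - k) * qcoeff q ?n k * (q ^ N) ^ (?n - k))"
  proof -
    have "pderiv p = (\<Sum>k\<le>?n. pderiv (Polynomial.monom (qcoeff q ?n k) (?n - k)))"
      unfolding p_def by (induction rule: infinite_finite_induct) (auto simp: pderiv_add)
    then have "poly (pderiv p) (q ^ N) * q ^ N
      = (\<Sum>k\<le>?n. of_nat (?n - k) * qcoeff q ?n k * (q ^ N) ^ (?n - k - 1) * q ^ N)"
      by (simp add: poly_sum pderiv_monom poly_monom sum_distrib_right)
    also have "\<dots> = (\<Sum>k\<le>?n. of_nat (?n - k) * qcoeff q ?n k * (q ^ N) ^ (?n - k))"
    proof (rule sum.cong)
      fix k assume "k \<in> {..?n}"
      show "of_nat (?n - k) * qcoeff q ?n k * (q ^ N) ^ (?n - k - 1) * q ^ N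
        = of_nat (?n - k) * qcoeff q ?n k * (q ^ N) ^ (?n - k)"
        by (cases "?n - k") simp_all
    qed simp
    finally show ?thesis .
  qed
  moreover have "poly R (q ^ N) * q ^ N = (- 1) ^ N * q ^ ((N choose 2) + N * N + N) * euler_prod q N ^ 2"
  proof -
    have split: "{..<?n} - {N} = {..<N} \<union> (\<lambda>k. N + Suc k) ` {..<N}"
    proof (intro equalityI subsetI)
      fix k assume k: "k \<in> {..<?n} - {N}"
      show "k \<in> {..<N} \<union> (\<lambda>k. N + Suc k) ` {..<N}"
      proof (cases "k < N")
        case False
        then have "k = N + Suc (k - N - 1)" "k - N - 1 \<in> {..<N}" using k by auto
        then show ?thesis by blast
      qed simp
    qed auto
    have "poly R (q ^ N) = (\<Prod>k\<in>{..<?n} - {N}. q ^ N - q ^ k)"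
      by (simp add: R_def poly_prod)
    also have "\<dots> = (\<Prod>k<N. q ^ N - q ^ k) * (\<Prod>k\<in>(\<lambda>k. N + Suc k) ` {..<N}. q ^ N - q ^ k)"
      unfolding split by (rule prod.union_disjoint) auto
    also have "(\<Prod>k\<in>(\<lambda>k. N + Suc k) ` {..<N}. q ^ N - q ^ k) = (\<Prod>k<N. q ^ N - q ^ (N + Suc k))"
      by (subst prod.reindex) (auto simp: inj_on_def)
    also have "\<dots> = (\<Prod>k<N. q ^ N * (1 - q ^ Suc k))"
      by (rule prod.cong) (auto simp: power_add algebra_simps)
    also have "\<dots> = q ^ (N * N) * euler_prod q N"
      by (simp add: prod.distrib euler_prod_def power_mult)
    also have "(\<Prod>k<N. q ^ N - q ^ k) = (\<Prod>k<N. (- 1) * q ^ k * (1 - q ^ (N - k)))"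
    proof (rule prod.cong)
      fix k assume "k \<in> {..<N}"
      then have "q ^ N = q ^ k * q ^ (N - k)" by (simp add: power_add [symmetric])
      then show "q ^ N - q ^ k = (- 1) * q ^ k * (1 - q ^ (N - k))" by (simp add: algebra_simps)
    qed simp
    also have "\<dots> = (- 1) ^ N * (\<Prod>k<N. q ^ k) * (\<Prod>k<N. 1 - q ^ (N - k))"
      by (simp only: prod.distrib prod_constant card_lessThan)
    also have "(\<Prod>k<N. 1 - q ^ (N - k)) = euler_prod q N"
      unfolding euler_prod_def
      by (subst prod.nat_diff_reindex [symmetric]) (rule prod.cong, auto simp: Suc_diff_Suc)
    also have "(\<Prod>k<N. q ^ k) = q ^ (N choose 2)"
      by (induction N) (auto simp: binomial_eq_0 Suc_choose_two power_add mult.commute)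
    finally show ?thesis by (simp add: power_add power2_eq_square)
  qed
  ultimately show ?thesis by simp
qed

lemma euler_factor_nonzero:
  assumes "norm q < 1"
  shows "1 - q ^ Suc i \<noteq> (0 :: complex)"
proof
  assume "1 - q ^ Suc i = 0"
  then have "norm (q ^ Suc i) = 1" by (metis eq_iff_diff_eq_0 norm_one)
  moreover have "norm (q ^ Suc i) < 1"
  proof (cases "q = 0")
    case False
    then show ?thesis unfolding norm_power using assms by (intro power_Suc_less_one) auto
  qed simp
  ultimately show False by simp
qed

lemma euler_prod_nonzero: "norm q < 1 \<Longrightarrow> euler_prod q k \<noteq> 0"
  using euler_factor_nonzero [of q] by (auto simp: euler_prod_def)

text \<open>A finite form of Jacobi's formula: for \<open>N \<longlongrightarrow> \<infinity>\<close> the quotient of Euler products tends to the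
reciprocal of the infinite product.\<close>

lemma finite_jacobi_cube:
  assumes q: "q \<noteq> 0" "norm q < 1"
  shows "(\<Sum>j\<le>N. (- 1) ^ j * of_nat (2 * j + 1) * q ^ (Suc j choose 2)
      * (euler_prod q (2 * N + 1) / (euler_prod q (N - j) * euler_prod q (N + 1 + j))))
    = euler_prod q N ^ 2"
proof -
  let ?n = "2 * N + 1" and ?E = "euler_prod q"
  define C where "C = (N choose 2) + N * N + N"
  note nz = euler_prod_nonzero [OF q(2)]
  let ?r = "\<lambda>j. ?E ?n / (?E (N - j) * ?E (N + 1 + j))"
  \<comment> \<open>The terms with indices \<open>N - j\<close> and \<open>N + 1 + j\<close> carry the same power of \<open>q\<close> and opposite signs, so
    the weights \<open>N + 1 + j\<close> and \<open>N - j\<close> combine to \<open>2j + 1\<close>.\<close>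
  have pair: "of_nat (?n - (N - j)) * qcoeff q ?n (N - j) * (q ^ N) ^ (?n - (N - j))
      + of_nat (?n - (N + 1 + j)) * qcoeff q ?n (N + 1 + j) * (q ^ N) ^ (?n - (N + 1 + j))
    = (- 1) ^ N * q ^ C * ((- 1) ^ j * of_nat (2 * j + 1) * q ^ (Suc j choose 2) * ?r j)"
    if "j \<le> N" for j
  proof -
    have n1: "?n - (N - j) = N + 1 + j" and n2: "?n - (N + 1 + j) = N - j"
      using that by auto
    have q1: "qcoeff q ?n (N - j) = (- 1) ^ (N - j) * q ^ ((N - j) choose 2) * ?r j"
    proof -
      have "qcoeff q ?n (N - j) * (?E (N - j) * ?E (N + 1 + j))
        = (- 1) ^ (N - j) * q ^ ((N - j) choose 2) * ?E ?n"
        unfolding n1 [symmetric] by (rule qcoeff_closed_form) simp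
      moreover have "?E (N - j) * ?E (N + 1 + j) \<noteq> 0" using nz by simp
      ultimately show ?thesis unfolding times_divide_eq_right by (intro eq_divide_imp)
    qed
    have q2: "qcoeff q ?n (N + 1 + j) = (- 1) ^ (N + 1 + j) * q ^ ((N + 1 + j) choose 2) * ?r j"
    proof -
      have "qcoeff q ?n (N + 1 + j) * (?E (N - j) * ?E (N + 1 + j))
        = (- 1) ^ (N + 1 + j) * q ^ ((N + 1 + j) choose 2) * ?E ?n"
        unfolding n2 [symmetric] mult.commute [of "?E (?n - (N + 1 + j))"]
        by (rule qcoeff_closed_form) (use that in simp)
      moreover have "?E (N - j) * ?E (N + 1 + j) \<noteq> 0" using nz by simp
      ultimately show ?thesis unfolding times_divide_eq_right by (intro eq_divide_imp)
    qed
    define d where "d = N - j"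
    have d: "N = j + d" using that by (simp add: d_def)
    have t: "2 * int (d choose 2) = int d * (int d - 1)"
      "2 * int ((j + d) choose 2) = (int j + int d) * (int j + int d - 1)"
      "2 * int (Suc j choose 2) = (int j + 1) * int j"
      "2 * int ((j + d + 1 + j) choose 2) = (int j + int d + 1 + int j) * (int j + int d + int j)"
      using two_choose_two [of d] two_choose_two [of "j + d"] two_choose_two [of "Suc j"]
        two_choose_two [of "j + d + 1 + j"] by simp_all
    have Nj: "N - j = d" using d by simp
    have "2 * int ((d choose 2) + N * (N + 1 + j)) = 2 * int (C + (Suc j choose 2))"
      unfolding C_def d of_nat_add of_nat_mult of_nat_1 distrib_left [of 2] t by (simp add: algebra_simps)
    then have e1: "((N - j) choose 2) + N * (N + 1 + j) = C + (Suc j choose 2)"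
      unfolding Nj by (simp only: mult_cancel_left of_nat_eq_iff) simp
    have "2 * int (((N + 1 + j) choose 2) + N * d) = 2 * int (C + (Suc j choose 2))"
      unfolding C_def d of_nat_add of_nat_mult distrib_left [of 2] t by (simp add: algebra_simps)
    then have e2: "((N + 1 + j) choose 2) + N * (N - j) = C + (Suc j choose 2)"
      unfolding Nj by (simp only: mult_cancel_left of_nat_eq_iff) simp
    have s1: "(- 1 :: complex) ^ (N - j) = (- 1) ^ N * (- 1) ^ j"
      and s2: "(- 1 :: complex) ^ (N + 1 + j) = - ((- 1) ^ N * (- 1) ^ j)"
      unfolding d by (cases "even d"; cases "even j"; simp)+
    have p1: "q ^ ((N - j) choose 2) * (q ^ N) ^ (N + 1 + j) = q ^ C * q ^ (Suc j choose 2)"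
      unfolding power_mult [symmetric] power_add [symmetric] e1 ..
    have p2: "q ^ ((N + 1 + j) choose 2) * (q ^ N) ^ (N - j) = q ^ C * q ^ (Suc j choose 2)"
      unfolding power_mult [symmetric] power_add [symmetric] e2 ..
    define X where "X = (- 1) ^ N * (- 1) ^ j * (q ^ C * q ^ (Suc j choose 2)) * ?r j"
    have "of_nat (?n - (N - j)) * qcoeff q ?n (N - j) * (q ^ N) ^ (?n - (N - j)) = of_nat (N + 1 + j) * X"
      unfolding n1 q1 s1 X_def p1 [symmetric] by (simp only: mult_ac)
    moreover have "of_nat (?n - (N + 1 + j)) * qcoeff q ?n (N + 1 + j) * (q ^ N) ^ (?n - (N + 1 + j))
      = - (of_nat (N - j) * X)"
      unfolding n2 q2 s2 X_def p2 [symmetric] by (simp only: mult_ac mult_minus_left mult_minus_right)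
    moreover have "of_nat (2 * j + 1) = of_nat (N + 1 + j) - (of_nat (N - j) :: complex)"
      using that by (simp add: of_nat_diff)
    moreover have "(- 1) ^ N * q ^ C * ((- 1) ^ j * of_nat (2 * j + 1) * q ^ (Suc j choose 2) * ?r j)
      = of_nat (2 * j + 1) * X"
      unfolding X_def by (simp only: mult_ac)
    ultimately show ?thesis by (simp only: diff_conv_add_uminus distrib_right mult_minus_left)
  qed
  have "(- 1) ^ N * q ^ C * (\<Sum>j\<le>N. (- 1) ^ j * of_nat (2 * j + 1) * q ^ (Suc j choose 2) * ?r j)
    = (\<Sum>j\<le>N. (- 1) ^ N * q ^ C * ((- 1) ^ j * of_nat (2 * j + 1) * q ^ (Suc j choose 2) * ?r j))"
    by (rule sum_distrib_left)
  also have "\<dots> = (\<Sum>j\<le>N. of_nat (?n - (N - j)) * qcoeff q ?n (N - j) * (q ^ N) ^ (?n - (N - j))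
      + of_nat (?n - (N + 1 + j)) * qcoeff q ?n (N + 1 + j) * (q ^ N) ^ (?n - (N + 1 + j)))"
    by (rule sum.cong [OF refl], rule pair [symmetric]) simp
  also have "\<dots> = (\<Sum>k\<le>?n. of_nat (?n - k) * qcoeff q ?n k * (q ^ N) ^ (?n - k))"
    by (rule sum_atMost_odd_pairs [symmetric])
  also have "\<dots> = (- 1) ^ N * q ^ C * ?E N ^ 2"
    unfolding C_def by (rule derivative_at_simple_root)
  finally have "(- 1) ^ N * q ^ C * (\<Sum>j\<le>N. (- 1) ^ j * of_nat (2 * j + 1) * q ^ (Suc j choose 2) * ?r j)
    = (- 1) ^ N * q ^ C * ?E N ^ 2" .
  then show ?thesis using q(1) by simp
qed

lemma euler_prod_LIMSEQ:
  assumes "norm q < 1"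
  shows "euler_prod q \<longlonglongrightarrow> (\<Prod>n. 1 - q ^ Suc n)" "(\<Prod>n. 1 - q ^ Suc n) \<noteq> 0"
proof -
  have "summable (\<lambda>n. norm q ^ n)" using assms by (simp add: summable_geometric)
  then have "summable (\<lambda>n. norm q ^ Suc n)" by (subst summable_Suc_iff)
  then have "summable (\<lambda>n. norm (1 - q ^ Suc n - 1))" by (simp add: norm_power norm_mult)
  then have "abs_convergent_prod (\<lambda>n. 1 - q ^ Suc n)" by (rule summable_imp_abs_convergent_prod)
  then have conv: "convergent_prod (\<lambda>n. 1 - q ^ Suc n)" by (rule abs_convergent_prod_imp_convergent_prod)
  then have "(\<lambda>n. \<Prod>k\<le>n. 1 - q ^ Suc k) \<longlonglongrightarrow> (\<Prod>n. 1 - q ^ Suc n)"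
    by (rule convergent_prod_LIMSEQ)
  then have "(\<lambda>n. euler_prod q (Suc n)) \<longlonglongrightarrow> (\<Prod>n. 1 - q ^ Suc n)"
    by (simp only: euler_prod_def lessThan_Suc_atMost)
  then show "euler_prod q \<longlonglongrightarrow> (\<Prod>n. 1 - q ^ Suc n)" by (rule LIMSEQ_imp_Suc)
  show "(\<Prod>n. 1 - q ^ Suc n) \<noteq> 0"
    using conv euler_factor_nonzero [OF assms] by (rule prodinf_nonzero)
qed

lemma le_Suc_choose_two: "j \<le> Suc j choose 2"
  by (simp add: Suc_choose_two)

text \<open>Tannery's theorem applied to the finite form. The summable bound comes from the Euler products being
bounded and bounded away from zero.\<close>

theorem jacobi_cube:
  fixes q :: complex
  assumes q: "q \<noteq> 0" "norm q < 1"
  shows "(\<lambda>j. (- 1) ^ j * of_nat (2 * j + 1) * q ^ (Suc j choose 2)) sums (\<Prod>n. 1 - q ^ Suc n) ^ 3"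
proof -
  let ?E = "euler_prod q"
  define L where "L = (\<Prod>n. 1 - q ^ Suc n)"
  define c where "c = (\<lambda>j. (- 1) ^ j * of_nat (2 * j + 1) * q ^ (Suc j choose 2))"
  define a where "a = (\<lambda>j N. if j \<le> N then c j * (?E (2 * N + 1) / (?E (N - j) * ?E (N + 1 + j))) else 0)"
  have E: "?E \<longlonglongrightarrow> L" and L: "L \<noteq> 0"
    using euler_prod_LIMSEQ [OF q(2)] by (simp_all add: L_def)
  obtain M where M: "M > 0" "\<And>n. norm (?E n) \<le> M"
    using convergent_imp_Bseq [OF convergentI [OF E]] unfolding Bseq_def by blast
  have "(\<lambda>n. inverse (?E n)) \<longlonglongrightarrow> inverse L" using E L by (rule tendsto_inverse)
  then have "Bseq (\<lambda>n. inverse (?E n))" by (intro convergent_imp_Bseq convergentI)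
  then obtain M' where M': "M' > 0" "\<And>n. norm (inverse (?E n)) \<le> M'"
    unfolding Bseq_def by blast
  have bound: "norm (a j N) \<le> norm (c j) * (M * (M' * M'))" for j N
  proof (cases "j \<le> N")
    case True
    have "norm (?E (2 * N + 1) / (?E (N - j) * ?E (N + 1 + j)))
      = norm (?E (2 * N + 1)) * (norm (inverse (?E (N - j))) * norm (inverse (?E (N + 1 + j))))"
      by (simp only: divide_inverse inverse_mult_distrib norm_mult)
    also have "\<dots> \<le> M * (M' * M')"
      using M M' by (intro mult_mono) (auto intro: less_imp_le)
    finally have "norm (?E (2 * N + 1) / (?E (N - j) * ?E (N + 1 + j))) \<le> M * (M' * M')" .
    moreover have "norm (a j N) = norm (c j) * norm (?E (2 * N + 1) / (?E (N - j) * ?E (N + 1 + j)))"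
      by (simp only: a_def True if_True norm_mult)
    ultimately show ?thesis by (simp only: mult_left_mono norm_ge_zero)
  next
    case False
    then show ?thesis using M M' by (simp add: a_def)
  qed
  have "summable (\<lambda>j. norm (c j) * (M * (M' * M')))"
  proof (rule summable_mult2, rule summable_comparison_test')
    have "summable (\<lambda>j. of_nat (Suc j) * norm q ^ j)"
      using geometric_deriv_sums [of "norm q"] q(2) by (auto simp: sums_iff)
    then show "summable (\<lambda>j. 2 * (of_nat (Suc j) * norm q ^ j))" by (rule summable_mult)
    show "norm (norm (c j)) \<le> 2 * (of_nat (Suc j) * norm q ^ j)" for j
    proof -
      have "norm q ^ (Suc j choose 2) \<le> norm q ^ j"
        using q(2) le_Suc_choose_two by (intro power_decreasing) auto
      then have "of_nat (2 * j + 1) * norm q ^ (Suc j choose 2) \<le> (2 * of_nat (Suc j)) * norm q ^ j"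
        by (intro mult_mono) auto
      moreover have "norm (c j) = of_nat (2 * j + 1) * norm q ^ (Suc j choose 2)"
        by (simp only: c_def norm_mult norm_power norm_minus_cancel norm_one power_one mult_1_left norm_of_nat)
      ultimately have "norm (c j) \<le> 2 * (of_nat (Suc j) * norm q ^ j)" by (simp only: mult.assoc)
      then show ?thesis by (simp only: real_norm_def abs_norm_cancel)
    qed
  qed
  have lim: "(\<lambda>N. a j N) \<longlonglongrightarrow> c j * (L / (L * L))" for j
  proof -
    have "(\<lambda>N. ?E (2 * N + 1)) \<longlonglongrightarrow> L"
      using LIMSEQ_subseq_LIMSEQ [OF E, of "\<lambda>N. 2 * N + 1"] by (simp add: strict_mono_def o_def)
    moreover have "(\<lambda>N. ?E (N - j)) \<longlonglongrightarrow> L"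
      by (rule LIMSEQ_offset [where k = j]) (simp add: E)
    moreover have "(\<lambda>N. ?E (N + 1 + j)) \<longlonglongrightarrow> L"
      using LIMSEQ_ignore_initial_segment [OF E, of "1 + j"] by (simp add: ac_simps)
    ultimately have "(\<lambda>N. c j * (?E (2 * N + 1) / (?E (N - j) * ?E (N + 1 + j)))) \<longlonglongrightarrow> c j * (L / (L * L))"
      using L by (intro tendsto_intros) auto
    moreover have "eventually (\<lambda>N. c j * (?E (2 * N + 1) / (?E (N - j) * ?E (N + 1 + j))) = a j N) sequentially"
      using eventually_ge_at_top [of j] by eventually_elim (simp add: a_def)
    ultimately show ?thesis by (rule Lim_transform_eventually)
  qed
  have T: "summable (\<lambda>j. norm (c j * (L / (L * L))))"
    "(\<lambda>N. \<Sum>j. a j N) \<longlonglongrightarrow> (\<Sum>j. c j * (L / (L * L)))"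
  proof -
    have "eventually (\<lambda>(j, N). norm (a j N) \<le> norm (c j) * (M * (M' * M'))) (at_top \<times>\<^sub>F sequentially)"
      using bound by (intro always_eventually) auto
    from tannerys_theorem [where a = a and b = "\<lambda>j. c j * (L / (L * L))", OF lim this
        \<open>summable (\<lambda>j. norm (c j) * (M * (M' * M')))\<close> sequentially_bot]
    show "summable (\<lambda>j. norm (c j * (L / (L * L))))"
      "(\<lambda>N. \<Sum>j. a j N) \<longlonglongrightarrow> (\<Sum>j. c j * (L / (L * L)))"
      by blast+
  qed
  have "(\<Sum>j. a j N) = ?E N ^ 2" for N
  proof -
    have "(\<Sum>j. a j N) = (\<Sum>j\<le>N. a j N)" by (rule suminf_finite) (auto simp: a_def)
    also have "\<dots> = (\<Sum>j\<le>N. (- 1) ^ j * of_nat (2 * j + 1) * q ^ (Suc j choose 2)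
      * (?E (2 * N + 1) / (?E (N - j) * ?E (N + 1 + j))))"
      by (rule sum.cong) (auto simp: a_def c_def)
    also have "\<dots> = ?E N ^ 2" by (rule finite_jacobi_cube [OF q])
    finally show ?thesis .
  qed
  then have "(\<lambda>N. \<Sum>j. a j N) \<longlonglongrightarrow> L ^ 2" using E by (auto intro: tendsto_power)
  then have sum: "(\<Sum>j. c j * (L / (L * L))) = L ^ 2" using T(2) LIMSEQ_unique by blast
  have "(\<lambda>j. c j * (L / (L * L))) sums L ^ 2"
    using summable_norm_cancel [OF T(1)] sum by (simp add: sums_iff)
  then have "(\<lambda>j. c j * (L / (L * L)) * L) sums (L ^ 2 * L)" by (rule sums_mult2)
  moreover have "c j * (L / (L * L)) * L = c j" for j using L by simp
  moreover have "L ^ 2 * L = L ^ 3" by (simp add: power2_eq_square power3_eq_cube)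
  ultimately show ?thesis by (simp only: c_def L_def)
qed

section \<open>The coefficients of the twelfth power of the eta function\<close>

lemma jacobi_series_nth: "jacobi_series $ ((2 * j + 1)\<^sup>2) = (- 1) ^ j * (2 * int j + 1)"
proof -
  define s where "s = (- 1) ^ j * (2 * int j + 1)"
  have s2: "s\<^sup>2 = int ((2 * j + 1)\<^sup>2)"
    by (simp add: s_def power_mult_distrib flip: power_mult)
  have s4: "s mod 4 = 1" "(- s) mod 4 \<noteq> 1"
    unfolding s_def by (cases "even j"; auto elim!: evenE oddE; presburger)+
  have "{t \<in> {t. t mod 4 = 1}. t\<^sup>2 = int ((2 * j + 1)\<^sup>2)} = {s}"
    using s4 unfolding s2 [symmetric] by (auto simp: power2_eq_iff)
  then show ?thesis unfolding jacobi_series_def genfun_nth by (simp add: s_def)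
qed

lemma jacobi_series_nth_eq_0:
  assumes "n \<notin> range (\<lambda>j. (2 * j + 1)\<^sup>2)"
  shows "jacobi_series $ n = 0"
proof -
  have "s\<^sup>2 \<noteq> int n" if "s mod 4 = 1" for s
  proof
    assume "s\<^sup>2 = int n"
    then have "n = (nat \<bar>s\<bar>)\<^sup>2" by (metis nat_int nat_power_eq abs_ge_zero power2_abs)
    moreover have "odd (nat \<bar>s\<bar>)" using that by (simp add: even_nat_iff) presburger
    then obtain j where "nat \<bar>s\<bar> = 2 * j + 1" by (rule oddE)
    ultimately show False using assms by auto
  qed
  then have "{s \<in> {s. s mod 4 = 1}. s\<^sup>2 = int n} = {}" by blast
  then show ?thesis unfolding jacobi_series_def genfun_nth by (simp only: sum.empty)
qed

lemma odd_square_eq: "(2 * j + 1)\<^sup>2 = 1 + 8 * (Suc j choose 2)"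
  by (induction j) (simp_all add: Suc_choose_two power2_eq_square algebra_simps binomial_eq_0)

lemma supported_jacobi_series: "supported_mod 8 1 jacobi_series"
proof -
  have "[n = 1] (mod 8)" if "jacobi_series $ n \<noteq> 0" for n
  proof -
    have "n \<in> range (\<lambda>j. (2 * j + 1)\<^sup>2)"
    proof (rule ccontr)
      assume "n \<notin> range (\<lambda>j. (2 * j + 1)\<^sup>2)"
      from jacobi_series_nth_eq_0 [OF this] that show False by simp
    qed
    then obtain j where "n = (2 * j + 1)\<^sup>2" by (rule rangeE)
    then have n: "n = 1 + 8 * (Suc j choose 2)" by (simp only: odd_square_eq)
    show ?thesis unfolding n cong_def by simp
  qed
  then show ?thesis by (simp add: supported_mod_def)
qed

lemma jacobi_series_sums:
  fixes x :: complex
  assumes "x \<noteq> 0" "norm x < 1"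
  shows "(\<lambda>n. of_int (jacobi_series $ n) * x ^ n) sums (x * (\<Prod>n. 1 - (x ^ 8) ^ Suc n) ^ 3)"
proof -
  have "norm (x ^ 8) < 1" 
    unfolding norm_power eval_nat_numeral using assms by (intro power_Suc_less_one) auto
  with assms have "(\<lambda>j. x * ((- 1) ^ j * of_nat (2 * j + 1) * (x ^ 8) ^ (Suc j choose 2)))
    sums (x * (\<Prod>n. 1 - (x ^ 8) ^ Suc n) ^ 3)"
    by (intro sums_mult jacobi_cube) auto
  moreover have "x * ((- 1) ^ j * of_nat (2 * j + 1) * (x ^ 8) ^ (Suc j choose 2))
    = of_int (jacobi_series $ ((2 * j + 1)\<^sup>2)) * x ^ ((2 * j + 1)\<^sup>2)" for j
  proof -
    have "x ^ ((2 * j + 1)\<^sup>2) = x * (x ^ 8) ^ (Suc j choose 2)"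
      by (simp only: odd_square_eq power_add power_mult power_one_right)
    moreover have "of_int (jacobi_series $ ((2 * j + 1)\<^sup>2)) = (- 1) ^ j * (of_nat (2 * j + 1) :: complex)"
      unfolding jacobi_series_nth by simp
    ultimately show ?thesis by (simp only: mult_ac)
  qed
  ultimately have "(\<lambda>j. of_int (jacobi_series $ ((2 * j + 1)\<^sup>2)) * x ^ ((2 * j + 1)\<^sup>2))
    sums (x * (\<Prod>n. 1 - (x ^ 8) ^ Suc n) ^ 3)"
    by (simp only:)
  moreover have "strict_mono (\<lambda>j :: nat. (2 * j + 1)\<^sup>2)"
    by (intro strict_monoI power_strict_mono) auto
  moreover have "of_int (jacobi_series $ n) * x ^ n = 0" if "n \<notin> range (\<lambda>j. (2 * j + 1)\<^sup>2)" for n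
    by (simp only: jacobi_series_nth_eq_0 [OF that] of_int_0 mult_zero_left)
  ultimately show ?thesis
    using sums_mono_reindex [of "\<lambda>j. (2 * j + 1)\<^sup>2" "\<lambda>n. of_int (jacobi_series $ n) * x ^ n"] by blast
qed

definition complex_fps :: "int fps \<Rightarrow> complex fps" where
  "complex_fps f = Abs_fps (\<lambda>n. of_int (f $ n))"

lemma complex_fps_mult: "complex_fps (f * g) = complex_fps f * complex_fps g"
  by (rule fps_ext) (simp add: complex_fps_def fps_mult_nth)

lemma complex_fps_power: "complex_fps (f ^ k) = complex_fps f ^ k"
proof (induction k)
  case 0
  show ?case by (rule fps_ext) (simp add: complex_fps_def fps_one_nth)
qed (simp add: complex_fps_mult)

lemma q_exp_power: "q_exp z ^ k = q_exp (of_nat k * z)"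
  by (simp add: q_exp_def exp_of_nat_mult [symmetric] algebra_simps)

lemma norm_q_exp: "norm (q_exp z) = exp (- 2 * pi * Im z)"
  by (simp add: q_exp_def norm_exp_eq_Re)

lemma Delta_6_4_sums:
  assumes "Im z > 0"
  shows "(\<lambda>n. of_int ((jacobi_series ^ 4) $ (4 * n)) * q_exp z ^ n) sums Delta_6_4 z"
proof -
  \<comment> \<open>With \<open>x = q\<^bsup>1/4\<^esup>\<close> the factor \<open>q\<^bsup>1/12\<^esup>\<close> of \<open>\<eta>(2z)\<close> has third power \<open>x\<close>.\<close>
  define x where "x = q_exp (z / 4)"
  have x: "x \<noteq> 0" "norm x < 1"
    using assms by (simp_all add: x_def norm_q_exp) (simp add: q_exp_def)
  have summ: "summable (\<lambda>n. fps_nth (complex_fps jacobi_series) n * y ^ n)" if "y \<noteq> 0" "norm y < 1" for y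
    using jacobi_series_sums [OF that] by (auto simp: complex_fps_def sums_iff)
  have "conv_radius (fps_nth (complex_fps jacobi_series)) \<ge> 1"
  proof (rule conv_radius_geI_ex')
    show "summable (\<lambda>n. fps_nth (complex_fps jacobi_series) n * of_real r ^ n)" if "0 < r" "ereal r < 1" for r
      using that by (intro summ) auto
  qed
  then have rad: "fps_conv_radius (complex_fps jacobi_series) \<ge> 1"
    by (simp add: fps_conv_radius_def)
  then have rx: "norm x < fps_conv_radius (complex_fps jacobi_series)"
    using x(2) by (metis ereal_less(3) less_le_trans)
  have "eval_fps (complex_fps jacobi_series) x = x * (\<Prod>n. 1 - (x ^ 8) ^ Suc n) ^ 3"
    using jacobi_series_sums [OF x] by (simp add: eval_fps_def complex_fps_def sums_iff)
  also have "\<dots> = dedekind_eta (2 * z) ^ 3"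
  proof -
    have "x ^ 8 = q_exp (2 * z)" by (simp add: x_def q_exp_power)
    moreover have "x = q_exp (2 * z / 24) ^ 3" by (simp add: x_def q_exp_power)
    ultimately show ?thesis by (simp add: dedekind_eta_def power_mult_distrib)
  qed
  finally have "eval_fps (complex_fps jacobi_series ^ 4) x = Delta_6_4 z"
    using rx by (simp add: eval_fps_power Delta_6_4_def flip: power_mult)
  moreover have "norm x < fps_conv_radius (complex_fps jacobi_series ^ 4)"
    using rx fps_conv_radius_power [of "complex_fps jacobi_series" 4] by (rule less_le_trans)
  ultimately have "(\<lambda>n. of_int ((jacobi_series ^ 4) $ n) * x ^ n) sums Delta_6_4 z"
    using summable_fps [of x "complex_fps jacobi_series ^ 4"]
    by (simp add: eval_fps_def sums_iff complex_fps_power [symmetric]) (simp add: complex_fps_def)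
  moreover have "(jacobi_series ^ 4) $ n = 0" if "n \<notin> range (\<lambda>n. 4 * n)" for n
  proof (rule supported_mod_nth)
    show "supported_mod 4 (4 * 1) (jacobi_series ^ 4)"
      by (rule supported_mod_power [OF supported_mod_coarsen [OF supported_jacobi_series]]) simp
    show "\<not> [n = 4 * 1] (mod 4)"
    proof
      assume "[n = 4 * 1] (mod 4)"
      then have "n mod 4 = 0" by (simp add: cong_def)
      then have "n = 4 * (n div 4)" by presburger
      with that show False by blast
    qed
  qed
  ultimately have "(\<lambda>n. of_int ((jacobi_series ^ 4) $ (4 * n)) * x ^ (4 * n)) sums Delta_6_4 z"
    by (subst sums_mono_reindex [where g = "\<lambda>n. 4 * n" and f = "\<lambda>n. of_int ((jacobi_series ^ 4) $ n) * x ^ n"])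
      (auto simp: strict_mono_def)
  moreover have "x ^ 4 = q_exp z" by (simp add: x_def q_exp_power)
  ultimately show ?thesis by (simp add: power_mult)
qed

text \<open>Every nonzero \<open>q\<close> of the unit disc is \<open>q_exp z\<close> for some \<open>z\<close> in the upper half-plane, so that this is
the uniqueness of the coefficients of a convergent power series.\<close>

lemma q_expansion_unique:
  fixes t u :: "nat \<Rightarrow> int"
  assumes "t 0 = u 0"
    and t: "\<And>z. Im z > 0 \<Longrightarrow> (\<lambda>n. of_int (t n) * q_exp z ^ n) sums f z"
    and u: "\<And>z. Im z > 0 \<Longrightarrow> (\<lambda>n. of_int (u n) * q_exp z ^ n) sums f z"
  shows "t = u"
proof (rule ccontr)
  assume "t \<noteq> u"
  then obtain m where m: "t m \<noteq> u m" by auto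
  then have "m > 0" using assms(1) by (cases m) auto
  have zero: "(\<lambda>n. of_int (t n - u n) * (x - 0) ^ n) sums (0 :: complex)" if "norm (x - 0) < 1" for x
  proof (cases "x = 0")
    case True
    have "of_int (t n - u n) * (x - 0) ^ n = 0" for n
      using True assms(1) by (cases n) simp_all
    then show ?thesis by (simp only: sums_zero)
  next
    case False
    define z where "z = Ln x / (2 * of_real pi * \<i>)"
    have x: "q_exp z = x" using False by (simp add: q_exp_def z_def)
    have "exp (- 2 * pi * Im z) < exp 0" using that norm_q_exp [of z] x by simp
    then have "Im z > 0" unfolding exp_less_cancel_iff by (simp add: zero_less_mult_iff)
    from sums_diff [OF t [OF this] u [OF this]] show ?thesis
      by (simp add: x algebra_simps)
  qed
  obtain s where s: "0 < s" "\<And>x :: complex. x \<in> cball 0 s - {0} \<Longrightarrow> (0 :: complex) \<noteq> 0"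
    using powser_0_nonzero [of 1 0 "\<lambda>n. of_int (t n - u n)" "\<lambda>_. 0", OF _ zero _ _ \<open>m > 0\<close>] m by auto
  have "of_real s \<in> cball 0 s - {0 :: complex}" using s(1) by auto
  then show False using s(2) by blast
qed

text \<open>Existence and uniqueness of the expansion, together with its value.\<close>

theorem tau_6_4_eq: "tau_6_4 n = (jacobi_series ^ 4) $ (4 * n)"
proof -
  have "(jacobi_series ^ 4) $ 0 = 0"
  proof (rule supported_mod_nth)
    show "supported_mod 8 (4 * 1) (jacobi_series ^ 4)"
      by (rule supported_mod_power [OF supported_jacobi_series])
    show "\<not> [0 = 4 * 1 :: nat] (mod 8)" by (simp add: cong_def)
  qed
  then have "tau_6_4 = (\<lambda>n. (jacobi_series ^ 4) $ (4 * n))"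
    unfolding tau_6_4_def
    by (intro the_equality) (auto intro: Delta_6_4_sums q_expansion_unique [where f = Delta_6_4])
  then show ?thesis by (simp add: fun_eq_iff)
qed

section \<open>Hecke relations for a theta series of \<open>x\<^sup>2 + 2y\<^sup>2\<close>\<close>

definition reps :: "int \<Rightarrow> (int \<times> int) set" where
  "reps n = {(x, y). x\<^sup>2 + 2 * y\<^sup>2 = n}"

text \<open>The sum of \<open>\<alpha>\<^sup>2\<close> over the \<open>\<alpha> = x + y\<surd>-2\<close> of norm \<open>n\<close>; the imaginary parts cancel. This is twice the
\<open>n\<close>-th coefficient of the newform \<open>\<eta>(z)\<^sup>2 \<eta>(2z) \<eta>(4z) \<eta>(8z)\<^sup>2\<close> of weight 3 with complex multiplication.\<close>

definition hecke_theta :: "nat \<Rightarrow> int" where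
  "hecke_theta n = (\<Sum>(x, y)\<in>reps (int n). x\<^sup>2 - 2 * y\<^sup>2)"

lemma finite_reps: "finite (reps n)"
proof (rule finite_subset)
  show "reps n \<subseteq> {- n..n} \<times> {- n..n}"
  proof (rule subrelI)
    fix x y assume "(x, y) \<in> reps n"
    then have n: "x\<^sup>2 + 2 * y\<^sup>2 = n" by (simp add: reps_def)
    have "\<bar>t\<bar> \<le> t\<^sup>2" for t :: int
      using self_le_power [of "\<bar>t\<bar>" 2] by (cases "t = 0") auto
    from this [of x] this [of y] n have "\<bar>x\<bar> \<le> n" "\<bar>y\<bar> \<le> n"
      using zero_le_power2 [of x] zero_le_power2 [of y] by linarith+
    then show "(x, y) \<in> {- n..n} \<times> {- n..n}" by auto
  qed
qed simp

text \<open>Multiplication in \<open>\<int>[\<surd>-2]\<close>.\<close>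

definition zmul :: "int \<times> int \<Rightarrow> int \<times> int \<Rightarrow> int \<times> int" where
  "zmul = (\<lambda>(a, b) (c, d). (a * c - 2 * b * d, a * d + b * c))"

lemma dvd_of_square_dvd:
  fixes p a b c :: int
  assumes "prime p" "p dvd b" "a\<^sup>2 + 2 * b\<^sup>2 = p * c" 
  shows "p dvd a"
proof -
  have "a\<^sup>2 = p * c - 2 * b\<^sup>2" using assms(3) by simp
  moreover have "p dvd 2 * b\<^sup>2" using assms(2) by (simp add: power2_eq_square)
  ultimately have "p dvd a\<^sup>2" by simp
  then show ?thesis using assms(1) prime_dvd_power by blast
qed

text \<open>With \<open>\<pi> = r + s\<surd>-2\<close> of prime norm \<open>p\<close>: the coefficients of \<open>\<surd>-2\<close> in \<open>\<alpha>\<pi>\<close> and \<open>\<alpha>\<close> times the conjugate of \<open>\<pi>\<close>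
have a product divisible by \<open>p\<close>. If \<open>p\<close> divides the second one, the norm forces it to divide the other coordinate as well,
and dividing by \<open>p\<close> gives the quotient of \<open>\<alpha>\<close> by \<open>\<pi>\<close>.\<close>

lemma dvd_by_prime_of_norm:
  fixes p r s x y :: int
  assumes p: "prime p" "r\<^sup>2 + 2 * s\<^sup>2 = p" and d: "p dvd x\<^sup>2 + 2 * y\<^sup>2"
  shows "(\<exists>\<beta>. (x, y) = zmul (r, s) \<beta>) \<or> (\<exists>\<beta>. (x, y) = zmul (r, - s) \<beta>)"
proof -
  have key: "\<exists>\<beta>. (x, y) = zmul (r, s) \<beta>" if p2: "r\<^sup>2 + 2 * s\<^sup>2 = p" and "p dvd r * y - s * x" for s
  proof -
    from d obtain c where c: "x\<^sup>2 + 2 * y\<^sup>2 = p * c" by blast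
    have "(r * x + 2 * s * y)\<^sup>2 + 2 * (r * y - s * x)\<^sup>2 = (r\<^sup>2 + 2 * s\<^sup>2) * (x\<^sup>2 + 2 * y\<^sup>2)"
      by (simp add: power2_eq_square algebra_simps)
    then have "(r * x + 2 * s * y)\<^sup>2 + 2 * (r * y - s * x)\<^sup>2 = p * (p * c)"
      unfolding p2 c .
    with p(1) \<open>p dvd r * y - s * x\<close> have "p dvd r * x + 2 * s * y" by (rule dvd_of_square_dvd)
    then obtain u where u: "r * x + 2 * s * y = p * u" by blast
    obtain v where v: "r * y - s * x = p * v" using \<open>p dvd r * y - s * x\<close> by blast
    have "p * x = (r\<^sup>2 + 2 * s\<^sup>2) * x" "p * y = (r\<^sup>2 + 2 * s\<^sup>2) * y" using p2 by simp_all
    then have "p * x = r * (r * x + 2 * s * y) - 2 * s * (r * y - s * x)"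
      "p * y = r * (r * y - s * x) + s * (r * x + 2 * s * y)"
      by (simp_all add: power2_eq_square algebra_simps)
    then have "p * x = p * (r * u - 2 * s * v)" "p * y = p * (r * v + s * u)"
      unfolding u v by (simp_all add: algebra_simps)
    then have "(x, y) = zmul (r, s) (u, v)" using p(1) by (simp add: zmul_def)
    then show ?thesis by blast
  qed
  have "(r * y - s * x) * (r * y + s * x) = (r\<^sup>2 + 2 * s\<^sup>2) * y\<^sup>2 - s\<^sup>2 * (x\<^sup>2 + 2 * y\<^sup>2)"
    by (simp add: power2_eq_square algebra_simps)
  also have "p dvd \<dots>" using d unfolding p(2) by simp
  finally have "p dvd r * y - s * x \<or> p dvd r * y + s * x"
    using p(1) by (simp add: prime_dvd_mult_iff)
  then show ?thesis using key [of s] key [of "- s"] p(2) by auto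
qed

text \<open>Thue's lemma: there are more than \<open>p\<close> pairs with entries in \<open>[0, \<surd>p]\<close>, so two of them have the
same residue \<open>x - t y\<close> modulo \<open>p\<close>.\<close>

lemma thue:
  fixes p :: nat and t :: int
  assumes "prime p"
  obtains x y where "(x, y) \<noteq> (0, 0)" "x\<^sup>2 < int p" "y\<^sup>2 < int p" "int p dvd x - t * y"
proof -
  define k where "k = nat \<lfloor>sqrt p\<rfloor>"
  define A where "A = {0..int k} \<times> {0..int k}"
  have k: "int k = \<lfloor>sqrt p\<rfloor>" by (simp add: k_def)
  have "sqrt p < real k + 1" using k by linarith
  then have "(sqrt p)\<^sup>2 < (real k + 1)\<^sup>2" by (intro power_strict_mono) auto
  then have "real p < real ((k + 1)\<^sup>2)" by (simp add: add.commute)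
  then have pk: "p < (k + 1)\<^sup>2" by (simp only: of_nat_less_iff)
  have kp: "(int k)\<^sup>2 < int p"
  proof -
    have "real k \<le> sqrt p" using k by linarith
    then have "(real k)\<^sup>2 \<le> (sqrt p)\<^sup>2" by (intro power_mono) auto
    then have "real (k\<^sup>2) \<le> real p" by simp
    then have "k\<^sup>2 \<le> p" by (simp only: of_nat_le_iff)
    moreover have "k\<^sup>2 \<noteq> p"
    proof
      assume "k\<^sup>2 = p"
      then have "prime (k\<^sup>2)" using assms by simp
      then show False by (simp add: prime_power_iff)
    qed
    ultimately have "k\<^sup>2 < p" by simp
    then show ?thesis by (metis of_nat_less_iff of_nat_power)
  qed
  have "nat (int k + 1) = k + 1" by simp
  then have "card A = (k + 1)\<^sup>2" by (simp only: A_def card_cartesian_product card_atLeastAtMost_int diff_zero power2_eq_square)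
  moreover have "card ((\<lambda>(a, b). (a - t * b) mod int p) ` A) \<le> card {0..<int p}"
    using assms prime_gt_0_nat by (intro card_mono) auto
  ultimately have "\<not> inj_on (\<lambda>(a, b). (a - t * b) mod int p) A"
    using pk by (intro pigeonhole) simp
  then obtain a b c d where "(a, b) \<in> A" "(c, d) \<in> A" "(a, b) \<noteq> (c, d)"
    and eq: "(a - t * b) mod int p = (c - t * d) mod int p"
    unfolding inj_on_def by fastforce
  then have bd: "\<bar>a - c\<bar> \<le> int k" "\<bar>b - d\<bar> \<le> int k" "(a - c, b - d) \<noteq> (0, 0)"
    by (auto simp: A_def)
  have sq: "z\<^sup>2 < int p" if "\<bar>z\<bar> \<le> int k" for z
  proof -
    have "z\<^sup>2 \<le> (int k)\<^sup>2" using that by (metis abs_ge_zero power2_abs power_mono)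
    then show ?thesis using kp by (rule le_less_trans)
  qed
  have "int p dvd (a - t * b) - (c - t * d)" using eq by (simp add: mod_eq_dvd_iff)
  then have "int p dvd (a - c) - t * (b - d)" by (simp add: algebra_simps)
  then show thesis using that [of "a - c" "b - d"] bd sq by blast
qed

lemma odd_prime_not_dvd_2:
  assumes "prime p" "odd (p :: nat)"
  shows "\<not> int p dvd 2"
proof
  assume "int p dvd 2"
  then have "int p \<le> 2" by (rule zdvd_imp_le) simp
  moreover have "p \<noteq> 2" using assms(2) by auto
  ultimately show False using prime_gt_1_nat [OF assms(1)] by linarith
qed

text \<open>In the split case Thue's lemma yields \<open>x\<^sup>2 + 2y\<^sup>2\<close> equal to \<open>p\<close> or \<open>2p\<close>, and \<open>2p\<close> reduces to \<open>p\<close>. In the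
inert case a solution prime to \<open>p\<close> would make \<open>-2\<close> a square modulo \<open>p\<close>.\<close>

lemma Legendre_minus_two_cases:
  assumes "prime p" "odd (p :: nat)"
  shows "Legendre (- 2) (int p) = 1 \<and> (\<exists>r s. r\<^sup>2 + 2 * s\<^sup>2 = int p)
    \<or> Legendre (- 2) (int p) = - 1 \<and> (\<forall>x y. int p dvd x\<^sup>2 + 2 * y\<^sup>2 \<longrightarrow> int p dvd x \<and> int p dvd y)"
proof -
  have p: "prime (int p)" using assms by simp
  have n2: "\<not> int p dvd 2" using assms by (rule odd_prime_not_dvd_2)
  then have nz: "\<not> [- 2 = 0] (mod int p)" by (simp only: cong_0_iff dvd_minus_iff not_False_eq_True)
  show ?thesis
  proof (cases "QuadRes (int p) (- 2)")
    case True
    then obtain t where t: "[t\<^sup>2 = - 2] (mod int p)" unfolding QuadRes_def by (rule exE)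
    then have t2: "int p dvd t\<^sup>2 + 2" unfolding cong_iff_dvd_diff by simp
    obtain x y where xy: "(x, y) \<noteq> (0, 0)" "x\<^sup>2 < int p" "y\<^sup>2 < int p" "int p dvd x - t * y"
      by (rule thue [OF assms(1)])
    have "x\<^sup>2 + 2 * y\<^sup>2 = (x - t * y) * (x + t * y) + (t\<^sup>2 + 2) * y\<^sup>2"
      by (simp add: power2_eq_square algebra_simps)
    also have "int p dvd \<dots>" using xy(4) t2 by simp
    finally obtain c where c: "x\<^sup>2 + 2 * y\<^sup>2 = int p * c" by blast
    have "0 < x\<^sup>2 \<or> 0 < y\<^sup>2" using xy(1) by auto
    then have "0 < x\<^sup>2 + 2 * y\<^sup>2" using zero_le_power2 [of x] zero_le_power2 [of y] by linarith
    then have "0 < c" using c by (simp add: zero_less_mult_iff)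
    have "int p * c < int p * 3" using c xy by linarith
    then have "c < 3" by (simp add: mult_less_cancel_left)
    with \<open>0 < c\<close> consider "c = 1" | "c = 2" by linarith
    then have "\<exists>r s. r\<^sup>2 + 2 * s\<^sup>2 = int p"
    proof cases
      case 1
      then show ?thesis using c by auto
    next
      case 2
      then have "x\<^sup>2 = 2 * (int p - y\<^sup>2)" using c by simp
      then have "even (x\<^sup>2)" by simp
      then have "even x" by simp
      then obtain z where "x = 2 * z" by (rule evenE)
      then have "y\<^sup>2 + 2 * z\<^sup>2 = int p" using c 2 by (simp add: power2_eq_square)
      then show ?thesis by blast
    qed
    moreover have "Legendre (- 2) (int p) = 1"
      unfolding Legendre_def using True nz by (simp only: if_False if_True)
    ultimately show ?thesis by blast
  next
    case False
    have "int p dvd x \<and> int p dvd y" if d: "int p dvd x\<^sup>2 + 2 * y\<^sup>2" for x y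
    proof -
      have y: "int p dvd y"
      proof (rule ccontr)
        assume "\<not> int p dvd y"
        then have "coprime y (int p)" using p by (metis coprime_commute prime_imp_coprime)
        then obtain z where z: "[y * z = 1] (mod int p)" using cong_solve_coprime_int by blast
        have "[(x * z)\<^sup>2 = - 2] (mod int p)"
        proof -
          have "(x * z)\<^sup>2 + 2 = (x\<^sup>2 + 2 * y\<^sup>2) * z\<^sup>2 - (y * z - 1) * (2 * (y * z + 1))"
            by (simp add: power2_eq_square algebra_simps)
          also have "int p dvd \<dots>"
            using d z [unfolded cong_iff_dvd_diff] by (rule dvd_diff [OF dvd_mult2 dvd_mult2])
          finally show ?thesis unfolding cong_iff_dvd_diff diff_minus_eq_add .
        qed
        then have "QuadRes (int p) (- 2)" unfolding QuadRes_def by (rule exI)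
        with False show False ..
      qed
      from d obtain c where "x\<^sup>2 + 2 * y\<^sup>2 = int p * c" by (elim dvdE)
      from dvd_of_square_dvd [OF p y this] y show ?thesis by simp
    qed
    moreover have "Legendre (- 2) (int p) = - 1"
      unfolding Legendre_def using False nz by (simp only: if_False)
    ultimately show ?thesis by blast
  qed
qed

lemma sum_scaled_reps:
  assumes "prime p"
  shows "(\<Sum>(x, y)\<in>{(x, y)\<in>reps (int p * int n). int p dvd x \<and> int p dvd y}. x\<^sup>2 - 2 * y\<^sup>2)
    = int p ^ 2 * (if p dvd n then hecke_theta (n div p) else 0)"
proof -
  let ?R = "{(x, y)\<in>reps (int p * int n). int p dvd x \<and> int p dvd y}"
  have p0: "int p \<noteq> 0" using assms by auto
  have sc: "(int p * x)\<^sup>2 + 2 * (int p * y)\<^sup>2 = int p * (int p * (x\<^sup>2 + 2 * y\<^sup>2))" for x y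
    by (simp add: power2_eq_square algebra_simps)
  show ?thesis
  proof (cases "p dvd n")
    case True
    then obtain k where k: "n = p * k" by blast
    have "bij_betw (\<lambda>(x, y). (int p * x, int p * y)) (reps (int k)) ?R"
    proof (rule bij_betwI [where g = "\<lambda>(x, y). (x div int p, y div int p)"])
      show "(\<lambda>(x, y). (int p * x, int p * y)) \<in> reps (int k) \<rightarrow> ?R"
      proof (rule funcsetI, clarify)
        fix x y assume "(x, y) \<in> reps (int k)"
        then have "x\<^sup>2 + 2 * y\<^sup>2 = int k" by (simp add: reps_def)
        then have "(int p * x)\<^sup>2 + 2 * (int p * y)\<^sup>2 = int p * int n"
          unfolding sc k by simp
        then show "(int p * x, int p * y) \<in> reps (int p * int n) \<and> int p dvd int p * x \<and> int p dvd int p * y"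
          by (simp add: reps_def)
      qed
      show "(\<lambda>(x, y). (x div int p, y div int p)) \<in> ?R \<rightarrow> reps (int k)"
      proof (rule funcsetI, clarify)
        fix x y assume R: "(x, y) \<in> reps (int p * int n)" and d: "int p dvd x" "int p dvd y"
        obtain a b where ab: "x = int p * a" "y = int p * b" using d by (elim dvdE)
        have "int p * (int p * (a\<^sup>2 + 2 * b\<^sup>2)) = int p * (int p * int k)"
          using R unfolding ab reps_def mem_Collect_eq prod.case sc k by simp
        then have "a\<^sup>2 + 2 * b\<^sup>2 = int k" using p0 by (simp only: mult_cancel_left) simp
        then show "(x div int p, y div int p) \<in> reps (int k)"
          using p0 unfolding ab reps_def by simp
      qed
    qed (use p0 in auto)
    then have "(\<Sum>(x, y)\<in>?R. x\<^sup>2 - 2 * y\<^sup>2) = (\<Sum>(x, y)\<in>reps (int k). (int p * x)\<^sup>2 - 2 * (int p * y)\<^sup>2)"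
      by (subst sum.reindex_bij_betw [symmetric]) (auto simp: case_prod_unfold)
    also have "\<dots> = int p ^ 2 * hecke_theta k"
      unfolding hecke_theta_def sum_distrib_left
      by (rule sum.cong) (auto simp: power2_eq_square algebra_simps)
    finally show ?thesis using True k p0 by simp
  next
    case False
    have "?R = {}"
    proof (rule ccontr)
      assume "?R \<noteq> {}"
      then obtain x y where R: "(x, y) \<in> reps (int p * int n)" and d: "int p dvd x" "int p dvd y" by auto
      obtain a b where ab: "x = int p * a" "y = int p * b" using d by (elim dvdE)
      have "int p * (int p * (a\<^sup>2 + 2 * b\<^sup>2)) = int p * int n"
        using R unfolding ab reps_def mem_Collect_eq prod.case sc .
      then have "int p * (a\<^sup>2 + 2 * b\<^sup>2) = int n" using p0 by (simp only: mult_cancel_left) simp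
      then have "int p dvd int n" by (metis dvd_triv_left)
      then show False using False by simp
    qed
    then show ?thesis using False by (simp only: sum.empty if_False mult_zero_right)
  qed
qed

lemma hecke_theta_inert:
  assumes p: "prime p"
    and inert: "\<And>x y. int p dvd x\<^sup>2 + 2 * y\<^sup>2 \<Longrightarrow> int p dvd x \<and> int p dvd y"
  shows "hecke_theta (p * k) = int p ^ 2 * (if p dvd k then hecke_theta (k div p) else 0)"
proof -
  have "int p dvd x \<and> int p dvd y" if "(x, y) \<in> reps (int p * int k)" for x y
  proof (rule inert)
    from that have "x\<^sup>2 + 2 * y\<^sup>2 = int p * int k" by (simp add: reps_def)
    then show "int p dvd x\<^sup>2 + 2 * y\<^sup>2" by simp
  qed
  then have "{(x, y)\<in>reps (int p * int k). int p dvd x \<and> int p dvd y} = reps (int p * int k)" by blast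
  then show ?thesis
    using sum_scaled_reps [OF p, of k] by (simp only: hecke_theta_def of_nat_mult)
qed

lemma prime_norm_not_dvd:
  assumes P: "prime p" and p2: "\<not> p dvd 2" and rs: "r\<^sup>2 + 2 * s\<^sup>2 = (p :: int)"
  shows "\<not> p dvd r" "\<not> p dvd s"
proof -
  show ps: "\<not> p dvd s"
  proof
    assume "p dvd s"
    then have "p dvd r"
      by (rule dvd_of_square_dvd [OF P, where c = 1]) (simp add: rs)
    obtain a b where ab: "r = p * a" "s = p * b" using \<open>p dvd r\<close> \<open>p dvd s\<close> by (elim dvdE)
    have "p * (p * (a\<^sup>2 + 2 * b\<^sup>2)) = p * 1"
      using rs unfolding ab by (simp add: power2_eq_square algebra_simps)
    then have "p * (a\<^sup>2 + 2 * b\<^sup>2) = 1" using P by (simp only: mult_cancel_left) auto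
    then have "p dvd 1" by (metis dvd_triv_left)
    then show False using P by auto
  qed
  show "\<not> p dvd r"
  proof
    assume "p dvd r"
    then have "p dvd r\<^sup>2" by (simp add: power2_eq_square)
    moreover have "2 * s\<^sup>2 = p - r\<^sup>2" using rs by simp
    ultimately have "p dvd 2 * s\<^sup>2" by simp
    then have "p dvd 2 \<or> p dvd s\<^sup>2" using P by (simp only: prime_dvd_mult_iff)
    then show False using P ps p2 prime_dvd_power by blast
  qed
qed

lemma hecke_theta_split:
  assumes p: "prime p" "odd p" and rs: "r\<^sup>2 + 2 * s\<^sup>2 = int p"
  shows "2 * (r\<^sup>2 - 2 * s\<^sup>2) * hecke_theta k
    = hecke_theta (p * k) + (int p)\<^sup>2 * (if p dvd k then hecke_theta (k div p) else 0)"
proof -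
  have P: "prime (int p)" using p by simp
  have p0: "int p > 1" using prime_gt_1_nat [OF p(1)] by simp
  have p2: "\<not> int p dvd 2" using p by (rule odd_prime_not_dvd_2)
  have pr: "\<not> int p dvd r" and ps: "\<not> int p dvd s" using prime_norm_not_dvd [OF P p2 rs] by blast+
  define f :: "int \<times> int \<Rightarrow> int" where "f = (\<lambda>(x, y). x\<^sup>2 - 2 * y\<^sup>2)"
  have norm_mult: "(zmul (r', s') \<alpha> \<in> reps (int p * k)) = (\<alpha> \<in> reps k)"
    if "r'\<^sup>2 + 2 * s'\<^sup>2 = int p" for r' s' \<alpha> k
  proof -
    obtain x y where \<alpha>: "\<alpha> = (x, y)" by (cases \<alpha>)
    have "(r' * x - 2 * s' * y)\<^sup>2 + 2 * (r' * y + s' * x)\<^sup>2 = (r'\<^sup>2 + 2 * s'\<^sup>2) * (x\<^sup>2 + 2 * y\<^sup>2)"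
      by (simp add: power2_eq_square algebra_simps)
    then show ?thesis unfolding that using p0 by (simp add: \<alpha> zmul_def reps_def)
  qed
  have inj: "inj (zmul (r', s'))" if "r'\<^sup>2 + 2 * s'\<^sup>2 = int p" for r' s' :: int
  proof (rule inj_on_inverseI)
    fix \<alpha> :: "int \<times> int"
    obtain x y where \<alpha>: "\<alpha> = (x, y)" by (cases \<alpha>)
    have "(r' * (r' * x - 2 * s' * y) + 2 * s' * (r' * y + s' * x), r' * (r' * y + s' * x) - s' * (r' * x - 2 * s' * y))
      = ((r'\<^sup>2 + 2 * s'\<^sup>2) * x, (r'\<^sup>2 + 2 * s'\<^sup>2) * y)"
      by (simp add: power2_eq_square algebra_simps)
    then show "(\<lambda>(x, y). ((r' * x + 2 * s' * y) div int p, (r' * y - s' * x) div int p)) (zmul (r', s') \<alpha>) = \<alpha>"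
      unfolding that using p0 by (simp add: \<alpha> zmul_def mult.assoc)
  qed
  have rs': "r\<^sup>2 + 2 * (- s)\<^sup>2 = int p" using rs by simp
  \<comment> \<open>Every element of norm \<open>pk\<close> is divisible by \<open>\<pi> = r + s\<surd>-2\<close> or by its conjugate, and by both
    exactly when it is divisible by \<open>p\<close>; the multiples of \<open>p\<close> are counted twice.\<close>
  let ?R = "\<lambda>k. reps (int p * int k)"
  let ?A = "\<lambda>k. zmul (r, s) ` reps (int k)" and ?B = "\<lambda>k. zmul (r, - s) ` reps (int k)"
  have memA: "zmul (r, s) \<beta> \<in> ?A k" if "zmul (r, s) \<beta> \<in> ?R k" for \<beta> k
    using that norm_mult [OF rs, of \<beta> "int k"] by blast
  have memB: "zmul (r, - s) \<beta> \<in> ?B k" if "zmul (r, - s) \<beta> \<in> ?R k" for \<beta> k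
    using that norm_mult [OF rs', of \<beta> "int k"] by blast
  have union: "?A k \<union> ?B k = ?R k" for k
  proof
    show "?A k \<union> ?B k \<subseteq> ?R k" using norm_mult [OF rs] norm_mult [OF rs'] by auto
    show "?R k \<subseteq> ?A k \<union> ?B k"
    proof
      fix \<gamma> assume \<gamma>: "\<gamma> \<in> ?R k"
      obtain x y where xy: "\<gamma> = (x, y)" by (cases \<gamma>)
      then have "int p dvd x\<^sup>2 + 2 * y\<^sup>2" using \<gamma> by (simp add: reps_def)
      from dvd_by_prime_of_norm [OF P rs this]
      obtain \<beta> where "\<gamma> = zmul (r, s) \<beta> \<or> \<gamma> = zmul (r, - s) \<beta>" using xy by blast
      with \<gamma> show "\<gamma> \<in> ?A k \<union> ?B k" using memA [of \<beta> k] memB [of \<beta> k] by blast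
    qed
  qed
  have inter: "?A k \<inter> ?B k = {(x, y)\<in>?R k. int p dvd x \<and> int p dvd y}" for k
  proof
    show "?A k \<inter> ?B k \<subseteq> {(x, y)\<in>?R k. int p dvd x \<and> int p dvd y}"
    proof
      fix \<gamma> assume \<gamma>: "\<gamma> \<in> ?A k \<inter> ?B k"
      then have R: "\<gamma> \<in> ?R k" using union by auto
      from \<gamma> obtain \<beta> \<delta> where "\<gamma> = zmul (r, s) \<beta>" "\<gamma> = zmul (r, - s) \<delta>" by blast
      then obtain a b c d where ab: "\<gamma> = zmul (r, s) (a, b)" and cd: "\<gamma> = zmul (r, - s) (c, d)"
        by (metis surj_pair)
      obtain x y where xy: "\<gamma> = (x, y)" by (cases \<gamma>)
      have x1: "x = r * a - 2 * s * b" and y1: "y = r * b + s * a"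
        and x2: "x = r * c + 2 * s * d" and y2: "y = r * d - s * c"
        using ab cd xy by (simp_all add: zmul_def)
      have "r * y - s * x = (r\<^sup>2 + 2 * s\<^sup>2) * b" unfolding x1 y1 by (simp add: power2_eq_square algebra_simps)
      moreover have "r * y + s * x = (r\<^sup>2 + 2 * s\<^sup>2) * d" unfolding x2 y2 by (simp add: power2_eq_square algebra_simps)
      ultimately have "2 * (r * y) = int p * (b + d)" "2 * (s * x) = int p * (d - b)"
        unfolding rs by (simp_all add: algebra_simps)
      then have "int p dvd 2 * (r * y)" "int p dvd 2 * (s * x)" by simp_all
      then have "int p dvd y" "int p dvd x" using P p2 pr ps by (simp_all add: prime_dvd_mult_iff)
      then show "\<gamma> \<in> {(x, y)\<in>?R k. int p dvd x \<and> int p dvd y}" using R xy by simp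
    qed
    show "{(x, y)\<in>?R k. int p dvd x \<and> int p dvd y} \<subseteq> ?A k \<inter> ?B k"
    proof (rule subrelI)
      fix x y assume "(x, y) \<in> {(x, y)\<in>?R k. int p dvd x \<and> int p dvd y}"
      then have R: "(x, y) \<in> ?R k" and d: "int p dvd x" "int p dvd y" by auto
      from d obtain a b where x: "x = int p * a" and y: "y = int p * b" by (elim dvdE)
      have "(x, y) = zmul (r, s) (r * a + 2 * s * b, r * b - s * a)"
        "(x, y) = zmul (r, - s) (r * a - 2 * s * b, r * b + s * a)"
        unfolding x y rs [symmetric] by (simp_all add: zmul_def power2_eq_square algebra_simps)
      then show "(x, y) \<in> ?A k \<inter> ?B k"
        using R memA memB by (metis IntI)
    qed
  qed
  have sum_A: "sum f (?A k) = (\<Sum>\<alpha>\<in>reps (int k). f (zmul (r, s) \<alpha>))"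
    and sum_B: "sum f (?B k) = (\<Sum>\<alpha>\<in>reps (int k). f (zmul (r, - s) \<alpha>))" for k
    by (subst sum.reindex, auto intro: inj_on_subset [OF inj [OF rs]] inj_on_subset [OF inj [OF rs']])+
  have f2: "f (zmul (r, s) \<alpha>) + f (zmul (r, - s) \<alpha>) = 2 * (r\<^sup>2 - 2 * s\<^sup>2) * f \<alpha>" for \<alpha>
    by (cases \<alpha>) (simp add: f_def zmul_def power2_eq_square algebra_simps)
  show ?thesis
  proof -
    have "2 * (r\<^sup>2 - 2 * s\<^sup>2) * hecke_theta k = (\<Sum>\<alpha>\<in>reps (int k). 2 * (r\<^sup>2 - 2 * s\<^sup>2) * f \<alpha>)"
      by (simp add: hecke_theta_def f_def sum_distrib_left)
    also have "\<dots> = sum f (?A k) + sum f (?B k)"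
      unfolding sum_A sum_B sum.distrib [symmetric] f2 ..
    also have "\<dots> = sum f (?R k) + sum f (?A k \<inter> ?B k)"
      unfolding union [symmetric] by (rule sum.union_inter [symmetric]) (simp_all add: finite_reps)
    also have "sum f (?R k) = hecke_theta (p * k)"
      by (simp add: hecke_theta_def f_def)
    also have "sum f (?A k \<inter> ?B k) = (int p)\<^sup>2 * (if p dvd k then hecke_theta (k div p) else 0)"
      unfolding inter f_def by (rule sum_scaled_reps [OF p(1)])
    finally show ?thesis .
  qed
qed

lemma hecke_theta_1: "hecke_theta 1 = 2"
proof -
  have "reps 1 = {(1, 0), (- 1, 0)}"
  proof
    show "reps 1 \<subseteq> {(1, 0), (- 1, 0)}"
    proof (rule subrelI)
      fix x y assume "(x, y) \<in> reps 1"
      then have e: "x\<^sup>2 + 2 * y\<^sup>2 = 1" by (simp add: reps_def)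
      have "y = 0"
      proof (rule ccontr)
        assume "y \<noteq> 0"
        then have "0 < y\<^sup>2" by simp
        then show False using e zero_le_power2 [of x] by linarith
      qed
      with e show "(x, y) \<in> {(1, 0), (- 1, 0)}" by (auto simp: power2_eq_1_iff)
    qed
  qed (auto simp: reps_def)
  then show ?thesis by (simp add: hecke_theta_def)
qed

text \<open>The theta series is an eigenform of all Hecke operators of odd prime index, with character \<open>(-2/\<cdot>)\<close> and
weight 3.\<close>

theorem hecke_theta_prime_mult:
  assumes p: "prime p" "odd p"
  shows "hecke_theta p * hecke_theta n = 2 * (hecke_theta (p * n)
    + (int p)\<^sup>2 * Legendre (- 2) (int p) * (if p dvd n then hecke_theta (n div p) else 0))"
proof -
  have p1: "\<not> p dvd 1" using prime_gt_1_nat [OF p(1)] by simp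
  consider "Legendre (- 2) (int p) = - 1" "\<And>x y. int p dvd x\<^sup>2 + 2 * y\<^sup>2 \<Longrightarrow> int p dvd x \<and> int p dvd y"
    | r s where "Legendre (- 2) (int p) = 1" "r\<^sup>2 + 2 * s\<^sup>2 = int p"
    using Legendre_minus_two_cases [OF p] by blast
  then show ?thesis
  proof cases
    case 1
    have "hecke_theta p = 0"
      using hecke_theta_inert [OF p(1) 1(2), of 1] p1 by (simp only: mult_1_right if_False mult_zero_right)
    moreover note hecke_theta_inert [OF p(1) 1(2), of n]
    ultimately show ?thesis unfolding 1(1) by simp
  next
    case 2
    have "hecke_theta p = 4 * (r\<^sup>2 - 2 * s\<^sup>2)"
      using hecke_theta_split [OF p 2(2), of 1] p1 hecke_theta_1
      by (simp only: mult_1_right if_False mult_zero_right)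
    then have "hecke_theta p * hecke_theta n = 2 * (2 * (r\<^sup>2 - 2 * s\<^sup>2) * hecke_theta n)" by simp
    then show ?thesis unfolding hecke_theta_split [OF p 2(2), of n] 2(1) by simp
  qed
qed

section \<open>Integral quaternions\<close>

text \<open>Quaternions with integer coordinates (the Lipschitz order), made a ring so that ideals can be handled
with the ring laws.\<close>

datatype quat = Quat (q1: int) (q2: int) (q3: int) (q4: int)

instantiation quat :: ring_1
begin

definition "0 = Quat 0 0 0 0"
definition "1 = Quat 1 0 0 0"
definition "x + y = Quat (q1 x + q1 y) (q2 x + q2 y) (q3 x + q3 y) (q4 x + q4 y)"
definition "- x = Quat (- q1 x) (- q2 x) (- q3 x) (- q4 x)"
definition "x - y = Quat (q1 x - q1 y) (q2 x - q2 y) (q3 x - q3 y) (q4 x - q4 y)"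
definition "x * y = Quat
  (q1 x * q1 y - q2 x * q2 y - q3 x * q3 y - q4 x * q4 y)
  (q1 x * q2 y + q2 x * q1 y + q3 x * q4 y - q4 x * q3 y)
  (q1 x * q3 y - q2 x * q4 y + q3 x * q1 y + q4 x * q2 y)
  (q1 x * q4 y + q2 x * q3 y - q3 x * q2 y + q4 x * q1 y)"

instance
  by standard (simp_all add: zero_quat_def one_quat_def plus_quat_def uminus_quat_def
    minus_quat_def times_quat_def algebra_simps)

end

lemmas quat_defs = zero_quat_def one_quat_def plus_quat_def uminus_quat_def minus_quat_def times_quat_def

definition qconj :: "quat \<Rightarrow> quat" where
  "qconj x = Quat (q1 x) (- q2 x) (- q3 x) (- q4 x)"

definition qnorm :: "quat \<Rightarrow> int" where
  "qnorm x = (q1 x)\<^sup>2 + (q2 x)\<^sup>2 + (q3 x)\<^sup>2 + (q4 x)\<^sup>2"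

lemma of_nat_quat: "of_nat n = Quat (int n) 0 0 0"
  by (induction n) (simp_all add: quat_defs)

lemma of_int_quat: "of_int n = Quat n 0 0 0"
  by (cases n rule: int_diff_cases) (simp add: of_nat_quat minus_quat_def)

lemma qnorm_mult: "qnorm (x * y) = qnorm x * qnorm y"
  by (simp add: qnorm_def times_quat_def power2_eq_square algebra_simps)

lemma mult_qconj: "x * qconj x = of_int (qnorm x)" and qconj_mult: "qconj x * x = of_int (qnorm x)"
  by (simp_all add: of_int_quat qnorm_def times_quat_def qconj_def power2_eq_square algebra_simps)

lemma qnorm_of_int: "qnorm (of_int n) = n\<^sup>2"
  by (simp add: of_int_quat qnorm_def)

lemma qnorm_qconj: "qnorm (qconj x) = qnorm x"
  by (simp add: qnorm_def qconj_def)

lemma qnorm_nonneg: "qnorm x \<ge> 0"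
  by (simp add: qnorm_def)

lemma qnorm_eq_0_iff: "qnorm x = 0 \<longleftrightarrow> x = 0"
proof
  assume "qnorm x = 0"
  then have "(q1 x)\<^sup>2 + (q2 x)\<^sup>2 + (q3 x)\<^sup>2 + (q4 x)\<^sup>2 = 0" by (simp add: qnorm_def)
  then have "(q1 x)\<^sup>2 = 0" "(q2 x)\<^sup>2 = 0" "(q3 x)\<^sup>2 = 0" "(q4 x)\<^sup>2 = 0"
    using zero_le_power2 [of "q1 x"] zero_le_power2 [of "q2 x"] zero_le_power2 [of "q3 x"] zero_le_power2 [of "q4 x"]
    by linarith+
  then show "x = 0" by (cases x) (simp add: zero_quat_def)
qed (simp add: qnorm_def zero_quat_def)

lemma of_int_quat_mult_left_cancel:
  assumes "n \<noteq> 0" "of_int n * x = of_int n * (y :: quat)"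
  shows "x = y"
  using assms by (cases x; cases y) (simp add: of_int_quat times_quat_def)

lemma quat_mult_left_cancel:
  assumes "qnorm d \<noteq> 0" "d * x = d * y"
  shows "x = y"
proof -
  have "qconj d * (d * x) = qconj d * (d * y)" using assms(2) by simp
  then have "of_int (qnorm d) * x = of_int (qnorm d) * y" by (simp only: mult.assoc [symmetric] qconj_mult)
  with assms(1) show ?thesis by (rule of_int_quat_mult_left_cancel)
qed

lemma round_div_odd:
  fixes t N :: int
  assumes "N > 0" "odd N"
  obtains k where "4 * (t - N * k)\<^sup>2 < N\<^sup>2"
proof -
  \<comment> \<open>\<open>k\<close> is \<open>t / N\<close> rounded to the nearest integer; as \<open>N\<close> is odd there is no tie.\<close>
  define k where "k = (2 * t + N) div (2 * N)"
  define r where "r = (2 * t + N) mod (2 * N)"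
  have "2 * t + N = 2 * N * k + r" by (simp add: k_def r_def)
  moreover have "0 \<le> r" "r < 2 * N" using assms(1) by (simp_all add: r_def)
  moreover have "r \<noteq> 0"
  proof
    assume "r = 0"
    then have "N = 2 * (N * k - t)" using \<open>2 * t + N = 2 * N * k + r\<close> by simp
    then show False using assms(2) by (metis dvd_triv_left)
  qed
  ultimately have "\<bar>2 * (t - N * k)\<bar> < \<bar>N\<bar>" by (simp add: algebra_simps)
  then have "\<bar>2 * (t - N * k)\<bar>\<^sup>2 < \<bar>N\<bar>\<^sup>2" by (intro power_strict_mono) auto
  then have "4 * (t - N * k)\<^sup>2 < N\<^sup>2" unfolding power2_abs power_mult_distrib by simp
  then show thesis by (rule that)
qed

text \<open>Division with remainder on the left by an element of odd norm: rounding \<open>d\<^sup>-\<^sup>1 x\<close> leaves coordinates strictly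
smaller than \<open>1/2\<close>. It fails for even norm, where all four coordinates may be equal to \<open>1/2\<close>.\<close>

lemma quat_euclid:
  assumes "odd (qnorm d)"
  obtains k where "qnorm (x - d * k) < qnorm d"
proof -
  define N where "N = qnorm d"
  have N: "N > 0" "odd N" using assms qnorm_nonneg [of d] by (auto simp: N_def order_le_less)
  define t where "t = qconj d * x"
  obtain k1 where k1: "4 * (q1 t - N * k1)\<^sup>2 < N\<^sup>2" by (rule round_div_odd [OF N])
  obtain k2 where k2: "4 * (q2 t - N * k2)\<^sup>2 < N\<^sup>2" by (rule round_div_odd [OF N])
  obtain k3 where k3: "4 * (q3 t - N * k3)\<^sup>2 < N\<^sup>2" by (rule round_div_odd [OF N])
  obtain k4 where k4: "4 * (q4 t - N * k4)\<^sup>2 < N\<^sup>2" by (rule round_div_odd [OF N])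
  define k where "k = Quat k1 k2 k3 k4"
  have "qconj d * (x - d * k) = t - of_int N * k"
    by (simp only: right_diff_distrib mult.assoc [symmetric] qconj_mult t_def N_def)
  then have "N * qnorm (x - d * k) = qnorm (t - of_int N * k)"
    by (metis qnorm_mult qnorm_qconj N_def)
  also have "\<dots> = (q1 t - N * k1)\<^sup>2 + (q2 t - N * k2)\<^sup>2 + (q3 t - N * k3)\<^sup>2 + (q4 t - N * k4)\<^sup>2"
    by (simp add: qnorm_def k_def of_int_quat times_quat_def minus_quat_def)
  also have "\<dots> < N * N" using k1 k2 k3 k4 unfolding power2_eq_square [of N] by linarith
  finally have "qnorm (x - d * k) < N" using N(1) by (simp add: mult_less_cancel_left_pos)
  then show thesis unfolding N_def by (rule that)
qed

text \<open>An element of even norm is divisible on the right by one of \<open>1 + i\<close>, \<open>1 + j\<close>, \<open>1 + k\<close>: its odd coordinates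
can be paired off. Here \<open>s\<close> is the quotient and \<open>v\<close> the conjugate of the divisor.\<close>

lemma quat_even_norm:
  assumes "even (qnorm r)"
  obtains s v where "of_int 2 * s = r * v" "qnorm r = 2 * qnorm s"
proof -
  obtain a b c d where r: "r = Quat a b c d" by (cases r)
  have "even (a + b + c + d)" using assms by (simp add: r qnorm_def)
  then consider "even (a + b)" "even (c + d)" | "even (a + c)" "even (b + d)" | "even (a + d)" "even (b + c)"
    by (auto simp: even_add)
  then show thesis
  proof cases
    case 1
    then obtain e f where ef: "a + b = 2 * e" "c + d = 2 * f" by (metis evenE)
    have ab: "b = 2 * e - a" "d = 2 * f - c" using ef by auto
    show thesis
    proof (rule that [of "Quat e (e - a) (c - f) f" "Quat 1 (- 1) 0 0"])
      show "of_int 2 * Quat e (e - a) (c - f) f = r * Quat 1 (- 1) 0 0"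
        unfolding r ab by (simp add: of_int_quat times_quat_def)
      show "qnorm r = 2 * qnorm (Quat e (e - a) (c - f) f)"
        unfolding r ab by (simp add: qnorm_def power2_eq_square algebra_simps)
    qed
  next
    case 2
    then obtain e f where ef: "a + c = 2 * e" "b + d = 2 * f" by (metis evenE)
    have ab: "c = 2 * e - a" "d = 2 * f - b" using ef by auto
    show thesis
    proof (rule that [of "Quat e f (e - a) (f - b)" "Quat 1 0 (- 1) 0"])
      show "of_int 2 * Quat e f (e - a) (f - b) = r * Quat 1 0 (- 1) 0"
        unfolding r ab by (simp add: of_int_quat times_quat_def)
      show "qnorm r = 2 * qnorm (Quat e f (e - a) (f - b))"
        unfolding r ab by (simp add: qnorm_def power2_eq_square algebra_simps)
    qed
  next
    case 3
    then obtain e f where ef: "a + d = 2 * e" "b + c = 2 * f" by (metis evenE)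
    have ab: "d = 2 * e - a" "c = 2 * f - b" using ef by auto
    show thesis
    proof (rule that [of "Quat e (b - f) f (e - a)" "Quat 1 0 0 (- 1)"])
      show "of_int 2 * Quat e (b - f) f (e - a) = r * Quat 1 0 0 (- 1)"
        unfolding r ab by (simp add: of_int_quat times_quat_def)
      show "qnorm r = 2 * qnorm (Quat e (b - f) f (e - a))"
        unfolding r ab by (simp add: qnorm_def power2_eq_square algebra_simps)
    qed
  qed
qed

text \<open>Dividing by elements of norm 2 stays inside a right ideal that contains an element of odd norm, so the
remainders in the Euclidean algorithm may be assumed to have odd norm.\<close>

lemma quat_right_ideal_odd_element:
  assumes diff: "\<And>x y. x \<in> I \<Longrightarrow> y \<in> I \<Longrightarrow> x - y \<in> I"
    and mult: "\<And>x y. x \<in> I \<Longrightarrow> x * y \<in> I"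
    and d: "d \<in> I" "odd (qnorm d)" and r: "r \<in> I" "r \<noteq> 0"
  obtains s where "s \<in> I" "odd (qnorm s)" "qnorm s \<le> qnorm r"
proof -
  have "\<exists>s\<in>I. odd (qnorm s) \<and> qnorm s \<le> qnorm r"
    using r
  proof (induction "nat (qnorm r)" arbitrary: r rule: less_induct)
    case less
    show ?case
    proof (cases "odd (qnorm r)")
      case False
      then obtain s v where s: "of_int 2 * s = r * v" "qnorm r = 2 * qnorm s"
        using quat_even_norm by blast
      have "qnorm r > 0" using less.prems(2) qnorm_nonneg [of r] qnorm_eq_0_iff [of r] by linarith
      obtain k where k: "qnorm d = 2 * k + 1" using d(2) by (auto elim: oddE)
      \<comment> \<open>Both \<open>2s\<close> and an odd multiple of \<open>s\<close> lie in the ideal, hence so does \<open>s\<close>.\<close>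
      have "of_int (qnorm d) * s \<in> I"
        using mult [OF d(1), of "qconj d * s"] by (simp only: mult.assoc [symmetric] mult_qconj)
      moreover have "of_int 2 * s * of_int k \<in> I"
        unfolding s(1) mult.assoc by (rule mult [OF less.prems(1)])
      moreover have "of_int (qnorm d) * s - of_int 2 * s * of_int k = s"
        by (cases s) (simp add: k of_int_quat times_quat_def minus_quat_def algebra_simps)
      ultimately have "s \<in> I" using diff by metis
      moreover have "s \<noteq> 0" using s(2) \<open>qnorm r > 0\<close> qnorm_eq_0_iff by force
      moreover have "nat (qnorm s) < nat (qnorm r)" using s(2) \<open>qnorm r > 0\<close> by simp
      ultimately obtain t where "t \<in> I" "odd (qnorm t)" "qnorm t \<le> qnorm s"
        using less.hyps by blast
      then show ?thesis using s(2) qnorm_nonneg [of s] by (intro bexI [of _ t]) auto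
    qed (use less.prems in auto)
  qed
  then show thesis using that by blast
qed

lemma quat_right_ideal_principal:
  assumes diff: "\<And>x y. x \<in> I \<Longrightarrow> y \<in> I \<Longrightarrow> x - y \<in> I"
    and mult: "\<And>x y. x \<in> I \<Longrightarrow> x * y \<in> I"
    and e: "e \<in> I" "odd (qnorm e)"
  obtains d where "d \<in> I" "odd (qnorm d)" "\<And>x. x \<in> I \<Longrightarrow> \<exists>y. x = d * y"
proof -
  define P where "P = (\<lambda>x. x \<in> I \<and> odd (qnorm x))"
  obtain d where d: "P d" and min: "\<And>x. P x \<Longrightarrow> nat (qnorm d) \<le> nat (qnorm x)"
    using ex_has_least_nat [of P e "\<lambda>x. nat (qnorm x)"] e by (auto simp: P_def)
  have dI: "d \<in> I" "odd (qnorm d)" using d by (simp_all add: P_def)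
  have "\<exists>y. x = d * y" if "x \<in> I" for x
  proof -
    obtain k where k: "qnorm (x - d * k) < qnorm d" by (rule quat_euclid [OF dI(2)])
    have I: "x - d * k \<in> I" using diff [OF that mult [OF dI(1)]] .
    have "x - d * k = 0"
    proof (rule ccontr)
      assume "x - d * k \<noteq> 0"
      obtain s where s: "s \<in> I" "odd (qnorm s)" "qnorm s \<le> qnorm (x - d * k)"
        by (rule quat_right_ideal_odd_element [OF diff mult dI I \<open>x - d * k \<noteq> 0\<close>])
      then have "nat (qnorm d) \<le> nat (qnorm s)" by (intro min) (simp add: P_def)
      then show False using s(3) k qnorm_nonneg [of s] by linarith
    qed
    then show ?thesis by (intro exI [of _ k]) simp
  qed
  with dI show thesis by (intro that)
qed

definition quats :: "int \<Rightarrow> quat set" where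
  "quats n = {x. qnorm x = n}"

lemma finite_quats: "finite (quats n)"
proof (rule finite_subset)
  show "quats n \<subseteq> (\<lambda>(a, b, c, d). Quat a b c d) ` ({- n..n} \<times> {- n..n} \<times> {- n..n} \<times> {- n..n})"
  proof
    fix x assume "x \<in> quats n"
    then have n: "(q1 x)\<^sup>2 + (q2 x)\<^sup>2 + (q3 x)\<^sup>2 + (q4 x)\<^sup>2 = n" by (simp add: quats_def qnorm_def)
    have le: "\<bar>t\<bar> \<le> t\<^sup>2" for t :: int
      using self_le_power [of "\<bar>t\<bar>" 2] by (cases "t = 0") auto
    have "\<bar>q1 x\<bar> \<le> n" "\<bar>q2 x\<bar> \<le> n" "\<bar>q3 x\<bar> \<le> n" "\<bar>q4 x\<bar> \<le> n"
      using n le [of "q1 x"] le [of "q2 x"] le [of "q3 x"] le [of "q4 x"] zero_le_power2 [of "q1 x"]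
        zero_le_power2 [of "q2 x"] zero_le_power2 [of "q3 x"] zero_le_power2 [of "q4 x"]
      by linarith+
    then have "(q1 x, q2 x, q3 x, q4 x) \<in> {- n..n} \<times> {- n..n} \<times> {- n..n} \<times> {- n..n}"
      by auto
    moreover have "x = (\<lambda>(a, b, c, d). Quat a b c d) (q1 x, q2 x, q3 x, q4 x)" by simp
    ultimately show "x \<in> (\<lambda>(a, b, c, d). Quat a b c d) ` ({- n..n} \<times> {- n..n} \<times> {- n..n} \<times> {- n..n})"
      by (rule rev_image_eqI)
  qed
qed auto

lemma quats_1: "quats 1 = {Quat 1 0 0 0, Quat (- 1) 0 0 0, Quat 0 1 0 0, Quat 0 (- 1) 0 0,
  Quat 0 0 1 0, Quat 0 0 (- 1) 0, Quat 0 0 0 1, Quat 0 0 0 (- 1)}" (is "_ = ?U")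
proof
  show "quats 1 \<subseteq> ?U"
  proof
    fix x assume "x \<in> quats 1"
    then obtain a b c d where x: "x = Quat a b c d" and n: "a\<^sup>2 + b\<^sup>2 + c\<^sup>2 + d\<^sup>2 = 1"
      by (cases x) (simp add: quats_def qnorm_def)
    have z: "t = 0 \<or> 1 \<le> t\<^sup>2" for t :: int using zero_less_power2 [of t] by linarith
    have o: "t\<^sup>2 = 1 \<longleftrightarrow> t = 1 \<or> t = - 1" for t :: int by (rule power2_eq_1_iff)
    show "x \<in> ?U"
      using z [of a] z [of b] z [of c] z [of d] n unfolding x
      by (elim disjE; simp add: o; use zero_le_power2 [of a] zero_le_power2 [of b]
        zero_le_power2 [of c] zero_le_power2 [of d] in linarith)
  qed
qed (auto simp: quats_def qnorm_def)

lemma card_quats_1: "card (quats 1) = 8"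
  by (simp add: quats_1)

lemma card_quat_factorizations:
  assumes mn: "coprime m n" "odd m" "m > 0" "n > 0" and \<alpha>: "qnorm \<alpha> = m * n"
  shows "card {(\<beta>, \<gamma>) \<in> quats m \<times> quats n. \<beta> * \<gamma> = \<alpha>} = 8"
proof -
  \<comment> \<open>A generator \<open>d\<close> of the right ideal generated by \<open>\<alpha>\<close> and \<open>m\<close> has norm \<open>m\<close> and divides \<open>\<alpha>\<close> on the
    left. Any other factorization generates the same ideal, so it differs from this one by a unit.\<close>
  define I where "I = {\<alpha> * x + of_int m * y | x y. True}"
  have "of_int m \<in> I"
    unfolding I_def by (rule CollectI, rule exI [of _ 0], rule exI [of _ 1]) simp
  moreover have "odd (qnorm (of_int m))" using mn(2) by (simp add: qnorm_of_int)
  moreover have "x - y \<in> I" if "x \<in> I" "y \<in> I" for x y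
  proof -
    from that obtain a b c d where "x = \<alpha> * a + of_int m * b" "y = \<alpha> * c + of_int m * d"
      unfolding I_def by blast
    then have "x - y = \<alpha> * (a - c) + of_int m * (b - d)" by (simp add: right_diff_distrib)
    then show ?thesis unfolding I_def by blast
  qed
  moreover have "x * y \<in> I" if "x \<in> I" for x y
  proof -
    from that obtain a b where "x = \<alpha> * a + of_int m * b" unfolding I_def by blast
    then have "x * y = \<alpha> * (a * y) + of_int m * (b * y)" by (simp only: distrib_right mult.assoc)
    then show ?thesis unfolding I_def by blast
  qed
  ultimately obtain d where d: "d \<in> I" "odd (qnorm d)" and gen: "\<And>x. x \<in> I \<Longrightarrow> \<exists>y. x = d * y"
    by (metis quat_right_ideal_principal)
  have "\<alpha> \<in> I" unfolding I_def by (rule CollectI, rule exI [of _ 1], rule exI [of _ 0]) simp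
  then obtain \<delta> where \<delta>: "\<alpha> = d * \<delta>" using gen by blast
  obtain y where y: "of_int m = d * y" using gen [OF \<open>of_int m \<in> I\<close>] by blast
  obtain a b where ab: "d = \<alpha> * a + of_int m * b" using d(1) unfolding I_def by blast
  have expand: "qnorm (u + of_int m * v) = qnorm u
      + m * (2 * (q1 u * q1 v + q2 u * q2 v + q3 u * q3 v + q4 u * q4 v) + m * qnorm v)" for u v
    by (simp add: qnorm_def of_int_quat times_quat_def plus_quat_def power2_eq_square algebra_simps)
  have "m dvd qnorm (\<alpha> * a)" by (simp add: qnorm_mult \<alpha>)
  then have "m dvd qnorm d" unfolding ab expand by (rule dvd_add) simp
  moreover have "qnorm d dvd m"
  proof -
    have "qnorm d dvd m * n" using \<alpha> unfolding \<delta> qnorm_mult by (metis dvd_triv_left)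
    moreover have "m\<^sup>2 = qnorm d * qnorm y" unfolding qnorm_mult [symmetric] y [symmetric] qnorm_of_int ..
    then have "qnorm d dvd m * m" by (simp add: power2_eq_square)
    ultimately have "qnorm d dvd gcd (m * n) (m * m)" by (rule gcd_greatest)
    also have "gcd (m * n) (m * m) = m"
      using mn by (simp add: gcd_mult_distrib_int [symmetric] coprime_iff_gcd_eq_1 gcd.commute)
    finally show ?thesis .
  qed
  ultimately have nd: "qnorm d = m" using mn(3) qnorm_nonneg [of d] by (simp add: zdvd_antisym_nonneg)
  have nz: "qnorm d \<noteq> 0" using nd mn by simp
  have n\<delta>: "qnorm \<delta> = n" using \<alpha> mn(3) unfolding \<delta> qnorm_mult nd by simp
  have unit: "\<epsilon> * qconj \<epsilon> = 1" "qconj \<epsilon> * \<epsilon> = 1" if "\<epsilon> \<in> quats 1" for \<epsilon>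
    using that by (simp_all add: quats_def mult_qconj qconj_mult)
  have "bij_betw (\<lambda>\<epsilon>. (d * \<epsilon>, qconj \<epsilon> * \<delta>)) (quats 1) {(\<beta>, \<gamma>) \<in> quats m \<times> quats n. \<beta> * \<gamma> = \<alpha>}"
    unfolding bij_betw_def
  proof
    show "inj_on (\<lambda>\<epsilon>. (d * \<epsilon>, qconj \<epsilon> * \<delta>)) (quats 1)"
      by (rule inj_onI) (use quat_mult_left_cancel [OF nz] in blast)
    show "(\<lambda>\<epsilon>. (d * \<epsilon>, qconj \<epsilon> * \<delta>)) ` quats 1 = {(\<beta>, \<gamma>) \<in> quats m \<times> quats n. \<beta> * \<gamma> = \<alpha>}" (is "?L = ?R")
    proof
      show "?L \<subseteq> ?R"
      proof
        fix p assume "p \<in> ?L"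
        then obtain \<epsilon> where \<epsilon>: "\<epsilon> \<in> quats 1" and p: "p = (d * \<epsilon>, qconj \<epsilon> * \<delta>)" by blast
        have "d * \<epsilon> * (qconj \<epsilon> * \<delta>) = d * (\<epsilon> * qconj \<epsilon>) * \<delta>" by (simp only: mult.assoc)
        then have "d * \<epsilon> * (qconj \<epsilon> * \<delta>) = \<alpha>" using unit [OF \<epsilon>] \<delta> by simp
        moreover have "qnorm \<epsilon> = 1" using \<epsilon> by (simp add: quats_def)
        ultimately show "p \<in> ?R" by (simp add: p quats_def qnorm_mult qnorm_qconj nd n\<delta>)
      qed
      show "?R \<subseteq> ?L"
      proof
        fix p assume "p \<in> ?R"
        then obtain \<beta> \<gamma> where p: "p = (\<beta>, \<gamma>)" and \<beta>: "qnorm \<beta> = m" and \<beta>\<gamma>: "\<beta> * \<gamma> = \<alpha>"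
          by (auto simp: quats_def)
        have "d = \<beta> * (\<gamma> * a + qconj \<beta> * b)"
          unfolding distrib_left mult.assoc [symmetric] mult_qconj \<beta> \<beta>\<gamma> by (rule ab)
        then obtain \<eta> where \<eta>: "d = \<beta> * \<eta>" by blast
        have "qnorm \<eta> = 1" using nd \<beta> mn(3) unfolding \<eta> qnorm_mult by simp
        then have u: "\<eta> \<in> quats 1" by (simp add: quats_def)
        have "d * qconj \<eta> = \<beta>" unfolding \<eta> mult.assoc unit [OF u] by simp
        moreover have "\<gamma> = \<eta> * \<delta>"
        proof (rule quat_mult_left_cancel)
          show "qnorm \<beta> \<noteq> 0" using \<beta> mn by simp
          show "\<beta> * \<gamma> = \<beta> * (\<eta> * \<delta>)" unfolding \<beta>\<gamma> mult.assoc [symmetric] \<eta> [symmetric] by (rule \<delta>)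
        qed
        moreover have "qconj (qconj \<eta>) = \<eta>" by (simp add: qconj_def)
        ultimately have "p = (d * qconj \<eta>, qconj (qconj \<eta>) * \<delta>)" using p by simp
        moreover have "qconj \<eta> \<in> quats 1" using u by (simp add: quats_def qnorm_qconj)
        ultimately show "p \<in> ?L" by blast
      qed
    qed
  qed
  then have "card (quats 1) = card {(\<beta>, \<gamma>) \<in> quats m \<times> quats n. \<beta> * \<gamma> = \<alpha>}" by (rule bij_betw_same_card)
  then show ?thesis by (simp add: card_quats_1)
qed

section \<open>Multiplicativity of a quartic harmonic sum\<close>

text \<open>The harmonic quartic form \<open>\<Sum> a\<^sub>i\<^sup>4 - 2 \<Sum>\<^bsub>i<j\<^esub> a\<^sub>i\<^sup>2 a\<^sub>j\<^sup>2\<close>, invariant under permutations and sign changes of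
the coordinates.\<close>

definition harmonic4 :: "quat \<Rightarrow> int" where
  "harmonic4 x = 2 * (q1 x ^ 4 + q2 x ^ 4 + q3 x ^ 4 + q4 x ^ 4) - (qnorm x)\<^sup>2"

lemma sum_quats_involution:
  assumes "\<And>x. qnorm (h x) = qnorm x" "\<And>x. h (h x) = x"
  shows "(\<Sum>x\<in>quats n. f (h x)) = (\<Sum>x\<in>quats n. f x)"
  by (rule sum.reindex_bij_witness [where i = h and j = h]) (auto simp: quats_def assms)

lemma sum_quats_flip:
  fixes f :: "int \<Rightarrow> int \<Rightarrow> int \<Rightarrow> int \<Rightarrow> int"
  shows "(\<Sum>x\<in>quats n. f (q1 x) (- q2 x) (q3 x) (q4 x)) = (\<Sum>x\<in>quats n. f (q1 x) (q2 x) (q3 x) (q4 x))"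
    and "(\<Sum>x\<in>quats n. f (q1 x) (q2 x) (- q3 x) (q4 x)) = (\<Sum>x\<in>quats n. f (q1 x) (q2 x) (q3 x) (q4 x))"
    and "(\<Sum>x\<in>quats n. f (q1 x) (q2 x) (q3 x) (- q4 x)) = (\<Sum>x\<in>quats n. f (q1 x) (q2 x) (q3 x) (q4 x))"
  using sum_quats_involution [of "\<lambda>x. Quat (q1 x) (- q2 x) (q3 x) (q4 x)" "\<lambda>x. f (q1 x) (q2 x) (q3 x) (q4 x)" n]
    sum_quats_involution [of "\<lambda>x. Quat (q1 x) (q2 x) (- q3 x) (q4 x)" "\<lambda>x. f (q1 x) (q2 x) (q3 x) (q4 x)" n]
    sum_quats_involution [of "\<lambda>x. Quat (q1 x) (q2 x) (q3 x) (- q4 x)" "\<lambda>x. f (q1 x) (q2 x) (q3 x) (q4 x)" n]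
  by (simp_all add: qnorm_def)

lemma sum_quats_swap:
  fixes f :: "int \<Rightarrow> int \<Rightarrow> int \<Rightarrow> int \<Rightarrow> int"
  shows "(\<Sum>x\<in>quats n. f (q2 x) (q1 x) (q3 x) (q4 x)) = (\<Sum>x\<in>quats n. f (q1 x) (q2 x) (q3 x) (q4 x))"
    and "(\<Sum>x\<in>quats n. f (q1 x) (q3 x) (q2 x) (q4 x)) = (\<Sum>x\<in>quats n. f (q1 x) (q2 x) (q3 x) (q4 x))"
    and "(\<Sum>x\<in>quats n. f (q1 x) (q2 x) (q4 x) (q3 x)) = (\<Sum>x\<in>quats n. f (q1 x) (q2 x) (q3 x) (q4 x))"
  using sum_quats_involution [of "\<lambda>x. Quat (q2 x) (q1 x) (q3 x) (q4 x)" "\<lambda>x. f (q1 x) (q2 x) (q3 x) (q4 x)" n]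
    sum_quats_involution [of "\<lambda>x. Quat (q1 x) (q3 x) (q2 x) (q4 x)" "\<lambda>x. f (q1 x) (q2 x) (q3 x) (q4 x)" n]
    sum_quats_involution [of "\<lambda>x. Quat (q1 x) (q2 x) (q4 x) (q3 x)" "\<lambda>x. f (q1 x) (q2 x) (q3 x) (q4 x)" n]
  by (simp_all add: qnorm_def)

definition moment4 :: "int \<Rightarrow> int" where
  "moment4 n = (\<Sum>x\<in>quats n. q1 x ^ 4)"

definition moment22 :: "int \<Rightarrow> int" where
  "moment22 n = (\<Sum>x\<in>quats n. (q1 x)\<^sup>2 * (q2 x)\<^sup>2)"

lemma moments:
  "(\<Sum>x\<in>quats n. q2 x ^ 4) = moment4 n" "(\<Sum>x\<in>quats n. q3 x ^ 4) = moment4 n"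
  "(\<Sum>x\<in>quats n. q4 x ^ 4) = moment4 n"
  "(\<Sum>x\<in>quats n. (q1 x)\<^sup>2 * (q3 x)\<^sup>2) = moment22 n" "(\<Sum>x\<in>quats n. (q1 x)\<^sup>2 * (q4 x)\<^sup>2) = moment22 n"
  "(\<Sum>x\<in>quats n. (q2 x)\<^sup>2 * (q3 x)\<^sup>2) = moment22 n" "(\<Sum>x\<in>quats n. (q2 x)\<^sup>2 * (q4 x)\<^sup>2) = moment22 n"
  "(\<Sum>x\<in>quats n. (q3 x)\<^sup>2 * (q4 x)\<^sup>2) = moment22 n"
proof -
  show 2: "(\<Sum>x\<in>quats n. q2 x ^ 4) = moment4 n"
    unfolding moment4_def by (rule sum_quats_swap(1) [where f = "\<lambda>a b c d. a ^ 4"])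
  show 3: "(\<Sum>x\<in>quats n. q3 x ^ 4) = moment4 n"
    unfolding 2 [symmetric] by (rule sum_quats_swap(2) [where f = "\<lambda>a b c d. b ^ 4"])
  show "(\<Sum>x\<in>quats n. q4 x ^ 4) = moment4 n"
    unfolding 3 [symmetric] by (rule sum_quats_swap(3) [where f = "\<lambda>a b c d. c ^ 4"])
  show 13: "(\<Sum>x\<in>quats n. (q1 x)\<^sup>2 * (q3 x)\<^sup>2) = moment22 n"
    unfolding moment22_def by (rule sum_quats_swap(2) [where f = "\<lambda>a b c d. a\<^sup>2 * b\<^sup>2"])
  show 14: "(\<Sum>x\<in>quats n. (q1 x)\<^sup>2 * (q4 x)\<^sup>2) = moment22 n"
    unfolding 13 [symmetric] by (rule sum_quats_swap(3) [where f = "\<lambda>a b c d. a\<^sup>2 * c\<^sup>2"])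
  show 23: "(\<Sum>x\<in>quats n. (q2 x)\<^sup>2 * (q3 x)\<^sup>2) = moment22 n"
    unfolding 13 [symmetric] by (rule sum_quats_swap(1) [where f = "\<lambda>a b c d. a\<^sup>2 * c\<^sup>2"])
  show 24: "(\<Sum>x\<in>quats n. (q2 x)\<^sup>2 * (q4 x)\<^sup>2) = moment22 n"
    unfolding 14 [symmetric] by (rule sum_quats_swap(1) [where f = "\<lambda>a b c d. a\<^sup>2 * d\<^sup>2"])
  show "(\<Sum>x\<in>quats n. (q3 x)\<^sup>2 * (q4 x)\<^sup>2) = moment22 n"
    unfolding 24 [symmetric] by (rule sum_quats_swap(2) [where f = "\<lambda>a b c d. b\<^sup>2 * d\<^sup>2"])
qed

text \<open>Only the moments \<open>\<Sum> x\<^sub>1\<^sup>4\<close> and \<open>\<Sum> x\<^sub>1\<^sup>2 x\<^sub>2\<^sup>2\<close> survive, by symmetry under sign changes and permutations.\<close>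

lemma sum_quats_linear_fourth_power:
  "(\<Sum>x\<in>quats n. (a * q1 x + b * q2 x + c * q3 x + d * q4 x) ^ 4)
    = (a ^ 4 + b ^ 4 + c ^ 4 + d ^ 4) * moment4 n
      + 6 * (a\<^sup>2 * b\<^sup>2 + a\<^sup>2 * c\<^sup>2 + a\<^sup>2 * d\<^sup>2 + b\<^sup>2 * c\<^sup>2 + b\<^sup>2 * d\<^sup>2 + c\<^sup>2 * d\<^sup>2) * moment22 n"
proof -
  \<comment> \<open>Averaging over the signs of three coordinates removes all monomials with an odd exponent.\<close>
  define L where "L = (\<lambda>s t u. \<Sum>x\<in>quats n. (a * q1 x + s * (b * q2 x) + t * (c * q3 x) + u * (d * q4 x)) ^ 4)"
  have s: "L (- 1) t u = L 1 t u" for t u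
    using sum_quats_flip(1) [of "\<lambda>e f g h. (a * e + 1 * (b * f) + t * (c * g) + u * (d * h)) ^ 4" n]
    by (simp add: L_def)
  have t: "L s (- 1) u = L s 1 u" for s u
    using sum_quats_flip(2) [of "\<lambda>e f g h. (a * e + s * (b * f) + 1 * (c * g) + u * (d * h)) ^ 4" n]
    by (simp add: L_def)
  have u: "L s t (- 1) = L s t 1" for s t
    using sum_quats_flip(3) [of "\<lambda>e f g h. (a * e + s * (b * f) + t * (c * g) + 1 * (d * h)) ^ 4" n]
    by (simp add: L_def)
  have even_part: "(A + B + C + D) ^ 4 + (A + B + C - D) ^ 4 + (A + B - C + D) ^ 4 + (A + B - C - D) ^ 4
      + (A - B + C + D) ^ 4 + (A - B + C - D) ^ 4 + (A - B - C + D) ^ 4 + (A - B - C - D) ^ 4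
    = 8 * (A ^ 4 + B ^ 4 + C ^ 4 + D ^ 4)
      + 48 * (A\<^sup>2 * B\<^sup>2 + A\<^sup>2 * C\<^sup>2 + A\<^sup>2 * D\<^sup>2 + B\<^sup>2 * C\<^sup>2 + B\<^sup>2 * D\<^sup>2 + C\<^sup>2 * D\<^sup>2)" for A B C D :: int
    by (simp add: power4_eq_xxxx power2_eq_square algebra_simps)
  have "8 * L 1 1 1 = L 1 1 1 + L 1 1 (- 1) + L 1 (- 1) 1 + L 1 (- 1) (- 1)
      + L (- 1) 1 1 + L (- 1) 1 (- 1) + L (- 1) (- 1) 1 + L (- 1) (- 1) (- 1)"
    by (simp add: s t u)
  also have "\<dots> = (\<Sum>x\<in>quats n. 8 * ((a * q1 x) ^ 4 + (b * q2 x) ^ 4 + (c * q3 x) ^ 4 + (d * q4 x) ^ 4)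
      + 48 * ((a * q1 x)\<^sup>2 * (b * q2 x)\<^sup>2 + (a * q1 x)\<^sup>2 * (c * q3 x)\<^sup>2 + (a * q1 x)\<^sup>2 * (d * q4 x)\<^sup>2
        + (b * q2 x)\<^sup>2 * (c * q3 x)\<^sup>2 + (b * q2 x)\<^sup>2 * (d * q4 x)\<^sup>2 + (c * q3 x)\<^sup>2 * (d * q4 x)\<^sup>2))"
    unfolding even_part [symmetric] by (simp add: L_def sum.distrib)
  also have "\<dots> = (\<Sum>x\<in>quats n. 8 * (a ^ 4 * q1 x ^ 4 + b ^ 4 * q2 x ^ 4 + c ^ 4 * q3 x ^ 4 + d ^ 4 * q4 x ^ 4)
      + 48 * (a\<^sup>2 * b\<^sup>2 * ((q1 x)\<^sup>2 * (q2 x)\<^sup>2) + a\<^sup>2 * c\<^sup>2 * ((q1 x)\<^sup>2 * (q3 x)\<^sup>2) + a\<^sup>2 * d\<^sup>2 * ((q1 x)\<^sup>2 * (q4 x)\<^sup>2)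
        + b\<^sup>2 * c\<^sup>2 * ((q2 x)\<^sup>2 * (q3 x)\<^sup>2) + b\<^sup>2 * d\<^sup>2 * ((q2 x)\<^sup>2 * (q4 x)\<^sup>2) + c\<^sup>2 * d\<^sup>2 * ((q3 x)\<^sup>2 * (q4 x)\<^sup>2)))"
    by (rule sum.cong) (simp_all add: power_mult_distrib mult_ac)
  also have "\<dots> = 8 * ((a ^ 4 + b ^ 4 + c ^ 4 + d ^ 4) * moment4 n
      + 6 * (a\<^sup>2 * b\<^sup>2 + a\<^sup>2 * c\<^sup>2 + a\<^sup>2 * d\<^sup>2 + b\<^sup>2 * c\<^sup>2 + b\<^sup>2 * d\<^sup>2 + c\<^sup>2 * d\<^sup>2) * moment22 n)"
    unfolding sum.distrib sum_distrib_left [symmetric] moments moment4_def [symmetric] moment22_def [symmetric]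
    by (simp add: algebra_simps)
  finally show ?thesis by (simp add: L_def)
qed

lemma qnorm_squared: "(qnorm x)\<^sup>2 = q1 x ^ 4 + q2 x ^ 4 + q3 x ^ 4 + q4 x ^ 4
    + 2 * ((q1 x)\<^sup>2 * (q2 x)\<^sup>2 + (q1 x)\<^sup>2 * (q3 x)\<^sup>2 + (q1 x)\<^sup>2 * (q4 x)\<^sup>2
      + (q2 x)\<^sup>2 * (q3 x)\<^sup>2 + (q2 x)\<^sup>2 * (q4 x)\<^sup>2 + (q3 x)\<^sup>2 * (q4 x)\<^sup>2)"
  by (simp add: qnorm_def power4_eq_xxxx power2_eq_square algebra_simps)

lemma sum_harmonic4: "(\<Sum>x\<in>quats n. harmonic4 x) = 4 * moment4 n - 12 * moment22 n"
  unfolding harmonic4_def qnorm_squared sum.distrib sum_subtractf sum_distrib_left [symmetric]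
    moments moment4_def [symmetric] moment22_def [symmetric]
  by simp

lemma sum_qnorm_squared: "(\<Sum>x\<in>quats n. (qnorm x)\<^sup>2) = 4 * moment4 n + 12 * moment22 n"
  unfolding qnorm_squared sum.distrib sum_distrib_left [symmetric]
    moments moment4_def [symmetric] moment22_def [symmetric]
  by simp

text \<open>The average of \<open>harmonic4 (x y)\<close> over \<open>y\<close> is proportional to \<open>harmonic4 x\<close>. Each coordinate of \<open>x y\<close> is a
linear form in \<open>y\<close> with coefficients \<open>\<plusminus>q1 x, \<dots>, \<plusminus>q4 x\<close>, so all four contribute equally.\<close>

lemma sum_harmonic4_mult:
  "(\<Sum>y\<in>quats n. harmonic4 (x * y)) = harmonic4 x * (\<Sum>y\<in>quats n. harmonic4 y)"
proof -
  define a b c d where "a = q1 x" and "b = q2 x" and "c = q3 x" and "d = q4 x"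
  define p e where "p = a ^ 4 + b ^ 4 + c ^ 4 + d ^ 4"
    and "e = a\<^sup>2 * b\<^sup>2 + a\<^sup>2 * c\<^sup>2 + a\<^sup>2 * d\<^sup>2 + b\<^sup>2 * c\<^sup>2 + b\<^sup>2 * d\<^sup>2 + c\<^sup>2 * d\<^sup>2"
  have nx: "(qnorm x)\<^sup>2 = p + 2 * e"
    unfolding qnorm_squared by (simp add: p_def e_def a_def b_def c_def d_def)
  have coord: "q1 (x * y) = a * q1 y + (- b) * q2 y + (- c) * q3 y + (- d) * q4 y"
    "q2 (x * y) = b * q1 y + a * q2 y + (- d) * q3 y + c * q4 y"
    "q3 (x * y) = c * q1 y + d * q2 y + a * q3 y + (- b) * q4 y"
    "q4 (x * y) = d * q1 y + (- c) * q2 y + b * q3 y + a * q4 y" for y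
    by (simp_all add: times_quat_def a_def b_def c_def d_def)
  have "(\<Sum>y\<in>quats n. q1 (x * y) ^ 4) = p * moment4 n + 6 * e * moment22 n"
    "(\<Sum>y\<in>quats n. q2 (x * y) ^ 4) = p * moment4 n + 6 * e * moment22 n"
    "(\<Sum>y\<in>quats n. q3 (x * y) ^ 4) = p * moment4 n + 6 * e * moment22 n"
    "(\<Sum>y\<in>quats n. q4 (x * y) ^ 4) = p * moment4 n + 6 * e * moment22 n"
    unfolding coord sum_quats_linear_fourth_power by (simp_all add: p_def e_def algebra_simps)
  then have "(\<Sum>y\<in>quats n. harmonic4 (x * y))
    = 2 * (4 * (p * moment4 n + 6 * e * moment22 n)) - (p + 2 * e) * (4 * moment4 n + 12 * moment22 n)"
    unfolding harmonic4_def qnorm_mult power_mult_distrib sum.distrib sum_subtractf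
      sum_distrib_left [symmetric] sum_qnorm_squared nx by simp
  also have "\<dots> = (2 * p - (p + 2 * e)) * (4 * moment4 n - 12 * moment22 n)"
    by (simp add: algebra_simps)
  also have "2 * p - (p + 2 * e) = harmonic4 x"
    unfolding harmonic4_def nx by (simp add: p_def a_def b_def c_def d_def)
  finally show ?thesis unfolding sum_harmonic4 .
qed

text \<open>Summing over pairs of norms \<open>m\<close> and \<open>n\<close> and grouping by the product, each quaternion of norm \<open>mn\<close> is hit
eight times.\<close>

theorem sum_harmonic4_coprime:
  assumes mn: "coprime m n" "odd m" "m > 0" "n > 0"
  shows "8 * (\<Sum>x\<in>quats (m * n). harmonic4 x)
    = (\<Sum>x\<in>quats m. harmonic4 x) * (\<Sum>x\<in>quats n. harmonic4 x)"
proof -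
  let ?P = "quats m \<times> quats n" and ?g = "\<lambda>(x, y). x * y :: quat"
  have "(\<Sum>x\<in>quats m. harmonic4 x) * (\<Sum>x\<in>quats n. harmonic4 x)
    = (\<Sum>x\<in>quats m. \<Sum>y\<in>quats n. harmonic4 (x * y))"
    unfolding sum_distrib_right sum_harmonic4_mult ..
  also have "\<dots> = (\<Sum>p\<in>?P. harmonic4 (?g p))"
    by (simp add: sum.cartesian_product case_prod_unfold)
  also have "\<dots> = (\<Sum>z\<in>quats (m * n). \<Sum>p\<in>{p\<in>?P. ?g p = z}. harmonic4 (?g p))"
    by (rule sum.group [symmetric]) (simp_all add: finite_quats, auto simp: quats_def qnorm_mult)
  also have "\<dots> = (\<Sum>z\<in>quats (m * n). 8 * harmonic4 z)"
  proof (rule sum.cong)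
    fix z assume z: "z \<in> quats (m * n)"
    have "{p\<in>?P. ?g p = z} = {(x, y) \<in> ?P. x * y = z}" by auto
    then have "card {p\<in>?P. ?g p = z} = 8"
      using card_quat_factorizations [OF mn] z by (simp add: quats_def)
    then show "(\<Sum>p\<in>{p\<in>?P. ?g p = z}. harmonic4 (?g p)) = 8 * harmonic4 z" by simp
  qed simp
  finally show ?thesis by (simp add: sum_distrib_left)
qed

section \<open>The coefficients as quaternionic sums\<close>

lemma finite_fibres_subset:
  assumes "finite_fibres X Q" "Y \<subseteq> X"
  shows "finite_fibres Y Q"
  unfolding finite_fibres_def
proof (intro conjI allI)
  show "\<forall>y\<in>Y. 0 \<le> Q y" using assms by (auto simp: finite_fibres_def)
  show "finite {y\<in>Y. Q y = n}" for n
    by (rule finite_subset [OF _ finite_fibresD [OF assms(1), of n]]) (use assms(2) in blast)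
qed

lemma odd_pairs_mod_4:
  fixes s t u v :: int
  assumes "odd s" "odd t" "odd u" "odd v" "4 dvd s - t - (u - v)"
  shows "((s, t), (u, v)) \<in>
    ({s. s mod 4 = 1} \<times> {s. s mod 4 = 1} \<union> {s. s mod 4 = 3} \<times> {s. s mod 4 = 3})
      \<times> ({s. s mod 4 = 1} \<times> {s. s mod 4 = 1} \<union> {s. s mod 4 = 3} \<times> {s. s mod 4 = 3})
    \<union> ({s. s mod 4 = 1} \<times> {s. s mod 4 = 3} \<union> {s. s mod 4 = 3} \<times> {s. s mod 4 = 1})
      \<times> ({s. s mod 4 = 1} \<times> {s. s mod 4 = 3} \<union> {s. s mod 4 = 3} \<times> {s. s mod 4 = 1})"
proof -
  have cases: "x mod 4 = 1 \<or> x mod 4 = 3" if "odd x" for x :: int using that by presburger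
  show ?thesis
    using cases [OF assms(1)] cases [OF assms(2)] cases [OF assms(3)] cases [OF assms(4)]
  proof (elim disjE)
  qed (use assms(5) in \<open>simp_all, presburger+\<close>)
qed

text \<open>The quadruples of odd numbers with product 1 modulo 4 are related by a linear map to all quaternions of
norm \<open>m\<close>. Such a quadruple has an even number of entries that are 3 modulo 4, and changing their signs
does not change the product, which explains the factor 8.\<close>

lemma jacobi_series_fourth_power:
  assumes "odd m"
  shows "8 * (jacobi_series ^ 4) $ (4 * m) = (\<Sum>x\<in>quats (int m). harmonic4 x)"
proof -
  let ?C1 = "{s::int. s mod 4 = 1}" and ?C3 = "{s::int. s mod 4 = 3}"
  let ?Q = "\<lambda>(s, t). s\<^sup>2 + t\<^sup>2 :: int" and ?c = "\<lambda>(s, t). s * t :: int"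
  let ?Q4 = "\<lambda>(p, r). ?Q p + ?Q r" and ?c4 = "\<lambda>(p, r). ?c p * ?c r"
  define neg where "neg = genfun ?C3 (\<lambda>s. s\<^sup>2) (\<lambda>s. s)"
  have "neg = genfun ?C1 (\<lambda>s. s\<^sup>2) (\<lambda>s. - 1 * s)"
    unfolding neg_def
  proof (rule genfun_reindex)
    show "bij_betw uminus ?C3 ?C1"
      by (rule bij_betwI [where g = uminus]) (auto, presburger+)
  qed auto
  then have neg: "neg = - jacobi_series"
    unfolding jacobi_series_def genfun_cmult fps_const_neg [symmetric] by simp
  have fin: "finite_fibres (X \<times> Y) ?Q" for X Y
    using finite_fibres_Times [OF finite_fibres_square1 finite_fibres_square1] by simp
  have prod2: "genfun (X \<times> Y) ?Q ?c = genfun X (\<lambda>s. s\<^sup>2) (\<lambda>s. s) * genfun Y (\<lambda>s. s\<^sup>2) (\<lambda>s. s)" for X Y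
    by (simp add: genfun_mult [OF finite_fibres_square1 finite_fibres_square1])
  \<comment> \<open>Pairs of odd numbers with product 1, respectively 3, modulo 4.\<close>
  let ?P = "?C1 \<times> ?C1 \<union> ?C3 \<times> ?C3" and ?M = "?C1 \<times> ?C3 \<union> ?C3 \<times> ?C1"
  have finP: "finite_fibres ?P ?Q" and finM: "finite_fibres ?M ?Q"
    by (rule finite_fibres_subset [OF fin [of UNIV UNIV]], blast)+
  have P: "genfun ?P ?Q ?c = 2 * jacobi_series\<^sup>2"
    using genfun_union [OF fin [of ?C1 ?C1] fin [of ?C3 ?C3], of ?c]
    unfolding prod2 neg_def [symmetric] neg jacobi_series_def [symmetric]
    by (simp add: power2_eq_square disjoint_iff)
  have M: "genfun ?M ?Q ?c = - 2 * jacobi_series\<^sup>2"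
    using genfun_union [OF fin [of ?C1 ?C3] fin [of ?C3 ?C1], of ?c]
    unfolding prod2 neg_def [symmetric] neg jacobi_series_def [symmetric]
    by (simp add: power2_eq_square disjoint_iff)
  let ?Y = "?P \<times> ?P \<union> ?M \<times> ?M"
  have "genfun ?Y ?Q4 ?c4 = genfun (?P \<times> ?P) ?Q4 ?c4 + genfun (?M \<times> ?M) ?Q4 ?c4"
    by (rule genfun_union [OF finite_fibres_Times [OF finP finP] finite_fibres_Times [OF finM finM]]) auto
  also have "\<dots> = genfun ?P ?Q ?c * genfun ?P ?Q ?c + genfun ?M ?Q ?c * genfun ?M ?Q ?c"
    by (simp only: genfun_mult [OF finP finP] genfun_mult [OF finM finM])
  also have "\<dots> = fps_const 8 * jacobi_series ^ 4"
    unfolding P M numeral_fps_const [symmetric] by (simp add: power2_eq_square power4_eq_xxxx)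
  finally have "genfun ?Y ?Q4 ?c4 $ (4 * m) = 8 * (jacobi_series ^ 4) $ (4 * m)"
    by simp
  then have 1: "8 * (jacobi_series ^ 4) $ (4 * m) = (\<Sum>y\<in>{y\<in>?Y. ?Q4 y = int (4 * m)}. ?c4 y)"
    by (simp only: genfun_nth)
  \<comment> \<open>The coordinates of \<open>(1 + i + j + k) x\<close>. Their product is \<open>harmonic4 x\<close> up to the odd
    term \<open>8 q1 q2 q3 q4\<close>, which sums to zero.\<close>
  define h where "h = (\<lambda>x. ((q1 x - q2 x - q3 x - q4 x, q1 x + q2 x - q3 x + q4 x),
    (q1 x + q2 x + q3 x - q4 x, q1 x - q2 x + q3 x + q4 x)))"
  define k where "k = (\<lambda>((s, t), (u, v)). Quat ((s + t + u + v) div 4) ((t - s + u - v) div 4)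
    ((u + v - s - t) div 4) ((t - s - u + v) div 4) :: quat)"
  have "bij_betw h (quats (int m)) {y\<in>?Y. ?Q4 y = int (4 * m)}"
  proof (rule bij_betwI [where g = k])
    show "h \<in> quats (int m) \<rightarrow> {y\<in>?Y. ?Q4 y = int (4 * m)}"
    proof
      fix x assume "x \<in> quats (int m)"
      then obtain a b c d where x: "x = Quat a b c d" and n: "a\<^sup>2 + b\<^sup>2 + c\<^sup>2 + d\<^sup>2 = int m"
        by (cases x) (simp add: quats_def qnorm_def)
      have "odd (a\<^sup>2 + b\<^sup>2 + c\<^sup>2 + d\<^sup>2)" unfolding n using assms by simp
      then have "odd (a + b + c + d)" by simp
      then have "odd (a - b - c - d)" "odd (a + b - c + d)" "odd (a + b + c - d)" "odd (a - b + c + d)"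
        by simp_all
      moreover have "4 dvd (a - b - c - d) - (a + b - c + d) - ((a + b + c - d) - (a - b + c + d))"
        by simp
      ultimately have "h x \<in> ?Y"
        unfolding x h_def quat.sel by (rule odd_pairs_mod_4)
      moreover have "?Q4 (h x) = 4 * (a\<^sup>2 + b\<^sup>2 + c\<^sup>2 + d\<^sup>2)"
        unfolding x h_def by (simp add: power2_eq_square algebra_simps)
      ultimately show "h x \<in> {y\<in>?Y. ?Q4 y = int (4 * m)}" unfolding n by simp
    qed
    have hk: "h (k y) = y" if "y \<in> ?Y" for y
    proof -
      obtain s t u v where y: "y = ((s, t), (u, v))" by (metis surj_pair)
      have D: "(s mod 4 = 1 \<and> t mod 4 = 1 \<or> s mod 4 = 3 \<and> t mod 4 = 3)
          \<and> (u mod 4 = 1 \<and> v mod 4 = 1 \<or> u mod 4 = 3 \<and> v mod 4 = 3)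
        \<or> (s mod 4 = 1 \<and> t mod 4 = 3 \<or> s mod 4 = 3 \<and> t mod 4 = 1)
          \<and> (u mod 4 = 1 \<and> v mod 4 = 3 \<or> u mod 4 = 3 \<and> v mod 4 = 1)"
        using that unfolding y by simp
      have "4 dvd s + t + u + v" using D by presburger
      moreover have "4 dvd t - s + u - v" using D by presburger
      moreover have "4 dvd u + v - s - t" using D by presburger
      moreover have "4 dvd t - s - u + v" using D by presburger
      ultimately obtain a b c d where "s + t + u + v = 4 * a" "t - s + u - v = 4 * b"
        "u + v - s - t = 4 * c" "t - s - u + v = 4 * d"
        by (elim dvdE)
      then show ?thesis unfolding y k_def h_def by simp
    qed
    show "h (k y) = y" if "y \<in> {y\<in>?Y. ?Q4 y = int (4 * m)}" for y
      using that hk by blast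
    show "k (h x) = x" for x
      by (cases x) (simp add: k_def h_def)
    show "k \<in> {y\<in>?Y. ?Q4 y = int (4 * m)} \<rightarrow> quats (int m)"
    proof
      fix y assume y: "y \<in> {y\<in>?Y. ?Q4 y = int (4 * m)}"
      then have "?Q4 (h (k y)) = 4 * int m" using hk by simp
      moreover have "?Q4 (h x) = 4 * qnorm x" for x
        by (simp add: h_def qnorm_def power2_eq_square algebra_simps)
      ultimately show "k y \<in> quats (int m)" by (simp add: quats_def)
    qed
  qed
  then have "(\<Sum>y\<in>{y\<in>?Y. ?Q4 y = int (4 * m)}. ?c4 y) = (\<Sum>x\<in>quats (int m). ?c4 (h x))"
    by (rule sum.reindex_bij_betw [symmetric])
  also have "\<dots> = (\<Sum>x\<in>quats (int m). harmonic4 x - 8 * (q1 x * q2 x * q3 x * q4 x))"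
    by (rule sum.cong) (simp_all add: h_def harmonic4_def qnorm_def power2_eq_square power4_eq_xxxx algebra_simps)
  also have "\<dots> = (\<Sum>x\<in>quats (int m). harmonic4 x) - 8 * (\<Sum>x\<in>quats (int m). q1 x * q2 x * q3 x * q4 x)"
    by (simp add: sum_subtractf sum_distrib_left)
  also have "(\<Sum>x\<in>quats (int m). q1 x * q2 x * q3 x * q4 x) = 0"
    using sum_quats_flip(1) [of "\<lambda>a b c d. a * b * c * d" "int m"] by (simp add: sum_negf)
  finally show ?thesis using 1 by simp
qed

section \<open>Sieving over square-free divisors\<close>

text \<open>The value at \<open>n / \<Prod>T\<close>, extended by zero. Square-free divisors are represented by their sets of prime factors.\<close>

definition quotient_value :: "(nat \<Rightarrow> rat) \<Rightarrow> nat \<Rightarrow> nat set \<Rightarrow> rat" where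
  "quotient_value h n T = (if \<Prod>T dvd n then h (n div \<Prod>T) else 0)"

text \<open>Multiplicativity on odd numbers, in the form in which it is used: one prime is split off at a time.\<close>

definition splits_odd_primes :: "(nat \<Rightarrow> rat) \<Rightarrow> bool" where
  "splits_odd_primes h \<longleftrightarrow> h 1 = 1 \<and>
    (\<forall>q e n. prime q \<longrightarrow> odd q \<longrightarrow> odd n \<longrightarrow> \<not> q dvd n \<longrightarrow> h (q ^ e * n) = h (q ^ e) * h n)"

definition prev_power :: "(nat \<Rightarrow> rat) \<Rightarrow> nat \<Rightarrow> nat \<Rightarrow> rat" where
  "prev_power h q e = (if e = 0 then 0 else h (q ^ (e - 1)))"

lemma splits_odd_primesD:
  assumes "splits_odd_primes h" "prime q" "odd q" "odd n" "\<not> q dvd n"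
  shows "h (q ^ e * n) = h (q ^ e) * h n"
  using assms unfolding splits_odd_primes_def by blast

lemma coprime_prod_primes:
  fixes q :: nat
  assumes "prime q" "\<And>p. p \<in> T \<Longrightarrow> prime p" "q \<notin> T"
  shows "coprime q (\<Prod>T)"
  by (rule prod_coprime_right) (use assms in \<open>auto intro: primes_coprime\<close>)

text \<open>Splitting off the \<open>q\<close>-part of the argument. These two equations carry both inductions over sets of primes below.\<close>

lemma quotient_value_insert:
  assumes h: "splits_odd_primes h" and q: "prime q" "odd q" and n: "odd n" "\<not> q dvd n"
    and T: "\<And>p. p \<in> T \<Longrightarrow> prime p" "finite T" "q \<notin> T"
  shows "quotient_value h (q ^ a * n) T = h (q ^ a) * quotient_value h n T"
    and "quotient_value h (q ^ a * n) (insert q T) = prev_power h q a * quotient_value h n T"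
proof -
  have cop: "coprime (\<Prod>T) (q ^ a)" for a
    using coprime_prod_primes [OF q(1) T(1,3)] by (simp add: coprime_commute)
  have pos: "\<Prod>T > 0" using T by (auto intro!: prod_pos prime_gt_0_nat)
  have 1: "quotient_value h (q ^ a * n) T = h (q ^ a) * quotient_value h n T" for a
  proof (cases "\<Prod>T dvd n")
    case True
    then obtain k where k: "n = \<Prod>T * k" by (elim dvdE)
    have "odd k" "\<not> q dvd k" using n unfolding k by auto
    have "q ^ a * n div \<Prod>T = q ^ a * k" "n div \<Prod>T = k" using pos unfolding k by simp_all
    then show ?thesis
      using True splits_odd_primesD [OF h q \<open>odd k\<close> \<open>\<not> q dvd k\<close>] by (simp add: quotient_value_def)
  next
    case False
    then have "\<not> \<Prod>T dvd q ^ a * n" using cop by (simp add: coprime_dvd_mult_right_iff)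
    with False show ?thesis by (simp add: quotient_value_def)
  qed
  then show "quotient_value h (q ^ a * n) T = h (q ^ a) * quotient_value h n T" .
  have ins: "\<Prod>(insert q T) = q * \<Prod>T" using T by simp
  show "quotient_value h (q ^ a * n) (insert q T) = prev_power h q a * quotient_value h n T"
  proof (cases a)
    case 0
    have "\<not> q * \<Prod>T dvd n" using n(2) by (metis dvd_mult_left)
    then show ?thesis using 0 by (simp add: quotient_value_def ins prev_power_def)
  next
    case (Suc b)
    have qn: "q ^ a * n = q * (q ^ b * n)" using Suc by simp
    have "q > 0" using q(1) by (rule prime_gt_0_nat)
    then have "quotient_value h (q ^ a * n) (insert q T) = quotient_value h (q ^ b * n) T"
      unfolding quotient_value_def ins qn by simp
    then show ?thesis using 1 [of b] Suc by (simp add: prev_power_def)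
  qed
qed

lemma sum_Pow_insert:
  assumes "finite A" "q \<notin> A"
  shows "(\<Sum>T\<in>Pow (insert q A). F T) = (\<Sum>T\<in>Pow A. F T + F (insert q T) :: 'a::comm_monoid_add)"
proof -
  have "(\<Sum>T\<in>Pow (insert q A). F T) = (\<Sum>T\<in>Pow A. F T) + (\<Sum>T\<in>insert q ` Pow A. F T)"
    unfolding Pow_insert using assms by (intro sum.union_disjoint) auto
  also have "(\<Sum>T\<in>insert q ` Pow A. F T) = (\<Sum>T\<in>Pow A. F (insert q T))"
    by (subst sum.reindex) (use assms in \<open>auto simp: inj_on_def\<close>)
  finally show ?thesis by (simp add: sum.distrib)
qed

lemma odd_prime_power_split:
  fixes q u :: nat
  assumes "prime q" "odd u"
  obtains a w where "u = q ^ a * w" "\<not> q dvd w" "odd w" "a = multiplicity q u"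
proof -
  have "u \<noteq> 0" using assms(2) by (metis dvd_0_right)
  obtain w where "u = q ^ multiplicity q u * w" "\<not> q dvd w"
    using multiplicity_decompose' [of u q] \<open>u \<noteq> 0\<close> assms(1) by (metis not_prime_unit)
  moreover from this(1) have "odd w" using assms(2) by (metis even_mult_iff)
  ultimately show thesis using that by blast
qed

lemma splits_coprime_mult:
  assumes h: "splits_odd_primes h"
  shows "coprime u v \<Longrightarrow> odd u \<Longrightarrow> odd v \<Longrightarrow> h (u * v) = h u * h v"
proof (induction u rule: less_induct)
  case (less u)
  show ?case
  proof (cases "u = 1")
    case True
    then show ?thesis using h by (simp add: splits_odd_primes_def)
  next
    case False
    then obtain q where q: "prime q" "q dvd u" using prime_factor_nat by blast
    have "u \<noteq> 0" using less.prems(2) by (metis dvd_0_right)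
    obtain e w where u: "u = q ^ e * w" and w: "\<not> q dvd w" "odd w" and e: "e = multiplicity q u"
      by (rule odd_prime_power_split [OF q(1) less.prems(2)])
    have "e > 0"
    proof (rule Nat.gr0I)
      assume "e = 0"
      then show False using u w(1) q(2) by simp
    qed
    have odds: "odd w" "odd q" using w(2) less.prems(2) q(2) by (auto dest: dvd_trans)
    have "w < u"
    proof -
      have "w \<noteq> 0" using odds(1) by (metis dvd_0_right)
      moreover have "1 < q ^ e" using prime_gt_1_nat [OF q(1)] \<open>e > 0\<close> by (rule one_less_power)
      ultimately show ?thesis unfolding u by simp
    qed
    have "coprime w v" using less.prems(1) unfolding u by simp
    have "\<not> q dvd v"
      using less.prems(1) q by (metis coprime_common_divisor not_prime_unit)
    then have nq: "\<not> q dvd w * v" using w(1) q(1) by (simp add: prime_dvd_mult_iff)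
    have "h (u * v) = h (q ^ e * (w * v))" by (simp add: u mult.assoc)
    also have "\<dots> = h (q ^ e) * h (w * v)"
      using odds less.prems(3) nq by (intro splits_odd_primesD [OF h q(1)]) auto
    also have "\<dots> = h (q ^ e) * h w * h v"
      using less.IH [OF \<open>w < u\<close> \<open>coprime w v\<close> odds(1) less.prems(3)] by simp
    also have "h (q ^ e) * h w = h u"
      unfolding u by (rule splits_odd_primesD [OF h q(1) odds(2,1) w(1), symmetric])
    finally show ?thesis .
  qed
qed

text \<open>The inverse Hecke relation \<open>h(uv) = \<Sum> \<mu>(d) \<kappa>(d) h(u/d) h(v/d)\<close> over the square-free \<open>d\<close> composed of primes in
\<open>A\<close>. The set \<open>A\<close> has to contain the common prime factors of \<open>u\<close> and \<open>v\<close>; the induction removes one of its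
elements together with the corresponding prime powers in \<open>u\<close> and \<open>v\<close>.\<close>

lemma hecke_relation_sieve:
  assumes h: "splits_odd_primes h"
    and rec: "\<And>q a c. prime q \<Longrightarrow> odd q \<Longrightarrow>
      h (q ^ (a + c)) = h (q ^ a) * h (q ^ c) - \<kappa> q * (prev_power h q a * prev_power h q c)"
  shows "finite A \<Longrightarrow> (\<And>p. p \<in> A \<Longrightarrow> prime p \<and> odd p) \<Longrightarrow> odd u \<Longrightarrow> odd v \<Longrightarrow>
    (\<And>p. prime p \<Longrightarrow> p dvd u \<Longrightarrow> p dvd v \<Longrightarrow> p \<in> A) \<Longrightarrow>
    h (u * v) = (\<Sum>T\<in>Pow A. (\<Prod>p\<in>T. - \<kappa> p) * (quotient_value h u T * quotient_value h v T))"
proof (induction A arbitrary: u v rule: finite_induct)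
  case empty
  have "coprime u v"
  proof (rule coprimeI)
    fix c assume c: "c dvd u" "c dvd v"
    show "c dvd 1"
    proof (rule ccontr)
      assume "\<not> c dvd 1"
      then have "c \<noteq> 1" by auto
      then obtain p where p: "prime p" "p dvd c" using prime_factor_nat by metis
      have "p \<in> {}"
        using p(1) dvd_trans [OF p(2) c(1)] dvd_trans [OF p(2) c(2)] by (rule empty.prems(4))
      then show False by simp
    qed
  qed
  then have "h (u * v) = h u * h v"
    using empty.prems(2,3) by (rule splits_coprime_mult [OF h])
  then show ?case by (simp add: quotient_value_def)
next
  case (insert q A)
  have q: "prime q" "odd q" using insert.prems(1) [of q] by simp_all
  obtain a u' where u: "u = q ^ a * u'" "\<not> q dvd u'" "odd u'"
    using odd_prime_power_split [OF q(1) insert.prems(2)] by metis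
  obtain c v' where v: "v = q ^ c * v'" "\<not> q dvd v'" "odd v'"
    using odd_prime_power_split [OF q(1) insert.prems(3)] by metis
  have IH: "h (u' * v') = (\<Sum>T\<in>Pow A. (\<Prod>p\<in>T. - \<kappa> p) * (quotient_value h u' T * quotient_value h v' T))"
  proof (rule insert.IH)
    show "p \<in> A" if "prime p" "p dvd u'" "p dvd v'" for p
    proof -
      have "p dvd u" "p dvd v" unfolding u(1) v(1) using that by simp_all
      with \<open>prime p\<close> have "p \<in> insert q A" by (rule insert.prems(4))
      moreover have "p \<noteq> q" using that(2) u(2) by blast
      ultimately show ?thesis by simp
    qed
    show "prime p \<and> odd p" if "p \<in> A" for p using that by (intro insert.prems(1)) simp
  qed (rule u(3), rule v(3))
  have summand: "(\<Prod>p\<in>T. - \<kappa> p) * (quotient_value h u T * quotient_value h v T)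
      + (\<Prod>p\<in>insert q T. - \<kappa> p) * (quotient_value h u (insert q T) * quotient_value h v (insert q T))
    = h (q ^ (a + c)) * ((\<Prod>p\<in>T. - \<kappa> p) * (quotient_value h u' T * quotient_value h v' T))" if "T \<in> Pow A" for T
  proof -
    have T: "\<And>p. p \<in> T \<Longrightarrow> prime p" "finite T" "q \<notin> T"
    proof -
      show "prime p" if "p \<in> T" for p
        using insert.prems(1) [of p] \<open>p \<in> T\<close> \<open>T \<in> Pow A\<close> by blast
      show "finite T" "q \<notin> T"
        using \<open>T \<in> Pow A\<close> insert.hyps finite_subset by blast+
    qed
    have "(\<Prod>p\<in>insert q T. - \<kappa> p) = - \<kappa> q * (\<Prod>p\<in>T. - \<kappa> p)" using T by simp
    moreover have "quotient_value h u T = h (q ^ a) * quotient_value h u' T"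
      unfolding u(1) by (rule quotient_value_insert(1) [OF h q u(3,2)]) (use T in auto)
    moreover have "quotient_value h u (insert q T) = prev_power h q a * quotient_value h u' T"
      unfolding u(1) by (rule quotient_value_insert(2) [OF h q u(3,2)]) (use T in auto)
    moreover have "quotient_value h v T = h (q ^ c) * quotient_value h v' T"
      unfolding v(1) by (rule quotient_value_insert(1) [OF h q v(3,2)]) (use T in auto)
    moreover have "quotient_value h v (insert q T) = prev_power h q c * quotient_value h v' T"
      unfolding v(1) by (rule quotient_value_insert(2) [OF h q v(3,2)]) (use T in auto)
    ultimately show ?thesis unfolding rec [OF q] by (simp add: algebra_simps)
  qed
  have nq: "\<not> q dvd u' * v'" using u(2) v(2) q(1) by (simp add: prime_dvd_mult_iff)
  have "u * v = q ^ (a + c) * (u' * v')" unfolding u(1) v(1) by (simp add: power_add mult_ac)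
  then have "h (u * v) = h (q ^ (a + c)) * h (u' * v')"
    using splits_odd_primesD [OF h q _ nq] u(3) v(3) by simp
  also have "\<dots> = (\<Sum>T\<in>Pow A. h (q ^ (a + c)) * ((\<Prod>p\<in>T. - \<kappa> p) * (quotient_value h u' T * quotient_value h v' T)))"
    unfolding IH by (rule sum_distrib_left)
  also have "\<dots> = (\<Sum>T\<in>Pow (insert q A). (\<Prod>p\<in>T. - \<kappa> p) * (quotient_value h u T * quotient_value h v T))"
    unfolding sum_Pow_insert [OF insert.hyps] using summand by (intro sum.cong) auto
  finally show ?case .
qed

text \<open>Expanding the product over the primes. The shape of the result matches \<open>hecke_relation_sieve\<close>.\<close>

lemma euler_factors_sieve:
  assumes h: "splits_odd_primes h"
  shows "finite A \<Longrightarrow> (\<And>p. p \<in> A \<Longrightarrow> prime p \<and> odd p) \<Longrightarrow> odd m \<Longrightarrow>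
    (\<And>p. prime p \<Longrightarrow> p dvd m \<Longrightarrow> p \<in> A) \<Longrightarrow>
    (\<Prod>p\<in>A. h (p ^ multiplicity p m) - \<kappa> p * prev_power h p (multiplicity p m))
      = (\<Sum>T\<in>Pow A. (\<Prod>p\<in>T. - \<kappa> p) * quotient_value h m T)"
proof (induction A arbitrary: m rule: finite_induct)
  case empty
  have "m = 1"
  proof (rule ccontr)
    assume "m \<noteq> 1"
    then obtain p where "prime p" "p dvd m" using prime_factor_nat by metis
    from empty.prems(3) [OF this] show False by simp
  qed
  then show ?case using h by (simp add: quotient_value_def splits_odd_primes_def)
next
  case (insert q A)
  have q: "prime q" "odd q" using insert.prems(1) [of q] by simp_all
  obtain a w where m: "m = q ^ a * w" "\<not> q dvd w" "odd w" and a: "a = multiplicity q m"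
    by (rule odd_prime_power_split [OF q(1) insert.prems(2)])
  have "w \<noteq> 0" using m(3) by (metis dvd_0_right)
  have mult: "multiplicity p m = multiplicity p w" if "p \<in> A" for p
  proof -
    have p: "prime p" using insert.prems(1) [of p] that by simp
    have "p \<noteq> q" using that insert.hyps(2) by blast
    have "\<not> p dvd q ^ a"
    proof
      assume "p dvd q ^ a"
      with p have "p dvd q" by (rule prime_dvd_power)
      with p q(1) have "p = q" by (rule primes_dvd_imp_eq)
      with \<open>p \<noteq> q\<close> show False ..
    qed
    then have "multiplicity p (q ^ a) = 0" by (rule not_dvd_imp_multiplicity_0)
    moreover have "q ^ a \<noteq> 0" using prime_gt_0_nat [OF q(1)] by simp
    ultimately show ?thesis unfolding m(1)
      using prime_elem_multiplicity_mult_distrib [OF prime_imp_prime_elem [OF p] _ \<open>w \<noteq> 0\<close>] by simp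
  qed
  have IH: "(\<Prod>p\<in>A. h (p ^ multiplicity p w) - \<kappa> p * prev_power h p (multiplicity p w))
      = (\<Sum>T\<in>Pow A. (\<Prod>p\<in>T. - \<kappa> p) * quotient_value h w T)"
  proof (rule insert.IH)
    show "p \<in> A" if "prime p" "p dvd w" for p
    proof -
      have "p dvd m" unfolding m(1) using that by simp
      with \<open>prime p\<close> have "p \<in> insert q A" by (rule insert.prems(3))
      moreover have "p \<noteq> q" using that(2) m(2) by blast
      ultimately show ?thesis by simp
    qed
    show "prime p \<and> odd p" if "p \<in> A" for p using that by (intro insert.prems(1)) simp
  qed (rule m(3))
  have summand: "(\<Prod>p\<in>T. - \<kappa> p) * quotient_value h m T + (\<Prod>p\<in>insert q T. - \<kappa> p) * quotient_value h m (insert q T)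
    = (h (q ^ a) - \<kappa> q * prev_power h q a) * ((\<Prod>p\<in>T. - \<kappa> p) * quotient_value h w T)" if "T \<in> Pow A" for T
  proof -
    have T: "\<And>p. p \<in> T \<Longrightarrow> prime p" "finite T" "q \<notin> T"
    proof -
      show "prime p" if "p \<in> T" for p
        using insert.prems(1) [of p] \<open>p \<in> T\<close> \<open>T \<in> Pow A\<close> by blast
      show "finite T" "q \<notin> T"
        using \<open>T \<in> Pow A\<close> insert.hyps finite_subset by blast+
    qed
    have "(\<Prod>p\<in>insert q T. - \<kappa> p) = - \<kappa> q * (\<Prod>p\<in>T. - \<kappa> p)" using T by simp
    moreover have "quotient_value h m T = h (q ^ a) * quotient_value h w T"
      unfolding m(1) by (rule quotient_value_insert(1) [OF h q m(3,2)]) (use T in auto)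
    moreover have "quotient_value h m (insert q T) = prev_power h q a * quotient_value h w T"
      unfolding m(1) by (rule quotient_value_insert(2) [OF h q m(3,2)]) (use T in auto)
    ultimately show ?thesis by (simp add: algebra_simps)
  qed
  have "(\<Prod>p\<in>insert q A. h (p ^ multiplicity p m) - \<kappa> p * prev_power h p (multiplicity p m))
    = (h (q ^ a) - \<kappa> q * prev_power h q a)
      * (\<Prod>p\<in>A. h (p ^ multiplicity p w) - \<kappa> p * prev_power h p (multiplicity p w))"
    using insert.hyps mult by (simp add: a)
  also have "\<dots> = (\<Sum>T\<in>Pow A. (h (q ^ a) - \<kappa> q * prev_power h q a) * ((\<Prod>p\<in>T. - \<kappa> p) * quotient_value h w T))"
    unfolding IH by (rule sum_distrib_left)
  also have "\<dots> = (\<Sum>T\<in>Pow (insert q A). (\<Prod>p\<in>T. - \<kappa> p) * quotient_value h m T)"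
    unfolding sum_Pow_insert [OF insert.hyps] using summand by (intro sum.cong) auto
  finally show ?case .
qed

section \<open>The Hecke relations in sieved form\<close>

definition hecke_b :: "nat \<Rightarrow> rat" where
  "hecke_b n = of_int (hecke_theta n) / 2"

definition kappa :: "nat \<Rightarrow> rat" where
  "kappa p = of_int ((int p)\<^sup>2 * Legendre (- 2) (int p))"

lemma hecke_b_1: "hecke_b 1 = 1"
  by (simp only: hecke_b_def hecke_theta_1)

lemma hecke_b_prime_mult:
  assumes "prime p" "odd p"
  shows "hecke_b (p * n) = hecke_b p * hecke_b n - kappa p * (if p dvd n then hecke_b (n div p) else 0)"
proof -
  have "(of_int (hecke_theta p * hecke_theta n) :: rat) = of_int (2 * (hecke_theta (p * n)
    + (int p)\<^sup>2 * Legendre (- 2) (int p) * (if p dvd n then hecke_theta (n div p) else 0)))"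
    using hecke_theta_prime_mult [OF assms, of n] by (simp only:)
  then show ?thesis by (simp add: hecke_b_def kappa_def field_simps split: if_splits)
qed

lemma hecke_b_prime_power_mult:
  assumes q: "prime q" "odd q" and n: "\<not> q dvd n"
  shows "hecke_b (q ^ Suc e * n) = hecke_b q * hecke_b (q ^ e * n)
    - kappa q * (if e = 0 then 0 else hecke_b (q ^ (e - 1) * n))"
proof (cases e)
  case 0
  then show ?thesis using hecke_b_prime_mult [OF q, of n] n by simp
next
  case (Suc d)
  have 1: "q ^ Suc e * n = q * (q ^ e * n)" by simp
  have 2: "q ^ e * n = q * (q ^ d * n)" using Suc by simp
  have 3: "q dvd q ^ e * n" "q ^ e * n div q = q ^ d * n"
    unfolding 2 using prime_gt_0_nat [OF q(1)] by simp_all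
  have 4: "(if e = 0 then 0 else hecke_b (q ^ (e - 1) * n)) = hecke_b (q ^ d * n)" using Suc by simp
  show ?thesis
    using hecke_b_prime_mult [OF q, of "q ^ e * n"] 3 unfolding 1 4 by (simp only: if_True)
qed

lemma hecke_b_splits: "splits_odd_primes hecke_b"
  unfolding splits_odd_primes_def
proof (intro conjI allI impI)
  fix q e n :: nat assume q: "prime q" "odd q" and n: "\<not> q dvd n"
  have q1: "\<not> q dvd 1" using q(1) by (metis not_prime_unit)
  show "hecke_b (q ^ e * n) = hecke_b (q ^ e) * hecke_b n"
  proof (induction e rule: less_induct)
    case (less e)
    show ?case
    proof (cases e)
      case 0
      then show ?thesis using hecke_b_1 by simp
    next
      case (Suc d)
      have "hecke_b (q ^ d * n) = hecke_b (q ^ d) * hecke_b n" using less Suc by simp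
      moreover have "hecke_b (q ^ (d - 1) * n) = hecke_b (q ^ (d - 1)) * hecke_b n" using less Suc by simp
      ultimately have "hecke_b (q ^ e * n) = hecke_b q * (hecke_b (q ^ d) * hecke_b n)
          - kappa q * (if d = 0 then 0 else hecke_b (q ^ (d - 1)) * hecke_b n)"
        using hecke_b_prime_power_mult [OF q n, of d] unfolding Suc by (simp only:)
      moreover have "hecke_b (q ^ e) = hecke_b q * hecke_b (q ^ d)
          - kappa q * (if d = 0 then 0 else hecke_b (q ^ (d - 1)))"
        using hecke_b_prime_power_mult [OF q q1, of d] unfolding Suc by (simp only: mult_1_right)
      ultimately show ?thesis by (simp add: left_diff_distrib mult.assoc)
    qed
  qed
qed (rule hecke_b_1)

lemma hecke_b_prime_powers:
  assumes q: "prime q" "odd q"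
  shows "hecke_b (q ^ (a + c)) = hecke_b (q ^ a) * hecke_b (q ^ c)
    - kappa q * (prev_power hecke_b q a * prev_power hecke_b q c)"
proof -
  have q1: "\<not> q dvd 1" using q(1) by (metis not_prime_unit)
  have rec: "hecke_b (q ^ Suc e) = hecke_b q * hecke_b (q ^ e) - kappa q * prev_power hecke_b q e" for e
    using hecke_b_prime_power_mult [OF q q1, of e] by (simp add: prev_power_def)
  show ?thesis
  proof (induction a arbitrary: c)
    case 0
    show ?case using hecke_b_1 by (simp add: prev_power_def)
  next
    case (Suc a)
    have "hecke_b (q ^ (Suc a + c)) = hecke_b (q ^ (a + Suc c))" by simp
    also have "\<dots> = hecke_b (q ^ a) * hecke_b (q ^ Suc c)
      - kappa q * (prev_power hecke_b q a * prev_power hecke_b q (Suc c))" by (rule Suc.IH)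
    also have "\<dots> = hecke_b (q ^ Suc a) * hecke_b (q ^ c)
      - kappa q * (prev_power hecke_b q (Suc a) * prev_power hecke_b q c)"
      unfolding rec by (simp add: prev_power_def algebra_simps)
    finally show ?case .
  qed
qed

lemma tau_harmonic4: "odd m \<Longrightarrow> 8 * tau_6_4 m = (\<Sum>x\<in>quats (int m). harmonic4 x)"
  by (simp add: tau_6_4_eq jacobi_series_fourth_power)

definition tau_rat :: "nat \<Rightarrow> rat" where
  "tau_rat n = of_int (tau_6_4 n)"

lemma tau_splits: "splits_odd_primes tau_rat"
  unfolding splits_odd_primes_def
proof (intro conjI allI impI)
  have "(\<Sum>x\<in>quats 1. harmonic4 x) = 8"
    by (simp add: quats_1 harmonic4_def qnorm_def)
  then show "tau_rat 1 = 1" using tau_harmonic4 [of 1] by (simp add: tau_rat_def)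
next
  fix q e n :: nat assume q: "prime q" "odd q" and n: "odd n" "\<not> q dvd n"
  have "coprime (q ^ e) n" using q(1) n(2) prime_imp_coprime by auto
  then have "coprime (int (q ^ e)) (int n)" by (simp only: coprime_int_iff)
  moreover have "0 < int (q ^ e)" "0 < int n" using q(1) n(1) by (auto simp: prime_gt_0_nat intro!: Nat.gr0I)
  moreover have "odd (int (q ^ e))" using q(2) by simp
  ultimately have "8 * (\<Sum>x\<in>quats (int (q ^ e) * int n). harmonic4 x)
    = (\<Sum>x\<in>quats (int (q ^ e)). harmonic4 x) * (\<Sum>x\<in>quats (int n). harmonic4 x)"
    by (intro sum_harmonic4_coprime)
  moreover have "8 * tau_6_4 (q ^ e * n) = (\<Sum>x\<in>quats (int (q ^ e) * int n). harmonic4 x)"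
    using tau_harmonic4 [of "q ^ e * n"] q(2) n(1) by simp
  moreover have "8 * tau_6_4 (q ^ e) = (\<Sum>x\<in>quats (int (q ^ e)). harmonic4 x)"
    using tau_harmonic4 [of "q ^ e"] q(2) by simp
  moreover have "8 * tau_6_4 n = (\<Sum>x\<in>quats (int n). harmonic4 x)"
    using n(1) by (rule tau_harmonic4)
  ultimately have "8 * (8 * tau_6_4 (q ^ e * n)) = (8 * tau_6_4 (q ^ e)) * (8 * tau_6_4 n)"
    by (simp only:)
  then have "tau_6_4 (q ^ e * n) = tau_6_4 (q ^ e) * tau_6_4 n" by simp
  then show "tau_rat (q ^ e * n) = tau_rat (q ^ e) * tau_rat n" by (simp add: tau_rat_def)
qed

lemma C3_sieve:
  assumes "odd m"
  shows "of_int (C3 m) = (\<Sum>T\<in>Pow (prime_factors m). (\<Prod>p\<in>T. - kappa p) * quotient_value tau_rat m T)"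
proof -
  have "m \<noteq> 0" using assms by (metis dvd_0_right)
  have "(of_int (C3 m) :: rat) = (\<Prod>p\<in>prime_factors m.
      tau_rat (p ^ multiplicity p m) - kappa p * prev_power tau_rat p (multiplicity p m))"
    unfolding C3_def of_int_prod
  proof (rule prod.cong)
    fix p assume "p \<in> prime_factors m"
    then have "multiplicity p m \<noteq> 0" using \<open>m \<noteq> 0\<close>
      by (metis in_prime_factors_imp_dvd in_prime_factors_imp_prime neq0_conv prime_multiplicity_gt_zero_iff prime_imp_prime_elem less_irrefl)
    then show "of_int (tau_6_4 (p ^ multiplicity p m)
       - (int p)\<^sup>2 * Legendre (- 2) (int p) * tau_6_4 (p ^ (multiplicity p m - 1)))
      = tau_rat (p ^ multiplicity p m) - kappa p * prev_power tau_rat p (multiplicity p m)"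
      by (simp add: tau_rat_def kappa_def prev_power_def)
  qed simp
  also have "\<dots> = (\<Sum>T\<in>Pow (prime_factors m). (\<Prod>p\<in>T. - kappa p) * quotient_value tau_rat m T)"
  proof (rule euler_factors_sieve [OF tau_splits])
    show "prime p \<and> odd p" if "p \<in> prime_factors m" for p
      using that assms by (metis dvd_trans in_prime_factors_iff)
  qed (use assms \<open>m \<noteq> 0\<close> in \<open>auto simp: in_prime_factors_iff\<close>)
  finally show ?thesis .
qed

section \<open>The theta series of \<open>x\<^sup>2 + 2y\<^sup>2\<close> in terms of theta functions\<close>

text \<open>The parts of the generating function of \<open>hecke_theta\<close> with \<open>x\<close> odd and \<open>y\<close> even, respectively \<open>x\<close> and \<open>y\<close> odd.
They live in exponents 1 and 3 modulo 8.\<close>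

definition hecke_part1 :: "int fps" where
  "hecke_part1 = theta_even 2 * euler (theta_odd 1) - theta_odd 1 * euler (theta_even 2)"

definition hecke_part3 :: "int fps" where
  "hecke_part3 = theta_odd 2 * euler (theta_odd 1) - theta_odd 1 * euler (theta_odd 2)"

lemma hecke_part_genfun:
  fixes X :: "int set"
  shows "genfun X (\<lambda>y. 2 * y\<^sup>2) (\<lambda>_. 1) * euler (theta_odd 1)
      - theta_odd 1 * euler (genfun X (\<lambda>y. 2 * y\<^sup>2) (\<lambda>_. 1))
    = genfun ({x. odd x} \<times> X) (\<lambda>(x, y). 1 * x\<^sup>2 + 2 * y\<^sup>2) (\<lambda>(x, y). x\<^sup>2 - 2 * y\<^sup>2)"
proof -
  have fin: "finite_fibres {x::int. odd x} (\<lambda>x. 1 * x\<^sup>2)" "finite_fibres X (\<lambda>y. 2 * y\<^sup>2)"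
    by (rule finite_fibres_square, simp)+
  have "genfun X (\<lambda>y. 2 * y\<^sup>2) (\<lambda>_. 1) * euler (theta_odd 1)
      - theta_odd 1 * euler (genfun X (\<lambda>y. 2 * y\<^sup>2) (\<lambda>_. 1))
    = genfun {x. odd x} (\<lambda>x. 1 * x\<^sup>2) (\<lambda>x. 1 * x\<^sup>2 * 1) * genfun X (\<lambda>y. 2 * y\<^sup>2) (\<lambda>_. 1)
      - genfun {x. odd x} (\<lambda>x. 1 * x\<^sup>2) (\<lambda>_. 1) * genfun X (\<lambda>y. 2 * y\<^sup>2) (\<lambda>y. 2 * y\<^sup>2 * 1)"
    unfolding theta_odd_def euler_genfun by (simp only: mult.commute)
  also have "\<dots> = genfun ({x. odd x} \<times> X) (\<lambda>(x, y). 1 * x\<^sup>2 + 2 * y\<^sup>2) (\<lambda>(x, y). x\<^sup>2 - 2 * y\<^sup>2)"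
    unfolding genfun_mult [OF fin] genfun_diff [symmetric]
    by (rule genfun_cong) auto
  finally show ?thesis .
qed

lemma hecke_parts_nth:
  assumes "odd n"
  shows "(hecke_part1 + hecke_part3) $ n = hecke_theta n"
proof -
  let ?O = "{x::int. odd x}" and ?E = "{x::int. even x}"
  let ?Q = "\<lambda>(x, y). 1 * x\<^sup>2 + 2 * y\<^sup>2 :: int" and ?c = "\<lambda>(x, y). x\<^sup>2 - 2 * y\<^sup>2 :: int"
  have fin: "finite_fibres (?O \<times> X) ?Q" for X
    by (intro finite_fibres_Times finite_fibres_square) simp_all
  have "hecke_part1 + hecke_part3 = genfun (?O \<times> ?E) ?Q ?c + genfun (?O \<times> ?O) ?Q ?c"
    unfolding hecke_part1_def hecke_part3_def theta_even_def theta_odd_def [of 2] hecke_part_genfun ..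
  also have "\<dots> = genfun (?O \<times> ?E \<union> ?O \<times> ?O) ?Q ?c"
    by (rule genfun_union [symmetric, OF fin fin]) auto
  finally have "(hecke_part1 + hecke_part3) $ n
    = (\<Sum>p\<in>{p \<in> ?O \<times> ?E \<union> ?O \<times> ?O. ?Q p = int n}. ?c p)"
    by (simp only: genfun_nth)
  also have "{p \<in> ?O \<times> ?E \<union> ?O \<times> ?O. ?Q p = int n} = reps (int n)"
  proof
    show "reps (int n) \<subseteq> {p \<in> ?O \<times> ?E \<union> ?O \<times> ?O. ?Q p = int n}"
    proof (rule subrelI)
      fix x y assume "(x, y) \<in> reps (int n)"
      then have e: "x\<^sup>2 + 2 * y\<^sup>2 = int n" by (simp add: reps_def)
      then have "odd (x\<^sup>2 + 2 * y\<^sup>2)" using assms by simp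
      then have "odd x" by simp
      then show "(x, y) \<in> {p \<in> ?O \<times> ?E \<union> ?O \<times> ?O. ?Q p = int n}" using e by auto
    qed
    show "{p \<in> ?O \<times> ?E \<union> ?O \<times> ?O. ?Q p = int n} \<subseteq> reps (int n)"
      by (auto simp: reps_def)
  qed
  finally show ?thesis unfolding hecke_theta_def .
qed

lemma supported_euler: "supported_mod M r f \<Longrightarrow> supported_mod M r (euler f)"
  unfolding supported_mod_def euler_nth by (metis mult_zero_right)

lemma supported_hecke_part1: "supported_mod 8 1 hecke_part1"
proof -
  have "supported_mod 8 (0 + 1) (theta_even 2 * euler (theta_odd 1))"
    by (intro supported_mod_mult supported_theta_even_2 supported_euler supported_theta_odd_1)
  moreover have "supported_mod 8 (1 + 0) (theta_odd 1 * euler (theta_even 2))"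
    by (intro supported_mod_mult supported_theta_even_2 supported_euler supported_theta_odd_1)
  ultimately show ?thesis unfolding hecke_part1_def by (simp add: supported_mod_diff)
qed

lemma supported_hecke_part3: "supported_mod 8 3 hecke_part3"
proof -
  have "supported_mod 8 (2 + 1) (theta_odd 2 * euler (theta_odd 1))"
    by (intro supported_mod_mult supported_theta_odd_2 supported_euler supported_theta_odd_1)
  moreover have "supported_mod 8 (1 + 2) (theta_odd 1 * euler (theta_odd 2))"
    by (intro supported_mod_mult supported_theta_odd_2 supported_euler supported_theta_odd_1)
  ultimately show ?thesis unfolding hecke_part3_def by (simp add: supported_mod_diff numeral_3_eq_3)
qed

text \<open>From \<open>w\<^sup>2 = 2PS\<close> one gets \<open>w\<cdot>Dw = S\<cdot>DP + P\<cdot>DS\<close>, which expresses both parts through the single Wronskian.\<close>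

lemma theta_odd_times_hecke_parts:
  "theta_odd 1 * hecke_part1 = theta_even 2 * theta_wronskian 2"
  "theta_odd 1 * hecke_part3 = - (theta_odd 2 * theta_wronskian 2)"
proof -
  define w P S where "w = theta_odd 1" and "P = theta_even 2" and "S = theta_odd 2"
  have ww: "w * w = 2 * (P * S)"
    using theta_odd_square by (simp add: w_def P_def S_def power2_eq_square)
  then have "euler (w * w) = euler (2 * (P * S))" by simp
  moreover have "euler 2 = (0 :: int fps)" by (simp add: euler_def)
  ultimately have "2 * (w * euler w) = 2 * (euler P * S + P * euler S)"
    by (simp add: euler_mult algebra_simps)
  then have Dw: "w * euler w = euler P * S + P * euler S"
    by (simp only: mult_cancel_left) simp
  have "w * (P * euler w - w * euler P) = P * (w * euler w) - (w * w) * euler P"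
    by (simp add: algebra_simps)
  also have "\<dots> = P * (P * euler S - S * euler P)" unfolding Dw ww by (simp add: algebra_simps)
  finally show "theta_odd 1 * hecke_part1 = theta_even 2 * theta_wronskian 2"
    by (simp add: hecke_part1_def theta_wronskian_def w_def P_def S_def)
  have "w * (S * euler w - w * euler S) = S * (w * euler w) - (w * w) * euler S"
    by (simp add: algebra_simps)
  also have "\<dots> = - (S * (P * euler S - S * euler P))" unfolding Dw ww by (simp add: algebra_simps)
  finally show "theta_odd 1 * hecke_part3 = - (theta_odd 2 * theta_wronskian 2)"
    by (simp add: hecke_part3_def theta_wronskian_def w_def P_def S_def)
qed

lemma hecke_parts_product: "2 * (hecke_part1 * hecke_part3) = - 16 * jacobi_series ^ 4"
proof -
  define w P S K where "w = theta_odd 1" and "P = theta_even 2" and "S = theta_odd 2"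
    and "K = theta_wronskian 2"
  have ww: "w * w = 2 * (P * S)"
    using theta_odd_square by (simp add: w_def P_def S_def power2_eq_square)
  have "(w * w) * (2 * (hecke_part1 * hecke_part3)) = 2 * ((w * hecke_part1) * (w * hecke_part3))"
    by (simp only: mult_ac)
  also have "\<dots> = (w * w) * - (K * K)"
    unfolding theta_odd_times_hecke_parts [folded w_def P_def S_def K_def] ww by (simp add: mult_ac)
  finally have "(w * w) * (2 * (hecke_part1 * hecke_part3)) = (w * w) * - (K * K)" .
  moreover have "w * w \<noteq> 0" using theta_odd_nonzero by (simp add: w_def)
  ultimately have "2 * (hecke_part1 * hecke_part3) = - (K * K)" by (simp only: mult_cancel_left) simp
  also have "K * K = 16 * jacobi_series ^ 4"
    unfolding K_def theta_wronskian_2 by (simp add: power2_eq_square power4_eq_xxxx)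
  finally show ?thesis by simp
qed

text \<open>The square of the generating function at exponents 4 modulo 8: only the mixed product of the two parts
contributes, and that is a multiple of the fourth power of Jacobi's series.\<close>

lemma sum_hecke_theta_products:
  assumes "odd m"
  shows "(\<Sum>u\<in>{u. u \<le> 4 * m \<and> odd u}. hecke_theta u * hecke_theta (4 * m - u)) = - 16 * tau_6_4 m"
proof -
  define g where "g = hecke_part1 + hecke_part3"
  have g1: "supported_mod 2 1 g"
    unfolding g_def
    by (rule supported_mod_add [OF supported_mod_coarsen [OF supported_hecke_part1]
        supported_mod_cong [OF supported_mod_coarsen [OF supported_hecke_part3]]]) (simp_all add: cong_def)
  have m8: "(4 * m) mod 8 = 4" using assms by presburger
  have "(g * g) $ (4 * m) = (\<Sum>u=0..4*m. g $ u * g $ (4 * m - u))" by (rule fps_mult_nth)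
  also have "\<dots> = (\<Sum>u\<in>{u. u \<le> 4 * m \<and> odd u}. g $ u * g $ (4 * m - u))"
  proof (rule sum.mono_neutral_right)
    show "\<forall>u\<in>{0..4 * m} - {u. u \<le> 4 * m \<and> odd u}. g $ u * g $ (4 * m - u) = 0"
    proof
      fix u assume "u \<in> {0..4 * m} - {u. u \<le> 4 * m \<and> odd u}"
      then have "\<not> [u = 1] (mod 2)" by (auto simp: cong_def)
      from supported_mod_nth [OF g1 this] show "g $ u * g $ (4 * m - u) = 0" by simp
    qed
  qed auto
  also have "\<dots> = (\<Sum>u\<in>{u. u \<le> 4 * m \<and> odd u}. hecke_theta u * hecke_theta (4 * m - u))"
    by (rule sum.cong) (auto simp: g_def hecke_parts_nth simp del: fps_add_nth)
  finally have "(\<Sum>u\<in>{u. u \<le> 4 * m \<and> odd u}. hecke_theta u * hecke_theta (4 * m - u)) = (g * g) $ (4 * m)" ..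
  also have "g * g = hecke_part1 * hecke_part1 + hecke_part3 * hecke_part3 + 2 * (hecke_part1 * hecke_part3)"
    by (simp add: g_def algebra_simps)
  also have "2 * (hecke_part1 * hecke_part3) = fps_const (- 16) * jacobi_series ^ 4"
    unfolding hecke_parts_product by (simp add: numeral_fps_const)
  also have "(hecke_part1 * hecke_part1 + hecke_part3 * hecke_part3 + fps_const (- 16) * jacobi_series ^ 4) $ (4 * m)
    = - 16 * (jacobi_series ^ 4) $ (4 * m)"
  proof -
    have "(hecke_part1 * hecke_part1) $ (4 * m) = 0"
      by (rule supported_mod_nth [OF supported_mod_mult [OF supported_hecke_part1 supported_hecke_part1]])
        (simp add: cong_def m8)
    moreover have "(hecke_part3 * hecke_part3) $ (4 * m) = 0"
      by (rule supported_mod_nth [OF supported_mod_mult [OF supported_hecke_part3 supported_hecke_part3]])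
        (simp add: cong_def m8)
    ultimately show ?thesis by simp
  qed
  finally show ?thesis by (simp add: tau_6_4_eq)
qed

lemma genfun_one_mult_nth:
  fixes f :: "int fps"
  assumes "finite_fibres X Q"
  shows "(genfun X Q (\<lambda>_. 1) * f) $ n = (\<Sum>x\<in>{x\<in>X. Q x \<le> int n}. f $ (n - nat (Q x)))"
proof -
  let ?S = "{x\<in>X. Q x \<le> int n}"
  have fin: "finite ?S"
  proof (rule finite_subset)
    show "?S \<subseteq> (\<Union>i\<in>{0..int n}. {x\<in>X. Q x = i})"
      using assms by (auto simp: finite_fibres_def)
  qed (use assms in \<open>auto simp: finite_fibres_def\<close>)
  have "(\<Sum>x\<in>?S. f $ (n - nat (Q x))) = (\<Sum>i\<in>{0..n}. \<Sum>x\<in>{x\<in>?S. nat (Q x) = i}. f $ (n - nat (Q x)))"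
    by (rule sum.group [symmetric, OF fin]) (use assms in \<open>auto simp: finite_fibres_def\<close>)
  also have "\<dots> = (\<Sum>i\<in>{0..n}. genfun X Q (\<lambda>_. 1) $ i * f $ (n - i))"
  proof (rule sum.cong)
    fix i assume "i \<in> {0..n}"
    then have "{x\<in>?S. nat (Q x) = i} = {x\<in>X. Q x = int i}"
      using assms by (auto simp: finite_fibres_def)
    then show "(\<Sum>x\<in>{x\<in>?S. nat (Q x) = i}. f $ (n - nat (Q x))) = genfun X Q (\<lambda>_. 1) $ i * f $ (n - i)"
      by (simp add: genfun_nth)
  qed simp
  finally show ?thesis by (simp add: fps_mult_nth)
qed

lemma cusp_series_nth:
  assumes "odd m"
  shows "2 * cusp_series $ ((2 * m)\<^sup>2) = - (\<Sum>u\<in>{u. u \<le> 4 * m \<and> odd u}. hecke_theta (u * (4 * m - u)))"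
proof -
  \<comment> \<open>A pair \<open>(x, n - x\<^sup>2)\<close> with \<open>n = (2m)\<^sup>2\<close> is encoded by \<open>u = 2m - x\<close>, since \<open>n - x\<^sup>2 = u (4m - u)\<close>.\<close>
  define N where "N = (2 * m)\<^sup>2"
  have "2 * cusp_series = theta_odd 2 * theta_wronskian 2"
    unfolding theta_wronskian_2_product cusp_series_def by (simp add: power2_eq_square mult_ac)
  also have "\<dots> = - (theta_odd 1 * hecke_part3)"
    by (simp add: theta_odd_times_hecke_parts)
  finally have c: "fps_const 2 * cusp_series = - (theta_odd 1 * hecke_part3)"
    by (simp add: numeral_fps_const)
  have "2 * cusp_series $ N = (fps_const 2 * cusp_series) $ N" by simp
  also have "\<dots> = - ((theta_odd 1 * hecke_part3) $ N)" unfolding c by simp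
  also have "(theta_odd 1 * hecke_part3) $ N
    = (\<Sum>x\<in>{x\<in>{x. odd x}. 1 * x\<^sup>2 \<le> int N}. hecke_part3 $ (N - nat (1 * x\<^sup>2)))"
    unfolding theta_odd_def by (rule genfun_one_mult_nth [OF finite_fibres_square]) simp
  also have "\<dots> = (\<Sum>x\<in>{x\<in>{x. odd x}. 1 * x\<^sup>2 \<le> int N}. hecke_theta (N - nat (x\<^sup>2)))"
  proof (rule sum.cong)
    fix x :: int assume x: "x \<in> {x\<in>{x. odd x}. 1 * x\<^sup>2 \<le> int N}"
    then have le: "nat (x\<^sup>2) \<le> N" and "odd x" by auto
    have ev: "even N" by (simp add: N_def)
    have "odd (nat (x\<^sup>2))" using \<open>odd x\<close> by (simp add: even_nat_iff)
    then have "odd (N - nat (x\<^sup>2))" using le ev by simp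
    then have "hecke_theta (N - nat (x\<^sup>2)) = (hecke_part1 + hecke_part3) $ (N - nat (x\<^sup>2))"
      by (rule hecke_parts_nth [symmetric])
    moreover have "hecke_part1 $ (N - nat (x\<^sup>2)) = 0"
    proof (rule supported_mod_nth [OF supported_hecke_part1])
      obtain j where m: "m = 2 * j + 1" using assms by (rule oddE)
      obtain y where y: "x = 2 * y + 1" using \<open>odd x\<close> by (rule oddE)
      have "int (N - nat (x\<^sup>2)) = int N - x\<^sup>2" using le by (simp add: of_nat_diff)
      also have "\<dots> = 3 + 4 * (4 * (int j)\<^sup>2 + 4 * int j - y\<^sup>2 - y)"
        unfolding N_def m y by (simp add: power2_eq_square algebra_simps)
      finally obtain A Z where A: "N - nat (x\<^sup>2) = A" and e: "int A = 3 + 4 * Z" by blast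
      show "\<not> [N - nat (x\<^sup>2) = 1] (mod 8)"
        unfolding A cong_def using e by presburger
    qed
    ultimately show "hecke_part3 $ (N - nat (1 * x\<^sup>2)) = hecke_theta (N - nat (x\<^sup>2))" by simp
  qed simp
  also have "\<dots> = (\<Sum>u\<in>{u. u \<le> 4 * m \<and> odd u}. hecke_theta (u * (4 * m - u)))"
  proof (rule sum.reindex_bij_witness [where i = "\<lambda>u. 2 * int m - int u" and j = "\<lambda>x. nat (2 * int m - x)"])
    fix x :: int assume "x \<in> {x\<in>{x. odd x}. 1 * x\<^sup>2 \<le> int N}"
    then have "x\<^sup>2 \<le> (2 * int m)\<^sup>2" and "odd x" by (simp_all add: N_def)
    then have ab: "\<bar>x\<bar> \<le> 2 * int m" using abs_le_square_iff [of x "2 * int m"] by simp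
    then show "2 * int m - int (nat (2 * int m - x)) = x" by simp
    show "nat (2 * int m - x) \<in> {u. u \<le> 4 * m \<and> odd u}"
      using ab \<open>odd x\<close> by (auto simp: even_nat_iff)
    have "int (nat (2 * int m - x) * (4 * m - nat (2 * int m - x))) = (2 * int m - x) * (2 * int m + x)"
      using ab by (simp add: of_nat_diff)
    also have "\<dots> = int (N - nat (x\<^sup>2))"
    proof -
      have "nat (x\<^sup>2) \<le> N" using \<open>x\<^sup>2 \<le> (2 * int m)\<^sup>2\<close> by (simp add: N_def nat_le_iff)
      then show ?thesis by (simp add: of_nat_diff N_def power2_eq_square algebra_simps)
    qed
    finally show "hecke_theta (nat (2 * int m - x) * (4 * m - nat (2 * int m - x))) = hecke_theta (N - nat (x\<^sup>2))"
      by (simp only: of_nat_eq_iff)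
  next
    fix u assume u: "u \<in> {u. u \<le> 4 * m \<and> odd u}"
    show "nat (2 * int m - (2 * int m - int u)) = u" by simp
    have "\<bar>2 * int m - int u\<bar> \<le> \<bar>2 * int m\<bar>" using u by auto
    then have "(2 * int m - int u)\<^sup>2 \<le> (2 * int m)\<^sup>2" by (simp only: abs_le_square_iff)
    then show "2 * int m - int u \<in> {x\<in>{x. odd x}. 1 * x\<^sup>2 \<le> int N}" using u by (simp add: N_def)
  qed
  finally show ?thesis unfolding N_def .
qed

section \<open>The Shimura correspondence and the theorem\<close>

lemma prod_primes_dvd:
  fixes n :: nat
  assumes "finite T" "\<And>p. p \<in> T \<Longrightarrow> prime p" "\<And>p. p \<in> T \<Longrightarrow> p dvd n"
  shows "\<Prod>T dvd n"
  using assms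
proof (induction T rule: finite_induct)
  case (insert q T)
  have "coprime q (\<Prod>T)"
    using insert.hyps insert.prems by (intro coprime_prod_primes) auto
  moreover have "q dvd n" "\<Prod>T dvd n" using insert by auto
  ultimately have "q * \<Prod>T dvd n" by (intro divides_mult)
  then show ?case using insert.hyps by simp
qed simp

text \<open>A square-free divisor \<open>d\<close> of \<open>m\<close> divides \<open>4m - u\<close> as soon as it divides \<open>u\<close>, so dividing everything by \<open>d\<close>
gives the same sum for \<open>m / d\<close>.\<close>

lemma sum_sieve_hecke:
  assumes m: "odd m" and T: "T \<subseteq> prime_factors m"
  shows "(\<Sum>u\<in>{u. u \<le> 4 * m \<and> odd u}. quotient_value hecke_b u T * quotient_value hecke_b (4 * m - u) T)
    = - 4 * quotient_value tau_rat m T"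
proof -
  define D where "D = \<Prod>T"
  have "D dvd m"
    unfolding D_def using T by (intro prod_primes_dvd) (auto intro: finite_subset)
  then obtain k where k: "m = D * k" by (elim dvdE)
  have odds: "odd D" "odd k" using m unfolding k by auto
  have D0: "D > 0" using odds(1) by (rule odd_pos)
  have dvd_iff: "D dvd 4 * m - u \<longleftrightarrow> D dvd u" if "u \<le> 4 * m" for u
    using that \<open>D dvd m\<close> by (metis dvd_diffD1 dvd_diff_nat dvd_mult)
  have "(\<Sum>u\<in>{u. u \<le> 4 * m \<and> odd u}. quotient_value hecke_b u T * quotient_value hecke_b (4 * m - u) T)
    = (\<Sum>u\<in>{u. u \<le> 4 * m \<and> odd u \<and> D dvd u}. hecke_b (u div D) * hecke_b ((4 * m - u) div D))"
    by (rule sum.mono_neutral_cong_right) (auto simp: quotient_value_def D_def [symmetric] dvd_iff)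
  also have "\<dots> = (\<Sum>u\<in>{u. u \<le> 4 * k \<and> odd u}. hecke_b u * hecke_b (4 * k - u))"
  proof (rule sum.reindex_bij_witness [where i = "\<lambda>u. D * u" and j = "\<lambda>u. u div D"])
    fix u assume u: "u \<in> {u. u \<le> 4 * m \<and> odd u \<and> D dvd u}"
    then obtain v where v: "u = D * v" by blast
    have le: "D * v \<le> D * (4 * k)" and "odd (D * v)"
      using u unfolding k v by (simp_all add: mult_ac)
    show "D * (u div D) = u" unfolding v using D0 by simp
    show "u div D \<in> {u. u \<le> 4 * k \<and> odd u}" unfolding v using D0 le \<open>odd (D * v)\<close> by simp
    have "4 * m - u = D * (4 * k - v)" unfolding k v by (simp add: diff_mult_distrib2 mult_ac)
    then show "hecke_b (u div D) * hecke_b (4 * k - u div D) = hecke_b (u div D) * hecke_b ((4 * m - u) div D)"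
      unfolding v using D0 by simp
  next
    fix u assume "u \<in> {u. u \<le> 4 * k \<and> odd u}"
    then show "D * u \<in> {u. u \<le> 4 * m \<and> odd u \<and> D dvd u}" "D * u div D = u"
      using D0 odds(1) unfolding k by (simp_all add: mult_ac)
  qed
  also have "\<dots> = of_int (\<Sum>u\<in>{u. u \<le> 4 * k \<and> odd u}. hecke_theta u * hecke_theta (4 * k - u)) / 4"
    by (simp add: hecke_b_def sum_divide_distrib)
  also have "\<dots> = - 4 * tau_rat k"
    unfolding sum_hecke_theta_products [OF odds(2)] by (simp add: tau_rat_def)
  also have "tau_rat k = quotient_value tau_rat m T"
    using D0 by (simp add: quotient_value_def D_def [symmetric] k)
  finally show ?thesis .
qed

text \<open>Insert the inverse Hecke relation with \<open>v = 4m - u\<close> and exchange the sums. A common prime factor of \<open>u\<close> and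
\<open>4m - u\<close> is odd and divides \<open>m\<close>.\<close>

theorem cusp_series_C3:
  assumes m: "odd m"
  shows "cusp_series $ ((2 * m)\<^sup>2) = 4 * C3 m"
proof -
  let ?U = "{u. u \<le> 4 * m \<and> odd u}" and ?A = "prime_factors m"
  have m0: "m \<noteq> 0" using m by (metis dvd_0_right)
  have "hecke_b (u * (4 * m - u))
    = (\<Sum>T\<in>Pow ?A. (\<Prod>p\<in>T. - kappa p) * (quotient_value hecke_b u T * quotient_value hecke_b (4 * m - u) T))"
    if u: "u \<in> ?U" for u
  proof (rule hecke_relation_sieve [OF hecke_b_splits hecke_b_prime_powers])
    show "prime p \<and> odd p" if "p \<in> ?A" for p
      using that m by (metis dvd_trans in_prime_factors_iff)
    show "odd u" "odd (4 * m - u)" using u by auto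
    show "p \<in> ?A" if "prime p" "p dvd u" "p dvd 4 * m - u" for p
    proof -
      have "p dvd 4 * m" using that u by (metis (mono_tags, lifting) dvd_diffD mem_Collect_eq)
      moreover have "\<not> p dvd 4"
      proof
        assume "p dvd 4"
        then have "p dvd 2 ^ 2" by simp
        with \<open>prime p\<close> have "p dvd 2" by (rule prime_dvd_power)
        with \<open>prime p\<close> have "p = 2" by (simp add: primes_dvd_imp_eq)
        then show False using that(2) u by simp
      qed
      ultimately have "p dvd m" using \<open>prime p\<close> by (simp add: prime_dvd_mult_iff)
      then show ?thesis using \<open>prime p\<close> m0 by (simp add: in_prime_factors_iff)
    qed
  qed auto
  then have "(\<Sum>u\<in>?U. hecke_b (u * (4 * m - u)))
    = (\<Sum>u\<in>?U. \<Sum>T\<in>Pow ?A. (\<Prod>p\<in>T. - kappa p) * (quotient_value hecke_b u T * quotient_value hecke_b (4 * m - u) T))"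
    by (intro sum.cong) auto
  also have "\<dots> = (\<Sum>T\<in>Pow ?A. (\<Prod>p\<in>T. - kappa p)
      * (\<Sum>u\<in>?U. quotient_value hecke_b u T * quotient_value hecke_b (4 * m - u) T))"
    unfolding sum_distrib_left by (rule sum.swap)
  also have "\<dots> = (\<Sum>T\<in>Pow ?A. - 4 * ((\<Prod>p\<in>T. - kappa p) * quotient_value tau_rat m T))"
    using sum_sieve_hecke [OF m] by (intro sum.cong) auto
  also have "\<dots> = - 4 * of_int (C3 m)"
    unfolding C3_sieve [OF m] sum_distrib_left ..
  finally have "(\<Sum>u\<in>?U. hecke_b (u * (4 * m - u))) = - 4 * of_int (C3 m)" .
  moreover have "(of_int (2 * cusp_series $ ((2 * m)\<^sup>2)) :: rat) = - 2 * (\<Sum>u\<in>?U. hecke_b (u * (4 * m - u)))"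
    unfolding cusp_series_nth [OF m] by (simp add: hecke_b_def sum_divide_distrib [symmetric])
  ultimately have "(of_int (2 * cusp_series $ ((2 * m)\<^sup>2)) :: rat) = of_int (8 * C3 m)" by simp
  then show ?thesis by (simp only: of_int_eq_iff)
qed

theorem proposition4p6:
  fixes n m :: nat
  assumes "n \<ge> 1"
    and "m = n div 2 ^ multiplicity 2 n"
  shows "([n = 0] (mod 4) \<longrightarrow>
            r7 [1,2,2,2,2,2,4] (n\<^sup>2) = r7 [1,1,2,2,2,4,4] (n\<^sup>2)
          \<and> r7 [1,1,2,2,2,4,4] (n\<^sup>2) = r7 [1,1,1,2,4,4,4] (n\<^sup>2)
          \<and> r7 [1,1,1,2,2,2,4] (n\<^sup>2) = r7 [1,1,1,1,2,4,4] (n\<^sup>2))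
       \<and> ([n = 2] (mod 4) \<longrightarrow>
            4 * C3 m = int (r7 [1,2,2,2,2,2,4] (n\<^sup>2)) - 2 * int (r7 [1,2,2,2,4,4,4] (n\<^sup>2))
          \<and> 4 * C3 m = int (r7 [1,1,2,2,2,4,4] (n\<^sup>2)) - 2 * int (r7 [1,2,2,2,4,4,4] (n\<^sup>2))
          \<and> 4 * C3 m = int (r7 [1,2,2,2,2,2,4] (n\<^sup>2)) - 2 * int (r7 [1,1,2,4,4,4,4] (n\<^sup>2))
          \<and> 4 * C3 m = int (r7 [1,1,2,2,2,4,4] (n\<^sup>2)) - 2 * int (r7 [1,1,2,4,4,4,4] (n\<^sup>2))
          \<and> 8 * C3 m = int (r7 [1,2,2,2,2,2,4] (n\<^sup>2)) - int (r7 [1,1,1,2,4,4,4] (n\<^sup>2))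
          \<and> 8 * C3 m = int (r7 [1,1,2,2,2,4,4] (n\<^sup>2)) - int (r7 [1,1,1,2,4,4,4] (n\<^sup>2))
          \<and> int (r7 [1,2,2,2,2,2,4] (n\<^sup>2))
              = 4 * int (r7 [1,1,2,4,4,4,4] (n\<^sup>2)) - int (r7 [1,1,1,2,4,4,4] (n\<^sup>2)))"
proof (rule conjI; rule impI)
  assume "[n = 0] (mod 4)"
  then obtain k where k: "n = 4 * k" by (auto simp: cong_0_iff)
  have "8 dvd n\<^sup>2" "4 dvd n\<^sup>2" unfolding k power2_eq_square by simp_all
  from r7_relations [OF this(2)] this(1)
  show "r7 [1,2,2,2,2,2,4] (n\<^sup>2) = r7 [1,1,2,2,2,4,4] (n\<^sup>2)
          \<and> r7 [1,1,2,2,2,4,4] (n\<^sup>2) = r7 [1,1,1,2,4,4,4] (n\<^sup>2)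
          \<and> r7 [1,1,1,2,2,2,4] (n\<^sup>2) = r7 [1,1,1,1,2,4,4] (n\<^sup>2)"
    by simp
next
  assume "[n = 2] (mod 4)"
  then have "n mod 4 = 2" by (simp add: cong_def)
  then have n: "n = 2 * (2 * (n div 4) + 1)" by presburger
  have "\<not> 2 ^ Suc 1 dvd n" using \<open>n mod 4 = 2\<close> by (simp add: dvd_eq_mod_eq_0)
  moreover have "2 ^ 1 dvd n" by (subst n) simp
  ultimately have "multiplicity 2 n = 1" by (intro multiplicity_eqI)
  then have m: "m = 2 * (n div 4) + 1" using assms(2) n by simp
  have "odd m" by (simp add: m)
  have "n = 2 * m" using m n by simp
  then have N: "n\<^sup>2 = 4 * m\<^sup>2" "n\<^sup>2 = (2 * m)\<^sup>2" by (simp_all add: power2_eq_square)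
  have "4 dvd n\<^sup>2" unfolding N(1) by simp
  moreover have "\<not> 8 dvd n\<^sup>2"
  proof
    assume "8 dvd n\<^sup>2"
    then obtain j where "4 * m\<^sup>2 = 8 * j" unfolding N(1) by (elim dvdE)
    then have "m\<^sup>2 = 2 * j" by simp
    then have "even (m\<^sup>2)" by simp
    then show False using \<open>odd m\<close> by simp
  qed
  moreover have "cusp_series $ (n\<^sup>2) = 4 * C3 m"
    unfolding N(2) using \<open>odd m\<close> by (rule cusp_series_C3)
  ultimately show "4 * C3 m = int (r7 [1,2,2,2,2,2,4] (n\<^sup>2)) - 2 * int (r7 [1,2,2,2,4,4,4] (n\<^sup>2))
          \<and> 4 * C3 m = int (r7 [1,1,2,2,2,4,4] (n\<^sup>2)) - 2 * int (r7 [1,2,2,2,4,4,4] (n\<^sup>2))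
          \<and> 4 * C3 m = int (r7 [1,2,2,2,2,2,4] (n\<^sup>2)) - 2 * int (r7 [1,1,2,4,4,4,4] (n\<^sup>2))
          \<and> 4 * C3 m = int (r7 [1,1,2,2,2,4,4] (n\<^sup>2)) - 2 * int (r7 [1,1,2,4,4,4,4] (n\<^sup>2))
          \<and> 8 * C3 m = int (r7 [1,2,2,2,2,2,4] (n\<^sup>2)) - int (r7 [1,1,1,2,4,4,4] (n\<^sup>2))
          \<and> 8 * C3 m = int (r7 [1,1,2,2,2,4,4] (n\<^sup>2)) - int (r7 [1,1,1,2,4,4,4] (n\<^sup>2))
          \<and> int (r7 [1,2,2,2,2,2,4] (n\<^sup>2))
              = 4 * int (r7 [1,1,2,4,4,4,4] (n\<^sup>2)) - int (r7 [1,1,1,2,4,4,4] (n\<^sup>2))"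
    using r7_relations [of "n\<^sup>2"] by linarith
qed

end
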